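(* Let $p\ge1$, let $\mathcal{T}$ be a regular triangulation of $\Omega$ generated by NVB from a regular triangulation $\widehat{\mathcal{T}}_0$, let $\widehat{\mathcal{T}}_\ell$ be the uniform refinement of $\widehat{\mathcal{T}}_0$ of level $\ell$, and $\widetilde{\mathcal{T}}_\ell:=\mathtt{fcc}(\mathcal{T},\widehat{\mathcal{T}}_\ell)$. Let $\widetilde I^{SZ}_\ell:L^2(\Omega)\to S^{p,1}(\widetilde{\mathcal{T}}_\ell)$ and $\widehat I^{SZ}_\ell:L^2(\Omega)\to S^{p,1}(\widehat{\mathcal{T}}_\ell)$ be the adapted Scott-Zhang operators. Then $$\widetilde I^{SZ}_\ell u=\widehat I^{SZ}_\ell u\qquad\forall u\in S^{p,1}(\mathcal{T}).$$
   Context: $S^{p,1}(\mathcal{T}'):=\{u\in H^1(\Omega):u|_T\in P_p(T)\ \forall T\in\mathcal{T}'\}$. NVB. Newest vertex bisection starts from a regular (Ciarlet, no hanging nodes) simplicial triangulation $\widehat{\mathcal{T}}_0$ with a fixed admissible labelling of refinement edges; each simplex is bisected through the midpoint of its refinement edge into two children whose refinement edges are given by a fixed rule. All simplices so obtained belong to one fixed infinite binary forest with roots $\widehat{\mathcal{T}}_0$, and any two of them are disjoint or nested (elements are open simplices). $\widehat{\mathcal{T}}_\ell$ is a regular, quasi-uniform mesh in which every element of $\widehat{\mathcal{T}}_{\ell-1}$ has been bisected the same number of times so that the mesh size is halved. Finest common coarsening: $\mathtt{fcc}(\mathcal{T},\mathcal{T}'):=\{T\in\mathcal{T}:\exists T'\in\mathcal{T}',T'\subsetneq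 T\}\cup\{T'\in\mathcal{T}':\exists T\in\mathcal{T},T\subsetneq T'\}\cup(\mathcal{T}\cap\mathcal{T}')$; for regular NVB-refinements of the same triangulation this is a regular triangulation. Scott-Zhang operators. For a regular mesh $\mathcal{T}'$, $\mathcal{N}(\mathcal{T}')\subset\overline\Omega$ is the set of images under the affine element maps of the principal lattice nodes $\{\sum_{j=1}^{d+1}\lambda_jz_j:\sum_j\lambda_j=1,\lambda_j\in\{i/p:i=0,\dots,p\}\}$ of the reference simplex $\operatorname{conv}\{z_1,\dots,z_{d+1}\}$; $\{\varphi_{z,\mathcal{T}'}\}$ is the Lagrange basis of $S^{p,1}(\mathcal{T}')$ with $\varphi_{z,\mathcal{T}'}(z')=\delta_{z,z'}$; for $T\in\mathcal{T}'$, $\{\varphi^*_{z,T}:z\in\mathcal{N}(\mathcal{T}')\cap\overline T\}\subset P_p(T)$ is the dual basis, $\int_T\varphi^*_{z,T}\varphi_{z',\mathcal{T}'}\,dx=\delta_{z,z'}$. With $\mathcal{A}(z,\mathcal{T}'):=\{T\in\mathcal{T}':z\in\overline T\}$, a Scott-Zhang operator is $I^{SZ}u=\sum_{z\in\mathcal{N}(\mathcal{T}')}\varphi_{z,\mathcal{T}'}\int_{T_z}\varphi^*_{z,T_z}u\,dx$ with a selected averaging element $T_z\in\mathcal{A}(z,\mathcal{T}')$ for each $z$. Adapted Scott-Zhang operators: the Scott-Zhang operators on $\widetilde{\mathcal{T}}_\ell$ and $\widehat{\mathcal{T}}_\ell$ with the following choice of $T_z$: (1) Loop through all $T\in\widehat{\mathcal{T}}_\ell\cap\widetilde{\mathcal{T}}_\ell$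 (in any fixed order). For nodes $z\in\overline T$: (a) if $z\in T$, take $T_z=T$ for both operators; (b) if $z\in\partial T$ and $z$ has no averaging element yet: (i) if $\mathcal{A}(z,\widehat{\mathcal{T}}_\ell)$ contains an element $T'\in\widehat{\mathcal{T}}_\ell$ that is a proper subset of some $\widetilde T\in\mathcal{T}$, take $T'$ for $\widehat I^{SZ}_\ell$ and $\widetilde T$ for $\widetilde I^{SZ}_\ell$; (ii) else take $T$ for both. (2) Loop through all $T\in\widetilde{\mathcal{T}}_\ell\setminus\widehat{\mathcal{T}}_\ell$ (any fixed order): for $\widetilde I^{SZ}_\ell$, take $T$ as averaging element for all nodes $z\in\overline T$ not yet fixed. (3) Loop through all $T\in\widehat{\mathcal{T}}_\ell\setminus\widetilde{\mathcal{T}}_\ell$ (any fixed order): for $\widehat I^{SZ}_\ell$, take $T$ as averaging element for all nodes $z\in\overline T$ not yet fixed.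
   Formalization: Ω is assumed to be a bounded open set with Lipschitz (locally graph) boundary, which the statement leaves unsaid; if elements may touch only at a vertex, functions in S^{p,1}(𝒯) can jump there and the two operators can differ. *)

theory Defs
  imports "HOL-Analysis.Analysis"
begin

section \<open>Domains, polynomials and Sobolev functions\<close>

text \<open>Bounded open sets whose boundary is locally the graph of a Lipschitz function, with the
  set lying on one side of it. Some such condition is indispensable: if two elements may touch in
  a vertex without being linked through a chain of faces, then piecewise polynomials in $H^1$ need
  not be continuous at that vertex and the nodal functions below do not span the spline space.\<close>

definition lipschitz_domain :: "'a::euclidean_space set \<Rightarrow> bool" where
  "lipschitz_domain \<Omega> \<longleftrightarrow> open \<Omega> \<and> bounded \<Omega> \<and>
     (\<forall>x\<in>frontier \<Omega>. \<exists>r>0. \<exists>e L. \<exists>g::'a \<Rightarrow> real.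
        norm e = 1 \<and> L-lipschitz_on UNIV g \<and>
        \<Omega> \<inter> ball x r = {y \<in> ball x r. g (y - (y \<bullet> e) *\<^sub>R e) < y \<bullet> e})"

definition multi_indices :: "nat \<Rightarrow> ('a::euclidean_space \<Rightarrow> nat) set" where
  "multi_indices p = {\<alpha> \<in> Basis \<rightarrow>\<^sub>E UNIV. (\<Sum>i\<in>Basis. \<alpha> i) \<le> p}"

definition poly_le :: "nat \<Rightarrow> ('a::euclidean_space \<Rightarrow> real) \<Rightarrow> bool" where
  "poly_le p q \<longleftrightarrow>
     (\<exists>c. \<forall>x. q x = (\<Sum>\<alpha>\<in>multi_indices p. c \<alpha> * (\<Prod>i\<in>Basis. (x \<bullet> i) ^ \<alpha> i)))"

text \<open>Elements of $L^2$ and $H^1$ are represented by functions; only their values almost everywhere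
  in \<open>\<Omega>\<close> matter. Test functions are of class $C^1_c$, which gives the same weak
  gradients as $C^\infty_c$.\<close>

definition square_integrable ::
    "'a::euclidean_space set \<Rightarrow> ('a \<Rightarrow> 'b::euclidean_space) \<Rightarrow> bool" where
  "square_integrable \<Omega> f \<longleftrightarrow>
     f \<in> borel_measurable (lebesgue_on \<Omega>) \<and> integrable (lebesgue_on \<Omega>) (\<lambda>x. (norm (f x))\<^sup>2)"

definition test_function :: "'a::euclidean_space set \<Rightarrow> ('a \<Rightarrow> real) \<Rightarrow> ('a \<Rightarrow> 'a) \<Rightarrow> bool" where
  "test_function \<Omega> \<psi> \<psi>' \<longleftrightarrow>
     (\<forall>x. GDERIV \<psi> x :> \<psi>' x) \<and> continuous_on UNIV \<psi>' \<and>
     (\<exists>K. compact K \<and> K \<subseteq> \<Omega> \<and> (\<forall>x. x \<notin> K \<longrightarrow> \<psi> x = 0))"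

definition weak_gradient :: "'a::euclidean_space set \<Rightarrow> ('a \<Rightarrow> real) \<Rightarrow> ('a \<Rightarrow> 'a) \<Rightarrow> bool" where
  "weak_gradient \<Omega> u g \<longleftrightarrow>
     (\<forall>\<psi> \<psi>'. test_function \<Omega> \<psi> \<psi>' \<longrightarrow>
        integral\<^sup>L (lebesgue_on \<Omega>) (\<lambda>x. u x *\<^sub>R \<psi>' x)
          = - integral\<^sup>L (lebesgue_on \<Omega>) (\<lambda>x. \<psi> x *\<^sub>R g x))"

definition H1 :: "'a::euclidean_space set \<Rightarrow> ('a \<Rightarrow> real) set" where
  "H1 \<Omega> = {u. square_integrable \<Omega> u \<and> (\<exists>g. square_integrable \<Omega> g \<and> weak_gradient \<Omega> u g)}"


section \<open>Triangulations and newest vertex bisection\<close>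

text \<open>Elements are open simplices. Disjointness of distinct elements follows from the
  common-face condition contained in \<open>triangulation\<close>.\<close>

definition regular_triangulation :: "'a::euclidean_space set \<Rightarrow> 'a set set \<Rightarrow> bool" where
  "regular_triangulation \<Omega> \<T> \<longleftrightarrow>
     (\<forall>T\<in>\<T>. \<exists>K. int DIM('a) simplex K \<and> T = interior K) \<and>
     triangulation (closure ` \<T>) \<and> \<Union>(closure ` \<T>) = closure \<Omega>"

text \<open>A labelled simplex $(z_0,\dots,z_d)_\gamma$ is an ordering of the vertices together with a
  type $\gamma < d$. Its refinement edge is the segment from $z_0$ to $z_d$; with $m$ the midpoint of
  that edge, the children are
  $(z_0,m,z_1,\dots,z_\gamma,z_{\gamma+1},\dots,z_{d-1})$ and
  $(z_d,m,z_1,\dots,z_\gamma,z_{d-1},\dots,z_{\gamma+1})$, both of type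
  $(\gamma+1)$ mod $d$ (the rule of Maubach, Traxler and Stevenson).\<close>

type_synonym 'a lsimplex = "'a list \<times> nat"

fun lchildren :: "'a::euclidean_space lsimplex \<Rightarrow> 'a lsimplex set" where
  "lchildren (zs, \<gamma>) =
     (let m = midpoint (hd zs) (last zs);
          mid = butlast (tl zs);
          \<gamma>' = Suc \<gamma> mod DIM('a)
      in {(hd zs # m # take \<gamma> mid @ drop \<gamma> mid, \<gamma>'),
          (last zs # m # take \<gamma> mid @ rev (drop \<gamma> mid), \<gamma>')})"

definition element :: "'a::euclidean_space lsimplex \<Rightarrow> 'a set" where
  "element t = interior (convex hull (set (fst t)))"

definition mesh :: "'a::euclidean_space lsimplex set \<Rightarrow> 'a set set" where
  "mesh L = element ` L"

text \<open>One level of uniform refinement bisects every element \<open>DIM('a)\<close> times,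
  which halves the mesh size.\<close>

definition uniform_refinement ::
    "'a::euclidean_space lsimplex set \<Rightarrow> nat \<Rightarrow> 'a lsimplex set" where
  "uniform_refinement L l = ((\<lambda>M. \<Union>(lchildren ` M)) ^^ (DIM('a) * l)) L"

text \<open>A regular triangulation with one label per element; the labelling is admissible if the
  uniform refinements are regular.\<close>

definition admissible_labelling ::
    "'a::euclidean_space set \<Rightarrow> 'a lsimplex set \<Rightarrow> bool" where
  "admissible_labelling \<Omega> L \<longleftrightarrow>
     (\<forall>(zs, \<gamma>)\<in>L. length zs = Suc DIM('a) \<and> distinct zs \<and> \<not> affine_dependent (set zs)
        \<and> \<gamma> < DIM('a)) \<and>
     inj_on element L \<and>
     regular_triangulation \<Omega> (mesh L) \<and>
     (\<forall>l. regular_triangulation \<Omega> (mesh (uniform_refinement L l)))"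

text \<open>Everything reachable by finitely many bisections of single elements; hanging nodes are
  allowed here and are excluded by requiring regularity of the resulting mesh.\<close>

inductive nvb_refinement ::
    "'a::euclidean_space lsimplex set \<Rightarrow> 'a lsimplex set \<Rightarrow> bool" for L\<^sub>0 where
  start: "nvb_refinement L\<^sub>0 L\<^sub>0"
| bisect: "nvb_refinement L\<^sub>0 L \<Longrightarrow> t \<in> L \<Longrightarrow> nvb_refinement L\<^sub>0 ((L - {t}) \<union> lchildren t)"

definition fcc :: "'a set set \<Rightarrow> 'a set set \<Rightarrow> 'a set set" where
  "fcc \<T> \<T>' = {T\<in>\<T>. \<exists>T'\<in>\<T>'. T' \<subset> T} \<union> {T'\<in>\<T>'. \<exists>T\<in>\<T>. T \<subset> T'} \<union> (\<T> \<inter> \<T>')"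


section \<open>Spline spaces and Scott-Zhang operators\<close>

definition spline_space ::
    "nat \<Rightarrow> 'a::euclidean_space set \<Rightarrow> 'a set set \<Rightarrow> ('a \<Rightarrow> real) set" where
  "spline_space p \<Omega> \<T> =
     {u \<in> H1 \<Omega>. \<forall>T\<in>\<T>. \<exists>q. poly_le p q \<and> (AE x in lebesgue_on T. u x = q x)}"

definition vertices :: "'a::euclidean_space set \<Rightarrow> 'a set" where
  "vertices T = {v. v extreme_point_of closure T}"

text \<open>An affine element map sends the vertices of the reference simplex to those of \<open>T\<close> and
  preserves barycentric coordinates.\<close>

definition nodes :: "nat \<Rightarrow> 'a::euclidean_space set set \<Rightarrow> 'a set" where
  "nodes p \<T> = (\<Union>T\<in>\<T>. {(\<Sum>v\<in>vertices T. lam v *\<^sub>R v) | lam.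
     (\<Sum>v\<in>vertices T. lam v) = 1 \<and> (\<forall>v\<in>vertices T. lam v \<in> {real i / real p | i. i \<le> p})})"

text \<open>Nodal values refer to the continuous representative.\<close>

definition lagrange_basis ::
    "nat \<Rightarrow> 'a::euclidean_space set \<Rightarrow> 'a set set \<Rightarrow> ('a \<Rightarrow> 'a \<Rightarrow> real) \<Rightarrow> bool" where
  "lagrange_basis p \<Omega> \<T> \<phi> \<longleftrightarrow>
     (\<forall>z\<in>nodes p \<T>. \<phi> z \<in> spline_space p \<Omega> \<T> \<and> continuous_on (closure \<Omega>) (\<phi> z) \<and>
        (\<forall>z'\<in>nodes p \<T>. \<phi> z z' = (if z = z' then 1 else 0)))"

text \<open>\<open>\<phi>s T z\<close> is the function $\varphi^*_{z,T}$.\<close>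

definition dual_basis ::
    "nat \<Rightarrow> 'a::euclidean_space set set \<Rightarrow> ('a \<Rightarrow> 'a \<Rightarrow> real) \<Rightarrow> ('a set \<Rightarrow> 'a \<Rightarrow> 'a \<Rightarrow> real) \<Rightarrow> bool"
    where
  "dual_basis p \<T> \<phi> \<phi>s \<longleftrightarrow>
     (\<forall>T\<in>\<T>. \<forall>z \<in> nodes p \<T> \<inter> closure T.
        (\<exists>q. poly_le p q \<and> (\<forall>x\<in>T. \<phi>s T z x = q x)) \<and>
        (\<forall>z' \<in> nodes p \<T> \<inter> closure T.
           integral\<^sup>L (lebesgue_on T) (\<lambda>x. \<phi>s T z x * \<phi> z' x) = (if z = z' then 1 else 0)))"

text \<open>\<open>\<tau> z\<close> is the averaging element of the node \<open>z\<close>.\<close>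

definition scott_zhang ::
    "nat \<Rightarrow> 'a::euclidean_space set set \<Rightarrow> ('a \<Rightarrow> 'a \<Rightarrow> real) \<Rightarrow> ('a set \<Rightarrow> 'a \<Rightarrow> 'a \<Rightarrow> real) \<Rightarrow>
     ('a \<Rightarrow> 'a set) \<Rightarrow> ('a \<Rightarrow> real) \<Rightarrow> 'a \<Rightarrow> real" where
  "scott_zhang p \<T> \<phi> \<phi>s \<tau> u x =
     (\<Sum>z\<in>nodes p \<T>. \<phi> z x * integral\<^sup>L (lebesgue_on (\<tau> z)) (\<lambda>y. \<phi>s (\<tau> z) z y * u y))"


section \<open>Adapted averaging elements\<close>

definition node_patch :: "'a::euclidean_space \<Rightarrow> 'a set set \<Rightarrow> 'a set set" where
  "node_patch z \<T> = {T\<in>\<T>. z \<in> closure T}"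

text \<open>Throughout, \<open>Tt\<close> is the coarsened mesh, \<open>Th\<close> the uniform one, and \<open>\<tau>t\<close>, \<open>\<tau>h\<close> are the
  partial assignments of averaging elements for the respective operators.\<close>

definition fine_coarse_pairs ::
    "'a::euclidean_space set set \<Rightarrow> 'a set set \<Rightarrow> 'a \<Rightarrow> ('a set \<times> 'a set) set" where
  "fine_coarse_pairs \<T> Th z = {(T', K). T' \<in> node_patch z Th \<and> K \<in> \<T> \<and> T' \<subset> K}"

text \<open>Body of the first loop, for an element \<open>T\<close> common to both meshes. It is a relation because
  the pair selected for a boundary node is arbitrary.\<close>

definition common_step ::
    "nat \<Rightarrow> 'a::euclidean_space set set \<Rightarrow> 'a set set \<Rightarrow> 'a set set \<Rightarrow> 'a set \<Rightarrow>
     ('a \<rightharpoonup> 'a set) \<times> ('a \<rightharpoonup> 'a set) \<Rightarrow> ('a \<rightharpoonup> 'a set) \<times> ('a \<rightharpoonup> 'a set) \<Rightarrow> bool" where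
  "common_step p \<T> Tt Th T = (\<lambda>(\<tau>t, \<tau>h) (\<tau>t', \<tau>h').
     \<forall>z. if z \<in> nodes p Tt \<union> nodes p Th \<and> z \<in> T
         then \<tau>t' z = Some T \<and> \<tau>h' z = Some T
         else if z \<in> nodes p Tt \<union> nodes p Th \<and> z \<in> frontier T \<and> \<tau>t z = None \<and> \<tau>h z = None
         then (if fine_coarse_pairs \<T> Th z \<noteq> {}
               then \<exists>(T', K) \<in> fine_coarse_pairs \<T> Th z. \<tau>h' z = Some T' \<and> \<tau>t' z = Some K
               else \<tau>t' z = Some T \<and> \<tau>h' z = Some T)
         else \<tau>t' z = \<tau>t z \<and> \<tau>h' z = \<tau>h z)"

primrec loop :: "('x \<Rightarrow> 's \<Rightarrow> 's \<Rightarrow> bool) \<Rightarrow> 'x list \<Rightarrow> 's \<Rightarrow> 's \<Rightarrow> bool" where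
  "loop R [] s s' \<longleftrightarrow> s' = s"
| "loop R (x # xs) s s' \<longleftrightarrow> (\<exists>s''. R x s s'' \<and> loop R xs s'' s')"

definition fill_step ::
    "nat \<Rightarrow> 'a::euclidean_space set set \<Rightarrow> 'a set \<Rightarrow> ('a \<rightharpoonup> 'a set) \<Rightarrow> ('a \<rightharpoonup> 'a set)" where
  "fill_step p \<M> T a =
     (\<lambda>z. if z \<in> nodes p \<M> \<inter> closure T \<and> a z = None then Some T else a z)"

text \<open>The lists are the orders in which the three loops are run.\<close>

definition adapted_averaging ::
    "nat \<Rightarrow> 'a::euclidean_space set set \<Rightarrow> 'a set set \<Rightarrow> 'a set set \<Rightarrow>
     ('a \<rightharpoonup> 'a set) \<Rightarrow> ('a \<rightharpoonup> 'a set) \<Rightarrow> bool" where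
  "adapted_averaging p \<T> Tt Th \<tau>t \<tau>h \<longleftrightarrow>
     (\<exists>xs ys zs \<tau>t\<^sub>1 \<tau>h\<^sub>1.
        distinct xs \<and> set xs = Th \<inter> Tt \<and>
        distinct ys \<and> set ys = Tt - Th \<and>
        distinct zs \<and> set zs = Th - Tt \<and>
        loop (common_step p \<T> Tt Th) xs (Map.empty, Map.empty) (\<tau>t\<^sub>1, \<tau>h\<^sub>1) \<and>
        \<tau>t = fold (fill_step p Tt) ys \<tau>t\<^sub>1 \<and>
        \<tau>h = fold (fill_step p Th) zs \<tau>h\<^sub>1)"

end

theory Submission
  imports Defs "HOL-Computational_Algebra.Polynomial"
begin

text \<open>An element of the coarsened mesh that is not in the uniform one belongs to \<open>\<T>\<close>, so
  \<open>u\<close> is a polynomial there. The choice of averaging elements ensures that every node of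
  either mesh on its closure is averaged over an element on which \<open>u\<close> is a polynomial; the
  dual basis then returns the value of that polynomial at the node. As \<open>u\<close> is in $H^1$ and
  \<open>\<Omega>\<close> is Lipschitz, the polynomials of elements that share a point agree there, so both
  operators reproduce \<open>u\<close> on the closure of such an element. On an element common to the two
  meshes the local bases, their duals and the averaging elements coincide, up to nodes of the
  first kind.\<close>

section \<open>Polynomials\<close>

text \<open>The obstacle is a common element that \<open>\<T>\<close> refines: there
  \<open>u\<close> is only piecewise polynomial, and an average over it need not be a nodal value.
  Clause (i) of the first loop keeps every node that touches a strictly coarser element of
  \<open>\<T>\<close> away from such elements. At the other nodes of common elements both operators
  use the same functional, so their coefficients agree although nothing is known about the value.
  Agreement of the polynomials at shared points is obtained without traces and without chains of
  faces. Mollified values of \<open>u\<close> are Lipschitz along segments inside \<Omega>, with a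
  bound on the polynomial gradients as constant, and near a point of the closure of a Lipschitz
  domain any two points of \<Omega> are joined by a path whose length is at most a constant times
  their distance. Regularity of the coarsened mesh is replaced by a weaker property: all its
  elements whose closure contains a given point agree on whether that point is a lattice
  point.\<close>

inductive polyd :: "nat \<Rightarrow> ('a::euclidean_space \<Rightarrow> real) \<Rightarrow> bool" where
  const: "polyd n (\<lambda>x. c)"
| add: "polyd n f \<Longrightarrow> polyd n g \<Longrightarrow> polyd n (\<lambda>x. f x + g x)"
| inner: "polyd n f \<Longrightarrow> polyd (Suc n) (\<lambda>x. (x \<bullet> b) * f x)"
| Suc: "polyd n f \<Longrightarrow> polyd (Suc n) f"

lemma polyd_cmult: "polyd n f \<Longrightarrow> polyd n (\<lambda>x. c * f x)"
proof (induction rule: polyd.induct)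
  case (add n f g)
  then show ?case using polyd.add[OF add.IH] by (simp add: distrib_left)
next
  case (inner n f b)
  then show ?case using polyd.inner[OF inner.IH] by (simp add: mult.left_commute)
qed (auto intro: polyd.intros)

lemma polyd_diff: "polyd n f \<Longrightarrow> polyd n g \<Longrightarrow> polyd n (\<lambda>x. f x - g x)"
  using polyd.add[OF _ polyd_cmult[of n g "-1"]] by simp

lemma polyd_sum: "(\<And>i. i \<in> I \<Longrightarrow> polyd n (f i)) \<Longrightarrow> polyd n (\<lambda>x. \<Sum>i\<in>I. f i x)"
  by (induction I rule: infinite_finite_induct) (auto intro: polyd.intros)

lemma polyd_mono: "polyd m f \<Longrightarrow> m \<le> n \<Longrightarrow> polyd n f"
  by (rule dec_induct[of m n "\<lambda>k. polyd k f"]) (blast intro: polyd.Suc)+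

lemma polyd_power_mult: "polyd n f \<Longrightarrow> polyd (m + n) (\<lambda>x. (x \<bullet> b) ^ m * f x)"
  by (induction m) (auto dest: polyd.inner[of _ _ b] simp: mult.assoc)

lemma polyd_monomial:
  "finite I \<Longrightarrow> polyd (\<Sum>i\<in>I. \<alpha> i) (\<lambda>x. \<Prod>i\<in>I. (x \<bullet> i) ^ \<alpha> i)"
  by (induction I rule: finite_induct) (auto intro: polyd.const dest: polyd_power_mult)

text \<open>This leaves the coefficient form behind: for \<open>polyd\<close>, which bounds the
  degree from above, stability under translations, differences and restriction to lines follows by
  rule induction.\<close>

lemma poly_le_imp_polyd:
  assumes "poly_le p q"
  shows "polyd p q"
proof -
  obtain c where c: "\<And>x. q x = (\<Sum>\<alpha>\<in>multi_indices p. c \<alpha> * (\<Prod>i\<in>Basis. (x \<bullet> i) ^ \<alpha> i))"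
    using assms unfolding poly_le_def by blast
  have "polyd p (\<lambda>x. \<Sum>\<alpha>\<in>multi_indices p. c \<alpha> * (\<Prod>i\<in>Basis. (x \<bullet> i) ^ \<alpha> i))"
    by (intro polyd_sum polyd_cmult polyd_mono[OF polyd_monomial]) (auto simp: multi_indices_def)
  then show ?thesis
    using c by presburger
qed

lemma polyd_translate: "polyd n f \<Longrightarrow> polyd n (\<lambda>x. f (x + e))"
proof (induction rule: polyd.induct)
  case (inner n f b)
  have "polyd (Suc n) (\<lambda>x. (x \<bullet> b) * f (x + e) + (e \<bullet> b) * f (x + e))"
    by (intro polyd.add polyd.inner polyd_cmult polyd.Suc inner.IH)
  then show ?case by (simp add: inner_add_left distrib_right)
qed (auto intro: polyd.intros)

text \<open>For \<open>n = 0\<close> the truncated \<open>n - 1\<close> makes the first conjunct too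
  weak. The second conjunct records that the difference of a constant vanishes, which the product
  rule uses when the degree rises from 0 to 1.\<close>

lemma polyd_difference:
  "polyd n f \<Longrightarrow> polyd (n - 1) (\<lambda>x. f (x + e) - f x) \<and> (n = 0 \<longrightarrow> (\<forall>x. f (x + e) = f x))"
proof (induction rule: polyd.induct)
  case (add n f g)
  then have "polyd (n - 1) (\<lambda>x. (f (x + e) - f x) + (g (x + e) - g x))"
    by (intro polyd.add) blast+
  with add show ?case by (simp add: algebra_simps)
next
  case (inner n f b)
  \<comment> \<open>Discrete Leibniz rule: the difference of \<open>(x \<bullet> b) * f x\<close> is
    this product plus \<open>(e \<bullet> b) * f (x + e)\<close>.\<close>
  have "polyd n (\<lambda>x. (x \<bullet> b) * (f (x + e) - f x))"
  proof (cases n)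
    case 0
    then show ?thesis using inner.IH by (simp add: polyd.const)
  next
    case (Suc k)
    then show ?thesis using inner.IH polyd.inner[of k] by auto
  qed
  then have "polyd n (\<lambda>x. (x \<bullet> b) * (f (x + e) - f x) + (e \<bullet> b) * f (x + e))"
    by (intro polyd.add polyd_cmult polyd_translate inner.hyps)
  then show ?case by (simp add: algebra_simps)
next
  case (Suc n f)
  then show ?case using polyd_mono[of "n - 1" "\<lambda>x. f (x + e) - f x" n] by simp
qed (auto intro: polyd.intros)

lemma polyd_on_line: "polyd n f \<Longrightarrow> \<exists>P. \<forall>t. f (x + t *\<^sub>R e) = poly P t"
proof (induction rule: polyd.induct)
  case (const n c)
  show ?case by (rule exI[of _ "[:c:]"]) simp
next
  case (add n f g)
  then show ?case by (metis poly_add)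
next
  case (inner n f b)
  then obtain P where "\<And>t. f (x + t *\<^sub>R e) = poly P t" by blast
  then show ?case
    by (intro exI[of _ "[:x \<bullet> b, e \<bullet> b:] * P"]) (simp add: inner_add_left algebra_simps)
qed

text \<open>Along the line, \<open>f\<close> is a univariate polynomial that takes the value
  \<open>f x\<close> at every natural number, so it is constant.\<close>

lemma polyd_periodic:
  assumes "polyd n f" "\<And>m::nat. f (x + real m *\<^sub>R e) = f x"
  shows "f (x + t *\<^sub>R e) = f x"
proof -
  obtain P where P: "\<And>t. f (x + t *\<^sub>R e) = poly P t"
    using polyd_on_line[OF assms(1)] by blast
  have "range real \<subseteq> {t. poly (P - [:f x:]) t = 0}"
    using assms(2) P by auto
  moreover have "infinite (range real)"
    by (simp add: finite_image_iff inj_on_def)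
  ultimately have "P - [:f x:] = 0"
    using poly_roots_finite finite_subset by blast
  then have "P = [:f x:]" by simp
  then show ?thesis using P by simp
qed

text \<open>The difference of \<open>f\<close> along each grid direction has lower degree and vanishes on the grid of
  size \<open>n\<close>, hence on the whole span; so \<open>f\<close> is periodic in these directions.\<close>

lemma polyd_vanishing_on_grid:
  assumes "finite I"
  shows "polyd n f \<Longrightarrow>
    (\<And>k::'i \<Rightarrow> nat. (\<Sum>i\<in>I. k i) \<le> n \<Longrightarrow> f (v + (\<Sum>i\<in>I. real (k i) *\<^sub>R e i)) = 0) \<Longrightarrow>
    f (v + (\<Sum>i\<in>I. t i *\<^sub>R e i)) = 0"
proof (induction n arbitrary: f t)
  case 0
  define w where "w = (\<Sum>i\<in>I. t i *\<^sub>R e i)"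
  have "f (v + w) = f v"
    using polyd_difference[OF 0(1)] by simp
  also have "\<dots> = 0"
    using 0(2)[of "\<lambda>_. 0"] by simp
  finally show ?case by (simp add: w_def)
next
  case (Suc n)
  \<comment> \<open>Raising one grid index by 1 keeps the index sum within \<open>Suc n\<close>, so
    the difference in direction \<open>e j\<close> vanishes on the grid of size \<open>n\<close> and
    the induction hypothesis applies to it.\<close>
  have shift: "f (v + (\<Sum>i\<in>I. s i *\<^sub>R e i) + e j) = f (v + (\<Sum>i\<in>I. s i *\<^sub>R e i))" if "j \<in> I" for j s
  proof -
    have "(\<lambda>x. f (x + e j) - f x) (v + (\<Sum>i\<in>I. s i *\<^sub>R e i)) = 0"
    proof (rule Suc.IH)
      show "polyd n (\<lambda>x. f (x + e j) - f x)"
        using polyd_difference[OF Suc.prems(1)] by simp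
      fix k :: "'i \<Rightarrow> nat" assume k: "(\<Sum>i\<in>I. k i) \<le> n"
      let ?k = "k(j := Suc (k j))"
      have "(\<Sum>i\<in>I. ?k i) = Suc (\<Sum>i\<in>I. k i)"
        using assms that by (simp add: sum.remove[of I j])
      then have "f (v + (\<Sum>i\<in>I. real (?k i) *\<^sub>R e i)) = 0"
        using k Suc.prems(2)[of ?k] by linarith
      moreover have "(\<Sum>i\<in>I. real (?k i) *\<^sub>R e i) = (\<Sum>i\<in>I. real (k i) *\<^sub>R e i) + e j"
        using assms that by (simp add: sum.remove[of I j] algebra_simps)
      moreover have "f (v + (\<Sum>i\<in>I. real (k i) *\<^sub>R e i)) = 0"
        using k Suc.prems(2)[of k] by simp
      ultimately show "f (v + (\<Sum>i\<in>I. real (k i) *\<^sub>R e i) + e j) - f (v + (\<Sum>i\<in>I. real (k i) *\<^sub>R e i)) = 0"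
        by (simp add: algebra_simps)
    qed
    then show ?thesis by simp
  qed
  have upd: "(\<Sum>i\<in>I. (s(j := s j + r)) i *\<^sub>R e i) = (\<Sum>i\<in>I. s i *\<^sub>R e i) + r *\<^sub>R e j"
    if "j \<in> I" for j s r
    using assms that by (simp add: sum.remove[of I j] algebra_simps)
  have line: "f (v + (\<Sum>i\<in>I. s i *\<^sub>R e i) + r *\<^sub>R e j) = f (v + (\<Sum>i\<in>I. s i *\<^sub>R e i))" if "j \<in> I" for j s r
  proof (rule polyd_periodic[OF Suc.prems(1)])
    fix m :: nat
    show "f (v + (\<Sum>i\<in>I. s i *\<^sub>R e i) + real m *\<^sub>R e j) = f (v + (\<Sum>i\<in>I. s i *\<^sub>R e i))"
    proof (induction m)
      case (Suc m)
      have "f (v + (\<Sum>i\<in>I. (s(j := s j + real m)) i *\<^sub>R e i) + e j) =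
          f (v + (\<Sum>i\<in>I. (s(j := s j + real m)) i *\<^sub>R e i))"
        by (rule shift[OF that])
      with Suc show ?case
        unfolding upd[OF that] by (simp add: algebra_simps)
    qed simp
  qed
  \<comment> \<open>From \<open>v\<close>, itself a grid point, the target is reached one direction
    at a time; \<open>J\<close> is the set of directions already travelled.\<close>
  have "f (v + (\<Sum>i\<in>I. (if i \<in> J then t i else 0) *\<^sub>R e i)) = 0" if "finite J" "J \<subseteq> I" for J
    using that
  proof (induction J rule: finite_induct)
    case empty
    then show ?case using Suc.prems(2)[of "\<lambda>_. 0"] by simp
  next
    case (insert j J)
    let ?s = "\<lambda>i. if i \<in> J then t i else 0"
    have eq: "(\<lambda>i. if i \<in> insert j J then t i else 0) = ?s(j := ?s j + t j)"
      using insert.hyps by auto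
    have "(if i \<in> insert j J then t i else 0) = (?s(j := ?s j + t j)) i" for i
      using fun_cong[OF eq, of i] by simp
    then have "f (v + (\<Sum>i\<in>I. (if i \<in> insert j J then t i else 0) *\<^sub>R e i)) =
        f (v + (\<Sum>i\<in>I. ?s i *\<^sub>R e i) + t j *\<^sub>R e j)"
      using upd[of j ?s "t j"] insert.prems by (simp only: add.assoc insert_subset)
    then show ?case using line[of j ?s "t j"] insert by simp
  qed
  from this[OF assms subset_refl] show ?case by simp
qed

section \<open>Principal lattices of simplices and unisolvence\<close>

definition lattice :: "nat \<Rightarrow> 'a::real_vector set \<Rightarrow> 'a set" where
  "lattice p V = {(\<Sum>v\<in>V. lam v *\<^sub>R v) | lam.
     (\<Sum>v\<in>V. lam v) = 1 \<and> (\<forall>v\<in>V. lam v \<in> {real i / real p | i. i \<le> p})}"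

lemma finite_lattice:
  assumes "finite V"
  shows "finite (lattice p V)"
proof -
  let ?G = "V \<rightarrow>\<^sub>E {real i / real p | i. i \<le> p}"
  have "lattice p V \<subseteq> (\<lambda>lam. \<Sum>v\<in>V. lam v *\<^sub>R v) ` ?G"
  proof
    fix z assume "z \<in> lattice p V"
    then obtain lam where "z = (\<Sum>v\<in>V. lam v *\<^sub>R v)"
        and "\<forall>v\<in>V. lam v \<in> {real i / real p | i. i \<le> p}"
      unfolding lattice_def by blast
    then show "z \<in> (\<lambda>lam. \<Sum>v\<in>V. lam v *\<^sub>R v) ` ?G"
      by (intro image_eqI[of _ _ "restrict lam V"]) (auto intro!: sum.cong)
  qed
  moreover have "{real i / real p | i. i \<le> p} = (\<lambda>i. real i / real p) ` {..p}" by auto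
  then have "finite ?G" using assms by (intro finite_PiE) auto
  ultimately show ?thesis using finite_subset by blast
qed

lemma lattice_subset_convex_hull: "finite V \<Longrightarrow> lattice p V \<subseteq> convex hull V"
proof
  fix z assume "finite V" "z \<in> lattice p V"
  then obtain lam where lam: "z = (\<Sum>v\<in>V. lam v *\<^sub>R v)" "sum lam V = 1"
      "\<forall>v\<in>V. lam v \<in> {real i / real p | i. i \<le> p}"
    unfolding lattice_def by blast
  then have "\<forall>v\<in>V. 0 \<le> lam v" by fastforce
  then show "z \<in> convex hull V"
    using lam \<open>finite V\<close> unfolding convex_hull_finite[OF \<open>finite V\<close>] by blast
qed

text \<open>Seen from a vertex \<open>v0\<close>, the lattice consists of the points
  \<open>v0\<close> plus natural multiples of \<open>(v - v0) / p\<close> with index sum at most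
  \<open>p\<close>. This is the grid of \<open>polyd_vanishing_on_grid\<close> for degree
  \<open>p\<close>, and its directions span the space.\<close>

lemma lattice_unisolvent:
  fixes V :: "'a::euclidean_space set"
  assumes "finite V" "affine hull V = UNIV" "p \<ge> 1" "polyd p f" "\<And>z. z \<in> lattice p V \<Longrightarrow> f z = 0"
  shows "f x = 0"
proof -
  have "V \<noteq> {}" using assms(2) by auto
  then obtain v0 where v0: "v0 \<in> V" by blast
  let ?I = "V - {v0}" and ?e = "\<lambda>v. (1 / real p) *\<^sub>R (v - v0)"
  have split: "(\<Sum>v\<in>V. u v *\<^sub>R v) = v0 + (\<Sum>v\<in>?I. u v *\<^sub>R (v - v0))" if "sum u V = 1" for u
  proof -
    have "(\<Sum>v\<in>V. u v *\<^sub>R v) = (\<Sum>v\<in>V. u v *\<^sub>R (v - v0)) + (\<Sum>v\<in>V. u v) *\<^sub>R v0"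
      by (simp add: scaleR_left.sum sum.distrib[symmetric] scaleR_diff_right)
    then show ?thesis using that assms(1) v0 by (simp add: sum.remove[of V v0])
  qed
  obtain u where u: "sum u V = 1" "(\<Sum>v\<in>V. u v *\<^sub>R v) = x"
    using assms(1,2) affine_hull_finite[of V] by blast
  have "f (v0 + (\<Sum>v\<in>?I. (real p * u v) *\<^sub>R ?e v)) = 0"
  proof (rule polyd_vanishing_on_grid[OF _ assms(4)])
    show "finite ?I" using assms(1) by simp
    fix k :: "'a \<Rightarrow> nat" assume k: "(\<Sum>i\<in>?I. k i) \<le> p"
    \<comment> \<open>The base vertex \<open>v0\<close> receives the remaining weight, so that the
      coefficients sum to 1.\<close>
    define lam where "lam = (\<lambda>v. real (if v = v0 then p - (\<Sum>i\<in>?I. k i) else k v) / real p)"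
    have sum1: "sum lam V = 1"
      using assms(1,3) v0 k
      by (simp add: lam_def sum.remove[of V v0] sum_divide_distrib[symmetric] of_nat_diff flip: add_divide_distrib)
    have "k v \<le> p" if "v \<in> ?I" for v
      using k member_le_sum[of v ?I k] that assms(1) by fastforce
    then have "\<forall>v\<in>V. lam v \<in> {real i / real p | i. i \<le> p}"
      by (auto simp: lam_def)
    then have "(\<Sum>v\<in>V. lam v *\<^sub>R v) \<in> lattice p V"
      using sum1 unfolding lattice_def by blast
    then have "f (v0 + (\<Sum>v\<in>?I. lam v *\<^sub>R (v - v0))) = 0"
      using assms(5) split[OF sum1] by simp
    then show "f (v0 + (\<Sum>i\<in>?I. real (k i) *\<^sub>R ?e i)) = 0"
      by (simp add: lam_def)
  qed
  then show ?thesis using split[OF u(1)] u(2) assms(3) by simp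
qed

section \<open>Continuously differentiable functions\<close>

definition C1 :: "('a::euclidean_space \<Rightarrow> real) \<Rightarrow> ('a \<Rightarrow> 'a) \<Rightarrow> bool" where
  "C1 f f' \<longleftrightarrow> (\<forall>x. GDERIV f x :> f' x) \<and> continuous_on UNIV f'"

lemma C1_continuous: "C1 f f' \<Longrightarrow> continuous_on S f"
  unfolding C1_def gderiv_def
  by (meson continuous_at_imp_continuous_on has_derivative_continuous)

lemma C1_gradient_continuous: "C1 f f' \<Longrightarrow> continuous_on S f'"
  unfolding C1_def using continuous_on_subset by blast

lemma C1_const: "C1 (\<lambda>x. c) (\<lambda>x. 0)"
  unfolding C1_def by (simp add: GDERIV_const)

lemma C1_add: "C1 f f' \<Longrightarrow> C1 g g' \<Longrightarrow> C1 (\<lambda>x. f x + g x) (\<lambda>x. f' x + g' x)"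
  unfolding C1_def by (auto intro: GDERIV_add continuous_intros)

lemma C1_mult:
  assumes "C1 f f'" "C1 g g'"
  shows "C1 (\<lambda>x. f x * g x) (\<lambda>x. f x *\<^sub>R g' x + g x *\<^sub>R f' x)"
  using assms C1_continuous[OF assms(1), of UNIV] C1_continuous[OF assms(2), of UNIV]
  unfolding C1_def by (auto intro: GDERIV_mult continuous_intros)

lemma C1_inner: "C1 (\<lambda>x. x \<bullet> b) (\<lambda>x. b)"
  unfolding C1_def gderiv_def
  by (auto intro!: derivative_eq_intros simp: inner_commute)

lemma C1_compose:
  assumes "C1 f f'" "\<And>t. (h has_real_derivative h' t) (at t)" "continuous_on UNIV h'"
  shows "C1 (\<lambda>x. h (f x)) (\<lambda>x. h' (f x) *\<^sub>R f' x)"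
proof -
  have "continuous_on UNIV (\<lambda>x. h' (f x))"
    using continuous_on_compose2[OF assms(3) C1_continuous[OF assms(1)]] by blast
  then show ?thesis
    using assms GDERIV_DERIV_compose unfolding C1_def
    by (fast intro: continuous_on_scaleR)
qed

lemma C1_cmult: "C1 f f' \<Longrightarrow> C1 (\<lambda>x. c * f x) (\<lambda>x. c *\<^sub>R f' x)"
  using C1_mult[OF C1_const] by fastforce

lemma C1_translate:
  assumes "C1 f f'" shows "C1 (\<lambda>x. f (x - a)) (\<lambda>x. f' (x - a))"
proof -
  have "((\<lambda>x. f (x - a)) has_derivative (\<lambda>h. h \<bullet> f' (x - a))) (at x)" for x
  proof -
    have "((\<lambda>x. x - a) has_derivative (\<lambda>h. h)) (at x)"
      by (auto intro!: derivative_eq_intros)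
    moreover have "(f has_derivative (\<lambda>h. h \<bullet> f' (x - a))) (at (x - a))"
      using assms by (simp add: C1_def gderiv_def)
    ultimately show ?thesis
      using has_derivative_compose by blast
  qed
  moreover have "continuous_on UNIV (\<lambda>x. f' (x - a))"
    by (intro continuous_on_compose2[OF C1_gradient_continuous[OF assms, of UNIV]] continuous_intros) auto
  ultimately show ?thesis
    unfolding C1_def gderiv_def by blast
qed

lemma polyd_C1: "polyd n f \<Longrightarrow> \<exists>f'. C1 f f'"
proof (induction rule: polyd.induct)
  case (inner n f b)
  then show ?case using C1_mult[OF C1_inner] by blast
qed (blast intro: C1_const C1_add)+

text \<open>The squared positive part is continuously differentiable, which suffices for test
  functions of class C^1. Both the cut-offs and the mollifier below are built from it.\<close>

lemma C1_pospart_power2: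
  "((\<lambda>t::real. (max 0 t)\<^sup>2) has_real_derivative 2 * max 0 t) (at t)"
proof (cases "t = 0")
  case True
  have "((\<lambda>h. (max 0 h)\<^sup>2 / h) \<longlongrightarrow> 0) (at (0::real))"
  proof (rule Lim_null_comparison)
    show "\<forall>\<^sub>F h in at 0. norm ((max 0 h)\<^sup>2 / h) \<le> \<bar>h :: real\<bar>"
      by (rule always_eventually) (auto simp: max_def power2_eq_square)
    show "((\<lambda>h::real. \<bar>h\<bar>) \<longlongrightarrow> 0) (at 0)"
      by (auto intro!: tendsto_eq_intros)
  qed
  then show ?thesis using True by (simp add: DERIV_def)
next
  case False
  then consider "t > 0" | "t < 0" by linarith
  then show ?thesis
  proof cases
    case 1
    have "((\<lambda>t::real. t\<^sup>2) has_real_derivative 2 * max 0 t) (at t)"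
      using 1 by (auto intro!: derivative_eq_intros)
    then show ?thesis
      by (rule has_field_derivative_transform_within[where d = t])
        (use 1 in \<open>auto simp: dist_real_def max_def\<close>)
  next
    case 2
    have "((\<lambda>t::real. 0) has_real_derivative 2 * max 0 t) (at t)"
      using 2 by simp
    then show ?thesis
      by (rule has_field_derivative_transform_within[where d = "- t"])
        (use 2 in \<open>auto simp: dist_real_def max_def\<close>)
  qed
qed

section \<open>Simplices and regular meshes\<close>

lemma nodes_eq_lattice: "nodes p \<M> = (\<Union>T\<in>\<M>. lattice p (vertices T))"
  unfolding nodes_def lattice_def by blast

definition open_simplex :: "'a::euclidean_space set \<Rightarrow> bool" where
  "open_simplex T \<longleftrightarrow> (\<exists>V. \<not> affine_dependent V \<and> card V = Suc DIM('a) \<and> T = interior (convex hull V))"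

lemma open_simplexE:
  fixes T :: "'a::euclidean_space set"
  assumes "open_simplex T"
  obtains V where "finite V" "\<not> affine_dependent V" "affine hull V = UNIV" "vertices T = V"
    "closure T = convex hull V" "T = interior (convex hull V)" "T \<noteq> {}"
proof -
  obtain V where V: "\<not> affine_dependent V" "card V = Suc DIM('a)" "T = interior (convex hull V)"
    using assms unfolding open_simplex_def by blast
  have fin: "finite V" using V(1) aff_independent_finite by blast
  have ne: "T \<noteq> {}"
    using interior_convex_hull_eq_empty[OF V(2)] V by blast
  then have cl: "closure T = convex hull V"
    using V(3) convex_closure_interior[OF convex_convex_hull, of V] fin
    by (simp add: closure_closed compact_imp_closed compact_convex_hull finite_imp_compact)
  have "aff_dim V = DIM('a)"
    using V affine_independent_iff_card[of V] by simp
  then have "affine hull V = UNIV"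
    by (simp add: aff_dim_eq_full)
  moreover have "vertices T = V"
    unfolding vertices_def cl using extreme_point_of_convex_hull_affine_independent[OF V(1)] by blast
  ultimately show thesis using that fin V cl ne by blast
qed

lemma open_simplex_props:
  assumes "open_simplex T"
  shows open_simplex_open: "open T" and open_simplex_nonempty: "T \<noteq> {}"
    and open_simplex_convex: "convex T" and open_simplex_bounded: "bounded T"
    and open_simplex_eq_interior: "T = interior (closure T)"
    and open_simplex_finite_vertices: "finite (vertices T)"
    and open_simplex_affine_hull: "affine hull (vertices T) = UNIV"
    and open_simplex_closure: "closure T = convex hull (vertices T)"
    and open_simplex_independent: "\<not> affine_dependent (vertices T)"
proof -
  obtain V where V: "finite V" "\<not> affine_dependent V" "affine hull V = UNIV" "vertices T = V"
    "closure T = convex hull V" "T = interior (convex hull V)" "T \<noteq> {}"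
    using open_simplexE[OF assms] by blast
  show "open T" "T \<noteq> {}" "T = interior (closure T)" "finite (vertices T)"
    "affine hull (vertices T) = UNIV" "closure T = convex hull (vertices T)"
    "\<not> affine_dependent (vertices T)"
    using V by (auto simp del: interior_convex_hull_eq_empty)
  show "convex T"
    using V(6) convex_interior convex_convex_hull by metis
  have "bounded (convex hull V)"
    using V(1) by (simp add: bounded_convex_hull finite_imp_bounded)
  then show "bounded T"
    using V(6) bounded_subset interior_subset by metis
qed

lemma open_simplex_frontier_negligible: "open_simplex T \<Longrightarrow> negligible (frontier T)"
  using negligible_convex_frontier open_simplex_convex by blast

text \<open>Barycentric coordinates with respect to \<open>V\<close> are unique, so a point of the
  face has weight 0 off \<open>W\<close>. Conversely, weights on \<open>W\<close> are extended by 0,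
  which is an admissible lattice weight.\<close>

lemma lattice_face:
  fixes V :: "'a::euclidean_space set"
  assumes "\<not> affine_dependent V" "W \<subseteq> V" "z \<in> convex hull W"
  shows "z \<in> lattice p V \<longleftrightarrow> z \<in> lattice p W"
proof
  have finV: "finite V" using assms(1) aff_independent_finite by blast
  then have finW: "finite W" using assms(2) finite_subset by blast
  have ext: "(\<Sum>v\<in>V. if v \<in> W then f v else 0) = sum f W" for f :: "'a \<Rightarrow> 'b::comm_monoid_add"
    using finV assms(2) by (simp add: sum.inter_restrict[symmetric] Int_absorb1)
  {
    assume "z \<in> lattice p W"
    then obtain lam where lam: "z = (\<Sum>v\<in>W. lam v *\<^sub>R v)" "sum lam W = 1"
        "\<forall>v\<in>W. lam v \<in> {real i / real p | i. i \<le> p}"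
      unfolding lattice_def by blast
    let ?lam = "\<lambda>v. if v \<in> W then lam v else 0"
    have "sum ?lam V = 1" using ext[of lam] lam(2) by simp
    moreover have "(\<Sum>v\<in>V. ?lam v *\<^sub>R v) = z"
      using ext[of "\<lambda>v. lam v *\<^sub>R v"] lam(1) by (simp add: if_distrib[of "\<lambda>c. c *\<^sub>R _"] cong: if_cong)
    moreover have "\<forall>v\<in>V. ?lam v \<in> {real i / real p | i. i \<le> p}"
      using lam(3) by (auto intro: exI[of _ 0])
    ultimately show "z \<in> lattice p V"
      unfolding lattice_def by (auto intro!: exI[of _ ?lam])
  }
  assume "z \<in> lattice p V"
  then obtain lam where lam: "z = (\<Sum>v\<in>V. lam v *\<^sub>R v)" "sum lam V = 1"
      "\<forall>v\<in>V. lam v \<in> {real i / real p | i. i \<le> p}"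
    unfolding lattice_def by blast
  obtain u where u: "sum u W = 1" "(\<Sum>v\<in>W. u v *\<^sub>R v) = z"
    using assms(3) unfolding convex_hull_finite[OF finW] by blast
  let ?u = "\<lambda>v. if v \<in> W then u v else 0"
  have "sum (\<lambda>v. lam v - ?u v) V = 0"
    using ext[of u] lam(2) u(1) by (simp add: sum_subtractf)
  moreover have "(\<Sum>v\<in>V. ?u v *\<^sub>R v) = z"
    using ext[of "\<lambda>v. u v *\<^sub>R v"] u(2) by (simp add: if_distrib[of "\<lambda>c. c *\<^sub>R _"] cong: if_cong)
  then have "(\<Sum>v\<in>V. (lam v - ?u v) *\<^sub>R v) = 0"
    using lam(1) by (simp add: scaleR_diff_left sum_subtractf)
  ultimately have eq: "\<And>v. v \<in> V \<Longrightarrow> lam v = ?u v"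
    using assms(1) affine_dependent_explicit_finite[OF finV] by fastforce
  have "sum lam W = 1" "(\<Sum>v\<in>W. lam v *\<^sub>R v) = z"
    using u eq assms(2) by (metis (no_types, lifting) subsetD sum.cong)+
  then show "z \<in> lattice p W"
    using lam(3) assms(2) unfolding lattice_def by blast
qed

text \<open>\<open>W\<close> collects the vertices of nonzero barycentric weight; a convex
  combination of affinely independent points with all weights positive lies in the relative interior
  of their hull.\<close>

lemma carrier_face:
  fixes V :: "'a::euclidean_space set"
  assumes "\<not> affine_dependent V" "z \<in> convex hull V"
  obtains W where "W \<subseteq> V" "z \<in> rel_interior (convex hull W)"
proof -
  have finV: "finite V" using assms(1) aff_independent_finite by blast
  obtain u where u: "\<forall>v\<in>V. 0 \<le> u v" "sum u V = 1" "(\<Sum>v\<in>V. u v *\<^sub>R v) = z"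
    using assms(2) unfolding convex_hull_finite[OF finV] by blast
  let ?W = "{v\<in>V. u v \<noteq> 0}"
  have "sum u ?W = sum u V" "(\<Sum>v\<in>?W. u v *\<^sub>R v) = (\<Sum>v\<in>V. u v *\<^sub>R v)"
    using finV by (auto intro!: sum.mono_neutral_left)
  then have "sum u ?W = 1" "(\<Sum>v\<in>?W. u v *\<^sub>R v) = z"
    using u(2,3) by simp_all
  moreover have "\<forall>v\<in>?W. 0 < u v" using u(1) by force
  moreover have "\<not> affine_dependent ?W"
    by (rule affine_independent_subset[OF assms(1)]) auto
  ultimately have "z \<in> rel_interior (convex hull ?W)"
    unfolding rel_interior_convex_hull_explicit[OF \<open>\<not> affine_dependent ?W\<close>]
    by (intro CollectI exI[of _ u] conjI)
  then show thesis by (rule that[rotated]) auto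
qed

text \<open>The smallest faces of \<open>T\<^sub>1\<close> and \<open>T\<^sub>2\<close> containing \<open>z\<close> agree: the one of \<open>T\<^sub>1\<close> is a face of
  \<open>S\<close>, hence is contained in \<open>T\<^sub>2\<close>, and vice versa.\<close>

lemma lattice_transfer:
  fixes T\<^sub>1 T\<^sub>2 :: "'a::euclidean_space set"
  assumes simp: "open_simplex T\<^sub>1" "open_simplex T\<^sub>2"
    and faces: "(closure T\<^sub>1 \<inter> closure S) face_of closure T\<^sub>1" "(closure T\<^sub>2 \<inter> closure S') face_of closure T\<^sub>2"
    and sub: "S \<subseteq> T\<^sub>2" "S' \<subseteq> T\<^sub>1" and z: "z \<in> closure S" "z \<in> closure S'"
  shows "z \<in> lattice p (vertices T\<^sub>1) \<longleftrightarrow> z \<in> lattice p (vertices T\<^sub>2)"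
proof -
  let ?V\<^sub>1 = "vertices T\<^sub>1" and ?V\<^sub>2 = "vertices T\<^sub>2"
  have cl: "closure S \<subseteq> closure T\<^sub>2" "closure S' \<subseteq> closure T\<^sub>1"
    using sub closure_mono by blast+
  note V1 = open_simplex_closure[OF simp(1)] open_simplex_independent[OF simp(1)]
  note V2 = open_simplex_closure[OF simp(2)] open_simplex_independent[OF simp(2)]
  obtain W\<^sub>1 where W1: "W\<^sub>1 \<subseteq> ?V\<^sub>1" "z \<in> rel_interior (convex hull W\<^sub>1)"
    using carrier_face[OF V1(2)] V1(1) cl z by blast
  obtain W\<^sub>2 where W2: "W\<^sub>2 \<subseteq> ?V\<^sub>2" "z \<in> rel_interior (convex hull W\<^sub>2)"
    using carrier_face[OF V2(2)] V2(1) cl z by blast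
  have face1: "convex hull W\<^sub>1 face_of closure T\<^sub>1"
    using face_of_convex_hull_affine_independent[OF V1(2)] W1(1) V1(1) by auto
  have face2: "convex hull W\<^sub>2 face_of closure T\<^sub>2"
    using face_of_convex_hull_affine_independent[OF V2(2)] W2(1) V2(1) by auto
  have zW: "z \<in> convex hull W\<^sub>1" "z \<in> convex hull W\<^sub>2"
    using W1(2) W2(2) rel_interior_subset by blast+
  \<comment> \<open>A face that meets the relative interior of a convex subset contains this subset.
    This is applied twice: it puts the hull of \<open>A\<close> into the closure of
    \<open>R\<close>, hence of \<open>T'\<close>, and then into the face spanned by
    \<open>B\<close>.\<close>
  have incl: "convex hull A \<subseteq> convex hull B"
    if "(closure T \<inter> closure R) face_of closure T" "convex hull A face_of closure T"
      "convex hull B face_of closure T'" "z \<in> rel_interior (convex hull A)" "z \<in> convex hull B"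
      "closure R \<subseteq> closure T'" "z \<in> closure R" for A B T T' R :: "'a set"
  proof -
    have "convex hull A \<subseteq> closure T" using that(2) face_of_imp_subset by blast
    moreover have "z \<in> closure T"
      using that(4) calculation rel_interior_subset by blast
    ultimately have "convex hull A \<subseteq> closure T \<inter> closure R"
      using that(1,4,7) by (intro subset_of_face_of[OF that(1)]) auto
    then show ?thesis
      using that by (intro subset_of_face_of[OF that(3)]) auto
  qed
  have hull: "convex hull W\<^sub>1 = convex hull W\<^sub>2"
    using incl[OF faces(1) face1 face2] incl[OF faces(2) face2 face1] W1(2) W2(2) zW cl z by blast
  moreover have "\<not> affine_dependent W\<^sub>1" "\<not> affine_dependent W\<^sub>2"
    using affine_independent_subset W1(1) W2(1) V1(2) V2(2) by blast+
  ultimately have "W\<^sub>1 = W\<^sub>2"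
    using extreme_point_of_convex_hull_affine_independent by (metis subsetI subset_antisym)
  then show ?thesis
    using lattice_face[OF V1(2) W1(1) zW(1)] lattice_face[OF V2(2) W2(1) zW(2)] by simp
qed

lemma regular_triangulationD:
  fixes \<Omega> :: "'a::euclidean_space set"
  assumes "regular_triangulation \<Omega> \<T>"
  shows regular_simplex: "\<And>T. T \<in> \<T> \<Longrightarrow> open_simplex T" and regular_finite: "finite \<T>"
    and regular_face: "\<And>S T. S \<in> \<T> \<Longrightarrow> T \<in> \<T> \<Longrightarrow> (closure S \<inter> closure T) face_of closure S"
    and regular_cover: "\<Union>(closure ` \<T>) = closure \<Omega>"
    and regular_disjoint: "\<And>S T. S \<in> \<T> \<Longrightarrow> T \<in> \<T> \<Longrightarrow> S \<inter> T \<noteq> {} \<Longrightarrow> S = T"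
proof -
  show os: "open_simplex T" if "T \<in> \<T>" for T
  proof -
    obtain K where "int DIM('a) simplex K" "T = interior K"
      using assms \<open>T \<in> \<T>\<close> unfolding regular_triangulation_def by blast
    then show ?thesis unfolding open_simplex_def simplex_def by fastforce
  qed
  show cover: "\<Union>(closure ` \<T>) = closure \<Omega>"
    using assms unfolding regular_triangulation_def by blast
  have tri: "triangulation (closure ` \<T>)"
    using assms unfolding regular_triangulation_def by blast
  then show face: "(closure S \<inter> closure T) face_of closure S" if "S \<in> \<T>" "T \<in> \<T>" for S T
    using that unfolding triangulation_def by blast
  have inj: "inj_on closure \<T>"
    by (rule inj_onI) (metis os open_simplex_eq_interior)
  then show "finite \<T>"
    using tri finite_image_iff[OF inj] unfolding triangulation_def by simp
  \<comment> \<open>A face that meets the interior is the whole convex set. Hence both closures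
    equal their intersection, and elements are determined by their closures.\<close>
  show "S = T" if "S \<in> \<T>" "T \<in> \<T>" "S \<inter> T \<noteq> {}" for S T
  proof -
    have meet: "closure S \<inter> closure T \<inter> interior (closure S) \<noteq> {}" "closure S \<inter> closure T \<inter> interior (closure T) \<noteq> {}"
      using that open_simplex_eq_interior[OF os[OF that(1)]] open_simplex_eq_interior[OF os[OF that(2)]]
        closure_subset[of S] closure_subset[of T] by blast+
    have "closure S \<inter> closure T = closure S"
      using face_of_disjoint_interior[OF face[OF that(1,2)]] meet(1) by blast
    moreover have "closure S \<inter> closure T = closure T"
      using face_of_disjoint_interior[OF face[OF that(2,1)]] meet(2) by (metis Int_commute)
    ultimately show ?thesis using inj_onD[OF inj _ that(1,2)] by simp
  qed
qed

section \<open>Newest vertex bisection\<close>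

text \<open>The type is left out: it affects the order of the vertices of a child, not the vertices
  themselves.\<close>

definition nondegenerate :: "'a::euclidean_space lsimplex \<Rightarrow> bool" where
  "nondegenerate t \<longleftrightarrow> length (fst t) = Suc DIM('a) \<and> distinct (fst t) \<and> \<not> affine_dependent (set (fst t))"

text \<open>Bisection in terms of unordered vertex sets: \<open>a\<close> and \<open>b\<close> are
  the ends of the refinement edge and \<open>Z\<close> holds the other vertices. The ordering,
  including the reversal in the second child, disappears, and the last clause lets distinct children
  be treated as one on either side.\<close>

lemma nondegenerate_lchildren:
  fixes t :: "'a::euclidean_space lsimplex"
  assumes "nondegenerate t"
  obtains a b Z where "a \<noteq> b" "a \<notin> Z" "b \<notin> Z" "set (fst t) = {a, b} \<union> Z" "\<not> affine_dependent ({a, b} \<union> Z)"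
    "card ({a, b} \<union> Z) = Suc DIM('a)"
    "\<forall>c\<in>lchildren t. length (fst c) = Suc DIM('a) \<and>
      (set (fst c) = {a, midpoint a b} \<union> Z \<or> set (fst c) = {b, midpoint a b} \<union> Z)"
    "\<forall>c\<in>lchildren t. \<forall>c'\<in>lchildren t. c \<noteq> c' \<longrightarrow>
      set (fst c) = {a, midpoint a b} \<union> Z \<and> set (fst c') = {b, midpoint a b} \<union> Z \<or>
      set (fst c') = {a, midpoint a b} \<union> Z \<and> set (fst c) = {b, midpoint a b} \<union> Z"
proof -
  obtain zs \<gamma> where t: "t = (zs, \<gamma>)" by (cases t)
  have len: "length zs = Suc DIM('a)" and dist: "distinct zs" and ind: "\<not> affine_dependent (set zs)"
    using assms by (auto simp: nondegenerate_def t)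
  obtain a ys where ys: "zs = a # ys" using len by (cases zs) auto
  then have "ys \<noteq> []" using len DIM_positive[where 'a = 'a] by auto
  then obtain mid b where zs: "zs = a # mid @ [b]"
    using ys by (cases ys rule: rev_cases) auto
  have set: "set (take \<gamma> mid) \<union> set (drop \<gamma> mid) = set mid"
    by (simp add: set_append[symmetric] del: set_append)
  define c\<^sub>1 c\<^sub>2 where
    "c\<^sub>1 = (a # midpoint a b # take \<gamma> mid @ drop \<gamma> mid, Suc \<gamma> mod DIM('a))" and
    "c\<^sub>2 = (b # midpoint a b # take \<gamma> mid @ rev (drop \<gamma> mid), Suc \<gamma> mod DIM('a))"
  have ch: "lchildren t = {c\<^sub>1, c\<^sub>2}"
    by (simp add: t zs c\<^sub>1_def c\<^sub>2_def Let_def)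
  have set1: "set (fst c\<^sub>1) = {a, midpoint a b} \<union> set mid" "length (fst c\<^sub>1) = Suc DIM('a)"
    using len by (auto simp: c\<^sub>1_def zs)
  have set2: "set (fst c\<^sub>2) = {b, midpoint a b} \<union> set mid" "length (fst c\<^sub>2) = Suc DIM('a)"
    using len set by (auto simp: c\<^sub>2_def zs)
  show thesis
  proof (rule that[of a b "set mid"])
    show "a \<noteq> b" "a \<notin> set mid" "b \<notin> set mid" using dist by (auto simp: zs)
    have "set zs = {a, b} \<union> set mid" by (auto simp: zs)
    then show "set (fst t) = {a, b} \<union> set mid" "\<not> affine_dependent ({a, b} \<union> set mid)"
      "card ({a, b} \<union> set mid) = Suc DIM('a)"
      using ind len distinct_card[OF dist] by (auto simp: t simp del: Un_insert_left)
    show "\<forall>c\<in>lchildren t. length (fst c) = Suc DIM('a) \<and>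
        (set (fst c) = {a, midpoint a b} \<union> set mid \<or> set (fst c) = {b, midpoint a b} \<union> set mid)"
      using set1 set2 unfolding ch by (simp only: ball_simps) blast
    show "\<forall>c\<in>lchildren t. \<forall>c'\<in>lchildren t. c \<noteq> c' \<longrightarrow>
        set (fst c) = {a, midpoint a b} \<union> set mid \<and> set (fst c') = {b, midpoint a b} \<union> set mid \<or>
        set (fst c') = {a, midpoint a b} \<union> set mid \<and> set (fst c) = {b, midpoint a b} \<union> set mid"
      using set1 set2 unfolding ch by (simp only: ball_simps) blast
  qed
qed

text \<open>The endpoint that a child loses is the reflection of the kept endpoint in the midpoint,
  so the child has the same affine hull as its parent. A list of \<open>DIM('a) + 1\<close> points
  with full affine dimension is distinct and affinely independent.\<close>

lemma lchildren_nondegenerate: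
  fixes t :: "'a::euclidean_space lsimplex"
  assumes "nondegenerate t" "c \<in> lchildren t"
  shows "nondegenerate c \<and> element c \<subseteq> element t"
proof -
  obtain a b Z where abZ0: "a \<noteq> b" "a \<notin> Z" "b \<notin> Z"
      "set (fst t) = {a, b} \<union> Z" "\<not> affine_dependent ({a, b} \<union> Z)" "card ({a, b} \<union> Z) = Suc DIM('a)"
    and ch: "\<forall>c\<in>lchildren t. length (fst c) = Suc DIM('a) \<and>
      (set (fst c) = {a, midpoint a b} \<union> Z \<or> set (fst c) = {b, midpoint a b} \<union> Z)"
    and pairs: "\<forall>c\<in>lchildren t. \<forall>c'\<in>lchildren t. c \<noteq> c' \<longrightarrow>
      set (fst c) = {a, midpoint a b} \<union> Z \<and> set (fst c') = {b, midpoint a b} \<union> Z \<or>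
      set (fst c') = {a, midpoint a b} \<union> Z \<and> set (fst c) = {b, midpoint a b} \<union> Z"
    by (rule nondegenerate_lchildren[OF assms(1)])
  note abZ = abZ0(4-6)
  have c: "length (fst c) = Suc DIM('a)"
      "set (fst c) = {a, midpoint a b} \<union> Z \<or> set (fst c) = {b, midpoint a b} \<union> Z"
    using ch assms(2) by blast+
  have mid: "midpoint a b \<in> convex hull ({a, b} \<union> Z)"
    using midpoint_in_closed_segment[of a b] hull_mono[of "{a, b}" "{a, b} \<union> Z" convex]
    by (auto simp: segment_convex_hull)
  have "set (fst c) \<subseteq> convex hull (set (fst t))"
    using c(2) mid abZ(1) hull_subset[of "{a, b} \<union> Z" convex] by auto
  then have sub: "element c \<subseteq> element t"
    unfolding element_def by (intro interior_mono hull_minimal) auto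
  have refl: "b = 2 *\<^sub>R midpoint a b - 1 *\<^sub>R a" "a = 2 *\<^sub>R midpoint a b - 1 *\<^sub>R b"
    by (auto simp: midpoint_def scaleR_right_distrib)
  have aff: "2 *\<^sub>R x - 1 *\<^sub>R y \<in> affine hull S" if "x \<in> S" "y \<in> S" for x y and S :: "'a set"
    using mem_affine[OF affine_affine_hull hull_inc hull_inc, of x S y 2 "-1"] that by simp
  have "{a, b} \<union> Z \<subseteq> affine hull (set (fst c))"
    using c(2) aff[of "midpoint a b" "set (fst c)" a] aff[of "midpoint a b" "set (fst c)" b] refl
      hull_subset[of "set (fst c)" affine] by auto
  then have "aff_dim ({a, b} \<union> Z) \<le> aff_dim (set (fst c))"
    by (metis aff_dim_affine_hull aff_dim_subset)
  then have dim: "aff_dim (set (fst c)) \<ge> int DIM('a)"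
    using abZ(2,3) affine_independent_iff_card[of "{a, b} \<union> Z"] by auto
  moreover have "aff_dim (set (fst c)) \<le> int (card (set (fst c))) - 1"
    using aff_dim_le_card by blast
  moreover have "card (set (fst c)) \<le> Suc DIM('a)"
    using card_length c(1) by metis
  ultimately have "card (set (fst c)) = length (fst c)" "aff_dim (set (fst c)) = int (card (set (fst c))) - 1"
    using c(1) by linarith+
  then have "nondegenerate c"
    unfolding nondegenerate_def using c(1) card_distinct affine_independent_iff_card by blast
  then show ?thesis using sub by blast
qed

text \<open>A hyperplane through the midpoint and all of \<open>Z\<close> has \<open>a\<close> and
  \<open>b\<close> strictly on opposite sides, so it separates the two open simplices.\<close>

lemma lchildren_disjoint:
  fixes t :: "'a::euclidean_space lsimplex"
  assumes "nondegenerate t" "c \<in> lchildren t" "c' \<in> lchildren t" "c \<noteq> c'"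
  shows "element c \<inter> element c' = {}"
proof -
  obtain a b Z where abZ0: "a \<noteq> b" "a \<notin> Z" "b \<notin> Z"
      "set (fst t) = {a, b} \<union> Z" "\<not> affine_dependent ({a, b} \<union> Z)" "card ({a, b} \<union> Z) = Suc DIM('a)"
    and ch: "\<forall>c\<in>lchildren t. length (fst c) = Suc DIM('a) \<and>
      (set (fst c) = {a, midpoint a b} \<union> Z \<or> set (fst c) = {b, midpoint a b} \<union> Z)"
    and pairs: "\<forall>c\<in>lchildren t. \<forall>c'\<in>lchildren t. c \<noteq> c' \<longrightarrow>
      set (fst c) = {a, midpoint a b} \<union> Z \<and> set (fst c') = {b, midpoint a b} \<union> Z \<or>
      set (fst c') = {a, midpoint a b} \<union> Z \<and> set (fst c) = {b, midpoint a b} \<union> Z"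
    by (rule nondegenerate_lchildren[OF assms(1)])
  note abZ = abZ0(1-3,5)
  have c: "set (fst c) = {a, midpoint a b} \<union> Z \<and> set (fst c') = {b, midpoint a b} \<union> Z \<or>
      set (fst c') = {a, midpoint a b} \<union> Z \<and> set (fst c) = {b, midpoint a b} \<union> Z"
    using pairs assms(2-) by blast
  \<comment> \<open>an affine function that is \<open>1\<close> at \<open>a\<close>, \<open>-1\<close> at \<open>b\<close> and \<open>0\<close> at the other vertices\<close>
  have ind: "independent ((\<lambda>x. x - a) ` (insert b Z))"
    using abZ(4) affine_dependent_iff_dependent2[of a "{a, b} \<union> Z"] abZ(1,2)
    by (auto simp: insert_Diff_if insert_commute)
  \<comment> \<open>The linear part is fixed relative to \<open>a\<close>, where the affine function
    is 1: the values -1 at \<open>b\<close> and 0 on \<open>Z\<close> become -2 and -1. Its constant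
    term is the \<open>k\<close> defined below.\<close>
  obtain g :: "'a \<Rightarrow> real" where g: "linear g"
      "\<And>x. x \<in> (\<lambda>x. x - a) ` (insert b Z) \<Longrightarrow> g x = (if x = b - a then -2 else -1)"
    using linear_independent_extend[OF ind, of "\<lambda>x. if x = b - a then -2 else -1"] by blast
  then obtain w where w: "\<And>x. g x = w \<bullet> x"
    using that[of "adjoint g 1"] adjoint_works[OF g(1), of _ 1] by (simp add: inner_commute)
  define k where "k = 1 - w \<bullet> a"
  have gb: "w \<bullet> (b - a) = -2" using g(2)[of "b - a"] w by simp
  have gZ: "w \<bullet> (z - a) = -1" if "z \<in> Z" for z
    using g(2)[of "z - a"] w that abZ(3) by auto
  have w0: "w \<noteq> 0" using gb by auto
  have va: "w \<bullet> a = 1 - k" by (simp add: k_def)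
  have vb: "w \<bullet> b = -1 - k" using gb by (simp add: k_def inner_diff_right)
  have vZ: "w \<bullet> z = -k" if "z \<in> Z" for z using gZ[OF that] by (simp add: k_def inner_diff_right)
  have vm: "w \<bullet> midpoint a b = -k"
    using va vb by (simp add: midpoint_def inner_add_right)
  have pos: "interior (convex hull ({a, midpoint a b} \<union> Z)) \<subseteq> {x. w \<bullet> x > - k}"
  proof -
    have "convex hull ({a, midpoint a b} \<union> Z) \<subseteq> {x. w \<bullet> x \<ge> -k}"
      using va vZ vm by (intro hull_minimal convex_halfspace_ge) auto
    then show ?thesis
      using interior_mono interior_halfspace_ge[OF w0, of "-k"] by blast
  qed
  have neg: "interior (convex hull ({b, midpoint a b} \<union> Z)) \<subseteq> {x. w \<bullet> x < - k}"
  proof -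
    have "convex hull ({b, midpoint a b} \<union> Z) \<subseteq> {x. w \<bullet> x \<le> -k}"
      using vb vZ vm by (intro hull_minimal convex_halfspace_le) auto
    then show ?thesis
      using interior_mono interior_halfspace_le[OF w0, of "-k"] by blast
  qed
  show ?thesis
    using c pos neg unfolding element_def by fastforce
qed

abbreviation lchild :: "'a::euclidean_space lsimplex \<Rightarrow> 'a lsimplex \<Rightarrow> bool" where
  "lchild t c \<equiv> c \<in> lchildren t"

lemma descendant_nondegenerate:
  assumes "lchild\<^sup>*\<^sup>* t s" "nondegenerate t"
  shows "nondegenerate s \<and> element s \<subseteq> element t"
  using assms by (induction rule: rtranclp_induct) (use lchildren_nondegenerate in blast)+

text \<open>Follow both branches down from the root. While they use the same child the induction
  hypothesis applies; where they part, the children are disjoint and contain the respective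
  descendants; if one branch ends, its element contains the other.\<close>

lemma descendants_nested:
  assumes "lchild\<^sup>*\<^sup>* r s" "lchild\<^sup>*\<^sup>* r t" "nondegenerate r"
  shows "element s \<subseteq> element t \<or> element t \<subseteq> element s \<or> element s \<inter> element t = {}"
  using assms
proof (induction rule: converse_rtranclp_induct)
  case base
  then show ?case using descendant_nondegenerate by blast
next
  case (step r c)
  have c: "nondegenerate c" "element s \<subseteq> element c"
    using step lchildren_nondegenerate descendant_nondegenerate by blast+
  show ?case
    using step.prems(1)
  proof (cases rule: converse_rtranclpE)
    case base
    then show ?thesis
      using step.hyps(1) step.prems(2) lchildren_nondegenerate c by blast
  next
    case (step c')
    have c': "element t \<subseteq> element c'"
      using step lchildren_nondegenerate descendant_nondegenerate \<open>nondegenerate r\<close> by blast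
    show ?thesis
    proof (cases "c = c'")
      case True
      then show ?thesis using step.IH step c by blast
    next
      case False
      then show ?thesis
        using lchildren_disjoint[OF \<open>nondegenerate r\<close> \<open>lchild r c\<close> \<open>lchild r c'\<close>] c c' by blast
    qed
  qed
qed

lemma nvb_refinement_descendant:
  "nvb_refinement L\<^sub>0 L \<Longrightarrow> t \<in> L \<Longrightarrow> \<exists>r\<in>L\<^sub>0. lchild\<^sup>*\<^sup>* r t"
proof (induction arbitrary: t rule: nvb_refinement.induct)
  case (bisect L s)
  then show ?case by (metis DiffE UnE rtranclp.rtrancl_into_rtrancl)
qed auto

lemma uniform_refinement_descendant:
  assumes "t \<in> uniform_refinement L\<^sub>0 l"
  shows "\<exists>r\<in>L\<^sub>0. lchild\<^sup>*\<^sup>* r t"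
proof -
  have "t \<in> ((\<lambda>M. \<Union>(lchildren ` M)) ^^ n) L\<^sub>0 \<Longrightarrow> \<exists>r\<in>L\<^sub>0. lchild\<^sup>*\<^sup>* r t" for n
  proof (induction n arbitrary: t)
    case (Suc n)
    then obtain s where "s \<in> ((\<lambda>M. \<Union>(lchildren ` M)) ^^ n) L\<^sub>0" "t \<in> lchildren s" by auto
    then show ?case using Suc.IH by (meson rtranclp.rtrancl_into_rtrancl)
  qed auto
  then show ?thesis using assms unfolding uniform_refinement_def by blast
qed

text \<open>Elements below one root are handled by \<open>descendants_nested\<close>. Distinct
  labelled roots have distinct elements by injectivity, and these are disjoint because the initial
  mesh is regular.\<close>

lemma nvb_nested:
  assumes adm: "admissible_labelling \<Omega> L\<^sub>0" and nvb: "nvb_refinement L\<^sub>0 L"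
    and S: "S \<in> mesh L" and T: "T \<in> mesh (uniform_refinement L\<^sub>0 l)"
  shows "S \<subseteq> T \<or> T \<subseteq> S \<or> S \<inter> T = {}"
proof -
  obtain s r where s: "S = element s" "r \<in> L\<^sub>0" "lchild\<^sup>*\<^sup>* r s"
    using S nvb_refinement_descendant[OF nvb] unfolding mesh_def by blast
  obtain t r' where t: "T = element t" "r' \<in> L\<^sub>0" "lchild\<^sup>*\<^sup>* r' t"
    using T uniform_refinement_descendant unfolding mesh_def by blast
  have nd: "nondegenerate q" if "q \<in> L\<^sub>0" for q
    using adm that unfolding admissible_labelling_def nondegenerate_def by fastforce
  have reg: "regular_triangulation \<Omega> (mesh L\<^sub>0)" and inj: "inj_on element L\<^sub>0"
    using adm unfolding admissible_labelling_def by blast+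
  show ?thesis
  proof (cases "r = r'")
    case True
    then show ?thesis using descendants_nested nd s t by blast
  next
    case False
    then have "element r \<noteq> element r'" using inj s(2) t(2) inj_onD by metis
    then have "element r \<inter> element r' = {}"
      using regular_disjoint[OF reg] s(2) t(2) unfolding mesh_def by blast
    then show ?thesis
      using descendant_nondegenerate[OF s(3) nd] descendant_nondegenerate[OF t(3) nd] s t by blast
  qed
qed

section \<open>Continuity of piecewise polynomials in $H^1$\<close>

lemma continuous_measurable_lebesgue_on:
  fixes f :: "'a::euclidean_space \<Rightarrow> 'b::euclidean_space"
  assumes "continuous_on UNIV f"
  shows "f \<in> borel_measurable (lebesgue_on S)"
  using assms borel_measurable_continuous_onI[OF assms]
  by (intro measurable_restrict_space1 measurable_completion) (simp add: measurable_lborel1)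

lemma integrable_mult_bounded:
  fixes f :: "'a::euclidean_space \<Rightarrow> 'b::euclidean_space" and u :: "'a \<Rightarrow> real"
  assumes "integrable (lebesgue_on S) u" "continuous_on UNIV f" "\<And>x. norm (f x) \<le> B"
  shows "integrable (lebesgue_on S) (\<lambda>x. u x *\<^sub>R f x)"
proof (rule Bochner_Integration.integrable_bound)
  show "integrable (lebesgue_on S) (\<lambda>x. B * u x)"
    using assms(1) by simp
  show "(\<lambda>x. u x *\<^sub>R f x) \<in> borel_measurable (lebesgue_on S)"
    using assms(1) continuous_measurable_lebesgue_on[OF assms(2)] by measurable
  have "0 \<le> B" using assms(3) norm_ge_zero order_trans by blast
  then show "AE x in lebesgue_on S. norm (u x *\<^sub>R f x) \<le> norm (B * u x)"
    using assms(3) by (intro always_eventually allI)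
      (simp add: abs_mult mult.commute[of B] mult_left_mono)
qed

lemma integrable_const_bounded:
  assumes "bounded S" "S \<in> sets lebesgue"
  shows "integrable (lebesgue_on S) (\<lambda>x. c :: real)"
proof -
  have "S \<in> lmeasurable" using assms bounded_set_imp_lmeasurable by blast
  then interpret finite_measure "lebesgue_on S" by (rule finite_measure_lebesgue_on)
  show ?thesis by (rule integrable_const)
qed

text \<open>Serves both the inclusion of L^2 in L^1 on bounded sets and the limit at infinity of the
  cut-off profile.\<close>

lemma less_one_plus_power2: "t < 1 + t\<^sup>2" for t :: real
proof -
  have "2 * t \<le> 1 + t\<^sup>2"
    using zero_le_power2[of "t - 1"] by (simp add: power2_diff)
  moreover have "0 \<le> t\<^sup>2" by simp
  ultimately show ?thesis by linarith
qed

lemma square_integrable_integrable: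
  assumes "square_integrable S f" "bounded S" "S \<in> sets lebesgue"
  shows "integrable (lebesgue_on S) f"
proof (rule Bochner_Integration.integrable_bound)
  show "integrable (lebesgue_on S) (\<lambda>x. 1 + (norm (f x))\<^sup>2)"
    using assms integrable_const_bounded[of S 1] unfolding square_integrable_def by simp
  show "f \<in> borel_measurable (lebesgue_on S)"
    using assms unfolding square_integrable_def by simp
  show "AE x in lebesgue_on S. norm (f x) \<le> norm (1 + (norm (f x))\<^sup>2)"
  proof (intro always_eventually allI)
    fix x
    show "norm (f x) \<le> norm (1 + (norm (f x))\<^sup>2)"
      using less_one_plus_power2[of "norm (f x)"] by simp
  qed
qed

lemma test_function_C1:
  "test_function S \<psi> \<psi>' \<longleftrightarrow> C1 \<psi> \<psi>' \<and> (\<exists>K. compact K \<and> K \<subseteq> S \<and> (\<forall>x. x \<notin> K \<longrightarrow> \<psi> x = 0))"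
  unfolding test_function_def C1_def by blast

lemma C1_gradient_eq_0:
  assumes "C1 f f'" "open U" "x \<in> U" "\<And>y. y \<in> U \<Longrightarrow> f y = 0"
  shows "f' x = 0"
proof -
  have "(f has_derivative (\<lambda>h. h \<bullet> f' x)) (at x)"
    using assms(1) unfolding C1_def gderiv_def by blast
  moreover have "(f has_derivative (\<lambda>h. 0)) (at x)"
    by (rule has_derivative_transform_within_open[of "\<lambda>_. 0" _ _ _ U]) (use assms in auto)
  ultimately have "(\<lambda>h. h \<bullet> f' x) = (\<lambda>h. 0)"
    by (rule has_derivative_unique)
  then show ?thesis by (metis inner_eq_zero_iff)
qed

lemma test_functionE:
  assumes "test_function S \<psi> \<psi>'"
  obtains K B where "compact K" "K \<subseteq> S" "\<And>x. x \<notin> K \<Longrightarrow> \<psi> x = 0" "\<And>x. x \<notin> K \<Longrightarrow> \<psi>' x = 0"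
    "\<And>x. norm (\<psi> x) \<le> B" "\<And>x. norm (\<psi>' x) \<le> B"
proof -
  have C1: "C1 \<psi> \<psi>'" using assms test_function_C1 by blast
  obtain K where K: "compact K" "K \<subseteq> S" "\<And>x. x \<notin> K \<Longrightarrow> \<psi> x = 0"
    using assms unfolding test_function_def by blast
  have K': "\<psi>' x = 0" if "x \<notin> K" for x
    using C1_gradient_eq_0[OF C1, of "- K" x] K that by (simp add: compact_imp_closed open_Compl)
  have "bounded (\<psi> ` K)" "bounded (\<psi>' ` K)"
    using K(1) C1_continuous[OF C1] C1_gradient_continuous[OF C1]
    by (simp_all add: compact_continuous_image compact_imp_bounded)
  then obtain B B' where B: "\<forall>x\<in>K. norm (\<psi> x) \<le> B" "\<forall>x\<in>K. norm (\<psi>' x) \<le> B'"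
    unfolding bounded_iff by blast
  have "norm (\<psi> x) \<le> max 0 (max B B')" "norm (\<psi>' x) \<le> max 0 (max B B')" for x
    using B K(3)[of x] K'[of x] by (cases "x \<in> K"; force)+
  with K K' that show thesis by blast
qed

lemma test_function_mult:
  assumes "test_function S \<psi> \<psi>'" "C1 q q'"
  shows "test_function S (\<lambda>x. q x * \<psi> x) (\<lambda>x. q x *\<^sub>R \<psi>' x + \<psi> x *\<^sub>R q' x)"
  using assms C1_mult[OF assms(2)] unfolding test_function_C1 by (metis mult_zero_right)

lemma test_function_mono: "test_function S \<psi> \<psi>' \<Longrightarrow> S \<subseteq> T \<Longrightarrow> test_function T \<psi> \<psi>'"
  unfolding test_function_def by blast

lemma C1_lipschitz:
  assumes "C1 f f'" "\<And>x. norm (f' x) \<le> B"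
  shows "\<bar>f x - f y\<bar> \<le> B * norm (x - y)"
proof -
  have "norm (f x - f y) \<le> B * norm (x - y)"
  proof (rule differentiable_bound[of UNIV f "\<lambda>x h. h \<bullet> f' x"])
    show "(f has_derivative (\<lambda>h. h \<bullet> f' x)) (at x within UNIV)" for x
      using assms(1) unfolding C1_def gderiv_def by blast
    show "onorm (\<lambda>h. h \<bullet> f' x) \<le> B" for x
    proof (rule onorm_le)
      fix h
      have "norm (h \<bullet> f' x) \<le> norm h * norm (f' x)"
        using Cauchy_Schwarz_ineq2 by simp
      also have "\<dots> \<le> B * norm h"
        using assms(2)[of x] by (simp add: mult.commute[of B] mult_left_mono)
      finally show "norm (h \<bullet> f' x) \<le> B * norm h" .
    qed
  qed auto
  then show ?thesis by simp
qed

section \<open>Translates and differentiation under the integral\<close>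

lemma C1_along_line:
  assumes "C1 f f'"
  shows "((\<lambda>t. f (y - t *\<^sub>R h)) has_real_derivative - (f' (y - t *\<^sub>R h) \<bullet> h)) (at t)"
proof -
  have "((\<lambda>t. y - t *\<^sub>R h) has_derivative (\<lambda>s. - (s *\<^sub>R h))) (at t)"
    by (auto intro!: derivative_eq_intros)
  moreover have "(f has_derivative (\<lambda>k. k \<bullet> f' (y - t *\<^sub>R h))) (at (y - t *\<^sub>R h))"
    using assms unfolding C1_def gderiv_def by blast
  ultimately have "((\<lambda>t. f (y - t *\<^sub>R h)) has_derivative (\<lambda>s. - (s *\<^sub>R h) \<bullet> f' (y - t *\<^sub>R h))) (at t)"
    by (rule has_derivative_compose)
  then show ?thesis
    unfolding has_field_derivative_def
    by (rule has_derivative_eq_rhs) (auto simp: fun_eq_iff inner_commute)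
qed

text \<open>Dominated convergence: by the mean value bound the difference quotients of
  \<open>f\<close> are at most \<open>B * norm h\<close>, so a multiple of
  \<open>\<bar>u\<bar>\<close> dominates. The case \<open>u = 1\<close> yields integration by parts,
  and a bump for \<open>f\<close> yields the derivative of mollified values.\<close>

lemma integral_translate_derivative:
  fixes u f :: "'a::euclidean_space \<Rightarrow> real"
  assumes u: "integrable (lebesgue_on S) u" and f: "C1 f f'"
    and B: "\<And>x. norm (f x) \<le> B" "\<And>x. norm (f' x) \<le> B"
  shows "((\<lambda>t. integral\<^sup>L (lebesgue_on S) (\<lambda>y. u y * f (y - t *\<^sub>R h))) has_real_derivative
     - integral\<^sup>L (lebesgue_on S) (\<lambda>y. u y * (f' (y - t *\<^sub>R h) \<bullet> h))) (at t)"
proof -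
  define F where "F t = integral\<^sup>L (lebesgue_on S) (\<lambda>y. u y * f (y - t *\<^sub>R h))" for t
  have cont: "continuous_on UNIV (\<lambda>y. f (y - t *\<^sub>R h))" for t
    using C1_continuous[OF C1_translate[OF f]] .
  have cont': "continuous_on UNIV (\<lambda>y. f' (y - t *\<^sub>R h) \<bullet> h)" for t
    using C1_gradient_continuous[OF C1_translate[OF f]] by (auto intro: continuous_intros)
  have int: "integrable (lebesgue_on S) (\<lambda>y. u y * f (y - t *\<^sub>R h))" for t
    using integrable_mult_bounded[OF u cont B(1)] by simp
  have "((\<lambda>s. (F (t + s) - F t) / s) \<longlongrightarrow> - integral\<^sup>L (lebesgue_on S) (\<lambda>y. u y * (f' (y - t *\<^sub>R h) \<bullet> h))) (at 0)"
    unfolding tendsto_at_iff_sequentially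
  proof (intro allI impI)
    fix X :: "nat \<Rightarrow> real" assume X: "\<forall>i. X i \<in> UNIV - {0}" "X \<longlonglongrightarrow> 0"
    let ?D = "\<lambda>i y. u y * ((f (y - (t + X i) *\<^sub>R h) - f (y - t *\<^sub>R h)) / X i)"
    have quot: "(F (t + X i) - F t) / X i = integral\<^sup>L (lebesgue_on S) (?D i)" for i
    proof -
      have "F (t + X i) - F t = integral\<^sup>L (lebesgue_on S)
          (\<lambda>y. u y * f (y - (t + X i) *\<^sub>R h) - u y * f (y - t *\<^sub>R h))"
        unfolding F_def using int by (simp add: Bochner_Integration.integral_diff)
      also have "\<dots> / X i = integral\<^sup>L (lebesgue_on S) (?D i)"
        unfolding Bochner_Integration.integral_divide_zero[symmetric] by (simp add: algebra_simps)
      finally show ?thesis .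
    qed
    have "(\<lambda>i. integral\<^sup>L (lebesgue_on S) (?D i)) \<longlonglongrightarrow>
        integral\<^sup>L (lebesgue_on S) (\<lambda>y. u y * - (f' (y - t *\<^sub>R h) \<bullet> h))"
    proof (rule integral_dominated_convergence)
      have [measurable]: "u \<in> borel_measurable (lebesgue_on S)" using u by simp
      have [measurable]: "(\<lambda>y. f (y - s *\<^sub>R h)) \<in> borel_measurable (lebesgue_on S)" for s
        using continuous_measurable_lebesgue_on[OF cont] .
      have [measurable]: "(\<lambda>y. f' (y - t *\<^sub>R h) \<bullet> h) \<in> borel_measurable (lebesgue_on S)"
        using continuous_measurable_lebesgue_on[OF cont'] .
      show "(\<lambda>y. u y * - (f' (y - t *\<^sub>R h) \<bullet> h)) \<in> borel_measurable (lebesgue_on S)"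
        by measurable
      show "?D i \<in> borel_measurable (lebesgue_on S)" for i
        by measurable
      show "integrable (lebesgue_on S) (\<lambda>y. (B * norm h) * \<bar>u y\<bar>)"
        using u by simp
      show "AE y in lebesgue_on S. (\<lambda>i. ?D i y) \<longlonglongrightarrow> u y * - (f' (y - t *\<^sub>R h) \<bullet> h)"
      proof (intro always_eventually allI tendsto_mult tendsto_const)
        fix y
        have "((\<lambda>s. (f (y - (t + s) *\<^sub>R h) - f (y - t *\<^sub>R h)) / s) \<longlongrightarrow> - (f' (y - t *\<^sub>R h) \<bullet> h)) (at 0)"
          using C1_along_line[OF f, of y h t] unfolding DERIV_def .
        then show "(\<lambda>i. (f (y - (t + X i) *\<^sub>R h) - f (y - t *\<^sub>R h)) / X i) \<longlonglongrightarrow> - (f' (y - t *\<^sub>R h) \<bullet> h)"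
          using X unfolding tendsto_at_iff_sequentially by (auto simp: o_def)
      qed
      show "AE y in lebesgue_on S. norm (?D i y) \<le> (B * norm h) * \<bar>u y\<bar>" for i
      proof (intro always_eventually allI)
        fix y
        have "\<bar>f (y - (t + X i) *\<^sub>R h) - f (y - t *\<^sub>R h)\<bar> \<le> B * norm ((y - (t + X i) *\<^sub>R h) - (y - t *\<^sub>R h))"
          by (rule C1_lipschitz[OF f B(2)])
        also have "\<dots> = B * norm h * \<bar>X i\<bar>"
          by (simp add: algebra_simps)
        finally have "\<bar>(f (y - (t + X i) *\<^sub>R h) - f (y - t *\<^sub>R h)) / X i\<bar> \<le> B * norm h"
          using X(1) by (simp add: divide_le_eq)
        then have "\<bar>u y\<bar> * \<bar>(f (y - (t + X i) *\<^sub>R h) - f (y - t *\<^sub>R h)) / X i\<bar> \<le> \<bar>u y\<bar> * (B * norm h)"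
          by (rule mult_left_mono) simp
        then show "norm (?D i y) \<le> (B * norm h) * \<bar>u y\<bar>"
          unfolding real_norm_def abs_mult by (simp only: mult.commute)
      qed
    qed
    then show "((\<lambda>s. (F (t + s) - F t) / s) \<circ> X) \<longlonglongrightarrow>
        - integral\<^sup>L (lebesgue_on S) (\<lambda>y. u y * (f' (y - t *\<^sub>R h) \<bullet> h))"
      by (simp add: o_def quot)
  qed
  then show ?thesis unfolding DERIV_def F_def .
qed

lemma integral_lebesgue_on_eq:
  fixes f :: "'a::euclidean_space \<Rightarrow> real"
  assumes "S \<in> sets lebesgue" "\<And>x. x \<notin> S \<Longrightarrow> f x = 0"
  shows "integral\<^sup>L (lebesgue_on S) f = integral\<^sup>L lebesgue f"
proof -
  have "(\<lambda>x. indicator S x *\<^sub>R f x) = f"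
    using assms(2) by (fastforce simp: indicator_def)
  then show ?thesis using assms(1) integral_restrict_space[of S lebesgue f] by simp
qed

lemma integral_lebesgue_translate:
  fixes f :: "'a::euclidean_space \<Rightarrow> real"
  assumes "continuous_on UNIV f"
  shows "integral\<^sup>L lebesgue (\<lambda>x. f (x - a)) = integral\<^sup>L lebesgue f"
proof -
  have [measurable]: "f \<in> borel_measurable borel"
    using borel_measurable_continuous_onI[OF assms] .
  have "integral\<^sup>L lebesgue (\<lambda>x. f (x - a)) = integral\<^sup>L lborel (\<lambda>x. f (- a + x))"
    by (simp add: integral_completion)
  also have "\<dots> = integral\<^sup>L (distr lborel borel ((+) (- a))) f"
    by (rule integral_distr[symmetric]) measurable
  also have "\<dots> = integral\<^sup>L lebesgue f"
    by (simp add: lborel_distr_plus integral_completion)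
  finally show ?thesis .
qed

text \<open>Small translates of \<open>f\<close> keep their support in \<open>S\<close>, so their
  integral over \<open>S\<close> is constant; its derivative at 0 is minus the integral in
  question.\<close>

lemma integral_gradient_test_function:
  fixes f :: "'a::euclidean_space \<Rightarrow> real"
  assumes "test_function S f f'" "open S" "bounded S"
  shows "integral\<^sup>L (lebesgue_on S) (\<lambda>y. f' y \<bullet> h) = 0"
proof -
  obtain K B where K: "compact K" "K \<subseteq> S" "\<And>x. x \<notin> K \<Longrightarrow> f x = 0"
      "\<And>x. norm (f x) \<le> B" "\<And>x. norm (f' x) \<le> B"
    using test_functionE[OF assms(1)] by metis
  have f: "C1 f f'" using assms(1) test_function_C1 by blast
  have S: "S \<in> sets lebesgue" using assms(2) by simp
  let ?F = "\<lambda>t. integral\<^sup>L (lebesgue_on S) (\<lambda>y. 1 * f (y - t *\<^sub>R h))"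
  obtain e where e: "e > 0" "(\<Union>x\<in>K. ball x e) \<subseteq> S"
    using compact_subset_open_imp_ball_epsilon_subset[OF K(1) assms(2) K(2)] by blast
  \<comment> \<open>The summand 1 in the denominator covers the case \<open>h = 0\<close>.\<close>
  have const: "?F t = integral\<^sup>L lebesgue f" if "t \<in> ball 0 (e / (norm h + 1))" for t
  proof -
    have nh: "norm h + 1 > 0" using norm_ge_zero[of h] by linarith
    have "\<bar>t\<bar> * norm h \<le> \<bar>t\<bar> * (norm h + 1)" by (rule mult_left_mono) auto
    also have "\<dots> < e" using that nh by (simp add: dist_real_def pos_less_divide_eq)
    finally have small: "norm (t *\<^sub>R h) < e" by simp
    have "f (y - t *\<^sub>R h) = 0" if "y \<notin> S" for y
    proof (rule K(3), rule notI)
      assume "y - t *\<^sub>R h \<in> K"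
      then have "y \<in> S" using e(2) small by (force simp: dist_norm)
      then show False using that by blast
    qed
    then have "?F t = integral\<^sup>L lebesgue (\<lambda>y. f (y - t *\<^sub>R h))"
      using integral_lebesgue_on_eq[OF S] by simp
    then show ?thesis
      using integral_lebesgue_translate[OF C1_continuous[OF f]] by simp
  qed
  have "(?F has_real_derivative 0) (at 0)"
  proof (rule has_field_derivative_transform_within_open)
    show "((\<lambda>t. integral\<^sup>L lebesgue f) has_real_derivative 0) (at 0)" by simp
    show "(0::real) \<in> ball 0 (e / (norm h + 1))"
      using e(1) norm_ge_zero[of h] by (simp add: add_nonneg_pos)
  qed (use const in auto)
  moreover have "(?F has_real_derivative - integral\<^sup>L (lebesgue_on S) (\<lambda>y. 1 * (f' (y - 0 *\<^sub>R h) \<bullet> h))) (at 0)"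
    by (rule integral_translate_derivative[OF integrable_const_bounded[OF assms(3) S] f K(4,5)])
  ultimately show ?thesis
    using DERIV_unique by fastforce
qed

text \<open>The cut-off is a product over the defining half-spaces of a profile applied to
  \<open>n\<close> times the slack minus 1. It vanishes as soon as one slack is at most
  \<open>1 / n\<close>, which confines the support to a compact part of the interior, and at an
  interior point all slacks are positive, so it tends to 1.\<close>

lemma polytope_interior_cutoffs:
  fixes P :: "'a::euclidean_space set"
  assumes "polytope P"
  obtains \<kappa> \<kappa>' where "\<And>n::nat. test_function (interior P) (\<kappa> n) (\<kappa>' n)"
    "\<And>n x. 0 \<le> \<kappa> n x \<and> \<kappa> n x \<le> 1" "\<And>x. x \<in> interior P \<Longrightarrow> (\<lambda>n. \<kappa> n x) \<longlonglongrightarrow> 1"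
proof -
  obtain H where H: "finite H" "P = \<Inter>H" "\<forall>h\<in>H. \<exists>a b. a \<noteq> 0 \<and> h = {x. a \<bullet> x \<le> b}"
    using assms polytope_imp_polyhedron unfolding polyhedron_def by metis
  then obtain a b where ab: "\<And>h. h \<in> H \<Longrightarrow> a h \<noteq> 0 \<and> h = {x. a h \<bullet> x \<le> b h}"
    by metis
  have int_h: "interior h = {x. a h \<bullet> x < b h}" if "h \<in> H" for h
  proof -
    have "interior h = interior {x. a h \<bullet> x \<le> b h}"
      by (rule arg_cong[of _ _ interior]) (use ab that in blast)
    also have "\<dots> = {x. a h \<bullet> x < b h}"
      by (rule interior_halfspace_le) (use ab that in blast)
    finally show ?thesis .
  qed
  have int: "interior P = {x. \<forall>h\<in>H. a h \<bullet> x < b h}"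
  proof -
    have "interior P = (\<Inter>h\<in>H. interior h)"
      unfolding H(2) using H(1) by (induction H rule: finite_induct) auto
    also have "\<dots> = (\<Inter>h\<in>H. {x. a h \<bullet> x < b h})"
      by (rule INF_cong[OF refl int_h])
    finally show ?thesis by blast
  qed
  \<comment> \<open>A C^1 profile with values in [0, 1] that is 0 on the negative half-line and
    tends to 1 at infinity.\<close>
  define \<eta> :: "real \<Rightarrow> real" where "\<eta> t = (max 0 t)\<^sup>2 / (1 + (max 0 t)\<^sup>2)" for t
  define \<eta>' :: "real \<Rightarrow> real" where "\<eta>' t = 2 * max 0 t / (1 + (max 0 t)\<^sup>2)\<^sup>2" for t
  have pos: "1 + (max 0 t)\<^sup>2 > (0::real)" for t :: real
    using zero_le_power2[of "max 0 t"] by linarith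
  have \<eta>': "(\<eta> has_real_derivative \<eta>' t) (at t)" for t
  proof -
    have "(\<eta> has_real_derivative (2 * max 0 t * (1 + (max 0 t)\<^sup>2) - (max 0 t)\<^sup>2 * (0 + 2 * max 0 t)) /
        ((1 + (max 0 t)\<^sup>2) * (1 + (max 0 t)\<^sup>2))) (at t)"
      unfolding \<eta>_def using pos[of t]
      by (intro DERIV_divide DERIV_add DERIV_const C1_pospart_power2) simp
    moreover have "2 * max 0 t * (1 + (max 0 t)\<^sup>2) - (max 0 t)\<^sup>2 * (0 + 2 * max 0 t) = 2 * max 0 t"
      by (simp add: algebra_simps)
    ultimately show ?thesis unfolding \<eta>'_def power2_eq_square[of "1 + (max 0 t)\<^sup>2"] by simp
  qed
  have cont: "continuous_on UNIV \<eta>'"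
    unfolding \<eta>'_def using pos by (auto intro!: continuous_intros simp: less_imp_neq[symmetric])
  have \<eta>01: "0 \<le> \<eta> t \<and> \<eta> t \<le> 1" for t
    unfolding \<eta>_def using pos[of t] by (auto simp: divide_le_eq)
  define \<xi> where "\<xi> n h x = \<eta> (real n * (b h - a h \<bullet> x) - 1)" for n h x
  have "\<exists>\<xi>'. C1 (\<xi> n h) \<xi>'" for n h
  proof -
    have "C1 (\<lambda>x. real n * (b h + (-1) * (x \<bullet> a h)) + (-1)) (\<lambda>x. real n *\<^sub>R (0 + (-1) *\<^sub>R a h) + 0)"
      by (intro C1_add C1_cmult C1_const C1_inner)
    from C1_compose[OF this \<eta>' cont] show ?thesis
      unfolding \<xi>_def by (auto simp: inner_commute)
  qed
  then have ex_C1: "\<exists>\<kappa>'. C1 (\<lambda>x. \<Prod>h\<in>G. \<xi> n h x) \<kappa>'" for n G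
  proof (induction G rule: infinite_finite_induct)
    case (insert h G)
    then obtain f g where "C1 (\<xi> n h) f" "C1 (\<lambda>x. \<Prod>h\<in>G. \<xi> n h x) g" by metis
    from C1_mult[OF this] show ?case using insert.hyps by auto
  qed (auto intro: C1_const)
  have "\<forall>n. \<exists>\<kappa>'. C1 (\<lambda>x. \<Prod>h\<in>H. \<xi> n h x) \<kappa>'" using ex_C1 by (rule allI)
  from choice[OF this] obtain \<kappa>' where "\<forall>n. C1 (\<lambda>x. \<Prod>h\<in>H. \<xi> n h x) (\<kappa>' n)" ..
  note \<kappa>' = this[rule_format]
  let ?\<kappa> = "\<lambda>n x. \<Prod>h\<in>H. \<xi> n h x"
  show thesis
  proof (rule that[of ?\<kappa> \<kappa>'])
    fix n :: nat
    let ?K = "{x\<in>P. \<forall>h\<in>H. real n * (b h - a h \<bullet> x) \<ge> 1}"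
    have "test_function (interior P) (?\<kappa> n) (\<kappa>' n)"
      unfolding test_function_C1
    proof (intro conjI exI[of _ ?K] allI impI \<kappa>')
      have "closed (\<Inter>h\<in>H. {x. real n * (b h - a h \<bullet> x) \<ge> 1})"
        by (intro closed_INT ballI closed_Collect_le continuous_intros)
      moreover have "?K = P \<inter> (\<Inter>h\<in>H. {x. real n * (b h - a h \<bullet> x) \<ge> 1})" by blast
      ultimately show "compact ?K"
        by (simp only: compact_Int_closed polytope_imp_compact[OF assms])
      show "?K \<subseteq> interior P"
      proof
        fix x assume x: "x \<in> ?K"
        have "a h \<bullet> x < b h" if "h \<in> H" for h
        proof (rule ccontr)
          assume "\<not> a h \<bullet> x < b h"
          then have "real n * (b h - a h \<bullet> x) \<le> 0"
            by (simp add: mult_le_0_iff)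
          moreover have "real n * (b h - a h \<bullet> x) \<ge> 1" using x that by blast
          ultimately show False by linarith
        qed
        then show "x \<in> interior P" unfolding int by blast
      qed
      fix x assume x: "x \<notin> ?K"
      have "\<exists>h\<in>H. real n * (b h - a h \<bullet> x) < 1"
      proof (cases "x \<in> P")
        case False
        then obtain h where h: "h \<in> H" "x \<notin> h" using H(2) by blast
        then have "a h \<bullet> x > b h" using ab[OF h(1)] by force
        then have "real n * (b h - a h \<bullet> x) \<le> 0" by (simp add: mult_le_0_iff)
        then show ?thesis using h(1) by force
      qed (use x in force)
      then have "\<exists>h\<in>H. \<xi> n h x = 0"
        unfolding \<xi>_def \<eta>_def by (force simp: max_def)
      then show "?\<kappa> n x = 0" by (rule prod_zero[OF H(1)])
    qed
    then show "test_function (interior P) (?\<kappa> n) (\<kappa>' n)" .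
    fix x
    show "0 \<le> ?\<kappa> n x \<and> ?\<kappa> n x \<le> 1"
      using \<eta>01 unfolding \<xi>_def by (auto intro!: prod_nonneg prod_le_1)
  next
    fix x assume x: "x \<in> interior P"
    have "(\<lambda>n. \<xi> n h x) \<longlonglongrightarrow> 1" if "h \<in> H" for h
    proof -
      have "b h - a h \<bullet> x > 0" using x that unfolding int by auto
      then have "filterlim (\<lambda>n. - 1 + (b h - a h \<bullet> x) * real n) at_top sequentially"
        by (intro filterlim_tendsto_add_at_top[OF tendsto_const]
            filterlim_tendsto_pos_mult_at_top[OF tendsto_const] filterlim_real_sequentially)
      then have "filterlim (\<lambda>n. real n * (b h - a h \<bullet> x) - 1) at_top sequentially"
        by (simp add: mult.commute)
      moreover have "(\<eta> \<longlongrightarrow> 1) at_top"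
      proof (rule Lim_transform_eventually)
        have "filterlim (\<lambda>t::real. 1 + t\<^sup>2) at_top at_top"
        proof (rule filterlim_at_top_mono[OF filterlim_ident])
          show "\<forall>\<^sub>F t::real in at_top. t \<le> 1 + t\<^sup>2"
            by (intro always_eventually allI less_imp_le less_one_plus_power2)
        qed
        then have "((\<lambda>t::real. 1 - inverse (1 + t\<^sup>2)) \<longlongrightarrow> 1 - 0) at_top"
          by (intro tendsto_diff tendsto_const tendsto_inverse_0_at_top)
        then show "((\<lambda>t::real. 1 - inverse (1 + t\<^sup>2)) \<longlongrightarrow> 1) at_top" by simp
        show "\<forall>\<^sub>F t in at_top. 1 - inverse (1 + t\<^sup>2) = \<eta> t"
          using eventually_ge_at_top[of 0]
        proof eventually_elim
          case (elim t)
          then show ?case using pos[of t] by (simp add: \<eta>_def field_simps)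
        qed
      qed
      ultimately show ?thesis
        unfolding \<xi>_def by (rule filterlim_compose[rotated])
    qed
    then have "(\<lambda>n. ?\<kappa> n x) \<longlonglongrightarrow> (\<Prod>h\<in>H. 1)" by (intro tendsto_prod)
    then show "(\<lambda>n. ?\<kappa> n x) \<longlonglongrightarrow> 1" by simp
  qed
qed

section \<open>The weak gradient tested inside elements\<close>

lemma integral_mult_inner:
  fixes g :: "'a::euclidean_space \<Rightarrow> 'b::euclidean_space"
  assumes "integrable M (\<lambda>x. f x *\<^sub>R g x)"
  shows "integral\<^sup>L M (\<lambda>x. f x * (g x \<bullet> h)) = integral\<^sup>L M (\<lambda>x. f x *\<^sub>R g x) \<bullet> h"
  using integral_inner_left[of h M "\<lambda>x. f x *\<^sub>R g x"] assms by simp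

lemma integrable_bounded_mult:
  fixes \<psi> :: "'a::euclidean_space \<Rightarrow> real" and g :: "'a \<Rightarrow> 'b::euclidean_space"
  assumes "integrable (lebesgue_on S) g" "continuous_on UNIV \<psi>" "\<And>x. norm (\<psi> x) \<le> B"
  shows "integrable (lebesgue_on S) (\<lambda>x. \<psi> x *\<^sub>R g x)"
proof (rule Bochner_Integration.integrable_bound)
  show "integrable (lebesgue_on S) (\<lambda>x. B *\<^sub>R g x)"
    using assms(1) by simp
  show "(\<lambda>x. \<psi> x *\<^sub>R g x) \<in> borel_measurable (lebesgue_on S)"
    using assms(1) continuous_measurable_lebesgue_on[OF assms(2)] by measurable
  have "0 \<le> B" using assms(3) norm_ge_zero order_trans by blast
  then show "AE x in lebesgue_on S. norm (\<psi> x *\<^sub>R g x) \<le> norm (B *\<^sub>R g x)"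
    using assms(3) by (intro always_eventually allI) (simp add: mult_right_mono)
qed

lemma integrable_test_function:
  assumes "test_function \<Omega> \<psi> \<psi>'" "bounded \<Omega>" "open \<Omega>"
  shows "integrable (lebesgue_on \<Omega>) \<psi>"
proof -
  obtain B where "\<And>x. norm (\<psi> x) \<le> B" using test_functionE[OF assms(1)] by metis
  then show ?thesis
    using integrable_mult_bounded[OF integrable_const_bounded[of \<Omega> 1], of \<psi> B] assms
      C1_continuous[of \<psi> \<psi>'] test_function_C1 by fastforce
qed

text \<open>Elements are only known to lie in the closure of \<open>\<Omega>\<close>, hence the intersections
  \<open>\<Omega> \<inter> T\<close> below.\<close>

locale piecewise_H1 =
  fixes \<Omega> :: "'a::euclidean_space set" and \<T> :: "'a set set"
    and u :: "'a \<Rightarrow> real" and g :: "'a \<Rightarrow> 'a"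
    and q :: "'a set \<Rightarrow> 'a \<Rightarrow> real" and q' :: "'a set \<Rightarrow> 'a \<Rightarrow> 'a" and M :: real
  assumes open_domain: "open \<Omega>" and bounded_domain: "bounded \<Omega>"
    and finite_mesh: "finite \<T>" and simplices: "\<And>T. T \<in> \<T> \<Longrightarrow> open_simplex T"
    and disjoint: "\<And>S T. S \<in> \<T> \<Longrightarrow> T \<in> \<T> \<Longrightarrow> S \<inter> T \<noteq> {} \<Longrightarrow> S = T"
    and cover: "closure \<Omega> = \<Union>(closure ` \<T>)"
    and integrable_u: "integrable (lebesgue_on \<Omega>) u"
    and integrable_g: "integrable (lebesgue_on \<Omega>) g"
    and gradient: "weak_gradient \<Omega> u g"
    and u_eq: "\<And>T. T \<in> \<T> \<Longrightarrow> AE x in lebesgue_on T. u x = q T x"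
    and q_C1: "\<And>T. T \<in> \<T> \<Longrightarrow> C1 (q T) (q' T)"
    and q'_bound: "\<And>T x. T \<in> \<T> \<Longrightarrow> x \<in> T \<Longrightarrow> norm (q' T x) \<le> M"
    and M_nonneg: "0 \<le> M"
begin

lemma sets_domain [simp]: "\<Omega> \<in> sets lebesgue"
  using open_domain by simp

lemma AE_in_element:
  assumes "T \<in> \<T>"
  shows "AE x in lebesgue_on \<Omega>. x \<in> T \<longrightarrow> u x = q T x"
proof -
  have "T \<in> sets lebesgue" using open_simplex_open[OF simplices[OF assms]] by simp
  then have "AE x in lebesgue. x \<in> T \<longrightarrow> u x = q T x"
    using u_eq[OF assms] by (simp add: AE_restrict_space_iff)
  then show ?thesis
    by (simp add: AE_restrict_space_iff) (auto elim: eventually_mono)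
qed

lemma AE_elements: "AE x in lebesgue_on \<Omega>. x \<in> \<Union>\<T>"
proof -
  have "negligible (\<Union>(frontier ` \<T>))"
    using finite_mesh open_simplex_frontier_negligible simplices by (intro negligible_Union) auto
  then have "AE x in lebesgue. x \<notin> \<Union>(frontier ` \<T>)"
    by (intro AE_not_in) (simp add: negligible_iff_null_sets)
  moreover have "x \<in> \<Union>\<T>" if x: "x \<notin> \<Union>(frontier ` \<T>)" "x \<in> \<Omega>" for x
  proof -
    obtain T where T: "T \<in> \<T>" "x \<in> closure T" using x(2) cover closure_subset by blast
    then have "x \<in> interior T" using x(1) unfolding frontier_def by blast
    then show ?thesis using T(1) interior_subset by blast
  qed
  ultimately show ?thesis
    by (simp add: AE_restrict_space_iff) (auto elim: eventually_mono)
qed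

text \<open>On the support of \<theta> the function \<open>u\<close> may be replaced by
  \<open>q T\<close>. Then \<theta> is moved back off its derivative, since the gradient of the
  product \<open>q T x * \<theta> x\<close> has integral zero.\<close>

lemma element_gradient:
  assumes T: "T \<in> \<T>" and \<theta>: "test_function (\<Omega> \<inter> T) \<theta> \<theta>'"
  shows "integral\<^sup>L (lebesgue_on \<Omega>) (\<lambda>x. \<theta> x * (g x \<bullet> h)) = integral\<^sup>L (lebesgue_on \<Omega>) (\<lambda>x. \<theta> x * (q' T x \<bullet> h))"
proof -
  have \<theta>\<Omega>: "test_function \<Omega> \<theta> \<theta>'" using test_function_mono[OF \<theta>] by blast
  have C1: "C1 \<theta> \<theta>'" using \<theta> test_function_C1 by blast
  obtain K B where K: "compact K" "K \<subseteq> \<Omega> \<inter> T" "\<And>x. x \<notin> K \<Longrightarrow> \<theta> x = 0" "\<And>x. x \<notin> K \<Longrightarrow> \<theta>' x = 0"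
    "\<And>x. norm (\<theta> x) \<le> B" "\<And>x. norm (\<theta>' x) \<le> B" using test_functionE[OF \<theta>] by metis
  have int_u: "integrable (lebesgue_on \<Omega>) (\<lambda>x. u x *\<^sub>R \<theta>' x)"
    using integrable_mult_bounded[OF integrable_u C1_gradient_continuous[OF C1] K(6)] .
  have int_g: "integrable (lebesgue_on \<Omega>) (\<lambda>x. \<theta> x *\<^sub>R g x)"
    using integrable_bounded_mult[OF integrable_g C1_continuous[OF C1] K(5)] .
  have q\<theta>: "test_function \<Omega> (\<lambda>x. q T x * \<theta> x) (\<lambda>x. q T x *\<^sub>R \<theta>' x + \<theta> x *\<^sub>R q' T x)"
    by (rule test_function_mult[OF \<theta>\<Omega> q_C1[OF T]])
  have [measurable]: "q T \<in> borel_measurable (lebesgue_on \<Omega>)" "q' T \<in> borel_measurable (lebesgue_on \<Omega>)"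
    "\<theta> \<in> borel_measurable (lebesgue_on \<Omega>)" "\<theta>' \<in> borel_measurable (lebesgue_on \<Omega>)"
    using C1_continuous[OF C1] C1_gradient_continuous[OF C1] C1_continuous[OF q_C1[OF T]]
      C1_gradient_continuous[OF q_C1[OF T]] continuous_measurable_lebesgue_on by blast+
  have [measurable]: "u \<in> borel_measurable (lebesgue_on \<Omega>)" using integrable_u by simp
  have AE: "AE x in lebesgue_on \<Omega>. u x * (\<theta>' x \<bullet> h) = q T x * (\<theta>' x \<bullet> h)"
    using AE_in_element[OF T]
  proof eventually_elim
    case (elim x)
    then show ?case using K(2,4) by (cases "x \<in> K") auto
  qed
  have int_q: "integrable (lebesgue_on \<Omega>) (\<lambda>x. q T x * (\<theta>' x \<bullet> h))"
  proof -
    have "integrable (lebesgue_on \<Omega>) (\<lambda>x. u x * (\<theta>' x \<bullet> h))"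
      using integrable_inner_left[of h, OF int_u] by simp
    then show ?thesis
      using Bochner_Integration.integrable_cong_AE[OF _ _ AE] by simp
  qed
  have int_sum: "integrable (lebesgue_on \<Omega>) (\<lambda>x. (q T x *\<^sub>R \<theta>' x + \<theta> x *\<^sub>R q' T x) \<bullet> h)"
  proof -
    obtain B' where "\<And>x. norm (q T x *\<^sub>R \<theta>' x + \<theta> x *\<^sub>R q' T x) \<le> B'"
      using test_functionE[OF q\<theta>] by metis
    moreover have "continuous_on UNIV (\<lambda>x. q T x *\<^sub>R \<theta>' x + \<theta> x *\<^sub>R q' T x)"
      using q\<theta> unfolding test_function_def by blast
    ultimately have "integrable (lebesgue_on \<Omega>) (\<lambda>x. 1 *\<^sub>R (q T x *\<^sub>R \<theta>' x + \<theta> x *\<^sub>R q' T x))"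
      by (intro integrable_mult_bounded[OF integrable_const_bounded[OF bounded_domain]]) auto
    then show ?thesis using integrable_inner_left[of h] by simp
  qed
  have int_q': "integrable (lebesgue_on \<Omega>) (\<lambda>x. \<theta> x * (q' T x \<bullet> h))"
    using Bochner_Integration.integrable_diff[OF int_sum int_q] by (simp add: inner_add_left)
  have "integral\<^sup>L (lebesgue_on \<Omega>) (\<lambda>x. \<theta> x * (g x \<bullet> h)) = integral\<^sup>L (lebesgue_on \<Omega>) (\<lambda>x. \<theta> x *\<^sub>R g x) \<bullet> h"
    by (rule integral_mult_inner[OF int_g])
  also have "\<dots> = - (integral\<^sup>L (lebesgue_on \<Omega>) (\<lambda>x. u x *\<^sub>R \<theta>' x) \<bullet> h)"
    using gradient \<theta>\<Omega> unfolding weak_gradient_def by simp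
  also have "\<dots> = - integral\<^sup>L (lebesgue_on \<Omega>) (\<lambda>x. u x * (\<theta>' x \<bullet> h))"
    using integral_mult_inner[OF int_u] by simp
  also have "\<dots> = - integral\<^sup>L (lebesgue_on \<Omega>) (\<lambda>x. q T x * (\<theta>' x \<bullet> h))"
    using integral_cong_AE[OF _ _ AE] by simp
  also have "\<dots> = integral\<^sup>L (lebesgue_on \<Omega>) (\<lambda>x. \<theta> x * (q' T x \<bullet> h))"
    using integral_gradient_test_function[OF q\<theta> open_domain bounded_domain, of h]
      Bochner_Integration.integral_add[OF int_q int_q']
    by (simp add: inner_add_left)
  finally show ?thesis .
qed

lemma element_gradient_bound:
  assumes T: "T \<in> \<T>" and \<theta>: "test_function (\<Omega> \<inter> T) \<theta> \<theta>'" and nonneg: "\<And>x. 0 \<le> \<theta> x"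
  shows "\<bar>integral\<^sup>L (lebesgue_on \<Omega>) (\<lambda>x. \<theta> x * (g x \<bullet> h))\<bar> \<le> M * norm h * integral\<^sup>L (lebesgue_on \<Omega>) \<theta>"
proof -
  obtain K where K: "K \<subseteq> \<Omega> \<inter> T" "\<And>x. x \<notin> K \<Longrightarrow> \<theta> x = 0"
    using test_functionE[OF \<theta>] by metis
  have int: "integrable (lebesgue_on \<Omega>) \<theta>"
    using integrable_test_function[OF test_function_mono[OF \<theta>]] bounded_domain open_domain by blast
  have bound: "\<bar>\<theta> x * (q' T x \<bullet> h)\<bar> \<le> M * norm h * \<theta> x" for x
  proof (cases "x \<in> K")
    case True
    then have "\<bar>q' T x \<bullet> h\<bar> \<le> M * norm h"
      using Cauchy_Schwarz_ineq2[of "q' T x" h] q'_bound[OF T, of x] K(1)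
      by (meson Int_iff mult_right_mono norm_ge_zero order_trans subsetD)
    then show ?thesis using nonneg[of x] by (simp add: abs_mult mult.commute mult_left_mono)
  qed (simp add: K(2))
  have "\<bar>integral\<^sup>L (lebesgue_on \<Omega>) (\<lambda>x. \<theta> x * (q' T x \<bullet> h))\<bar> \<le> integral\<^sup>L (lebesgue_on \<Omega>) (\<lambda>x. M * norm h * \<theta> x)"
    using bound int nonneg M_nonneg by (intro integral_abs_bound[THEN order_trans] integral_mono') auto
  then show ?thesis
    unfolding element_gradient[OF T \<theta>] by simp
qed

text \<open>Cutting the test function off inside each element replaces \<open>g\<close> by the gradients of the
  polynomials, and the cut-off functions tend to \<open>1\<close> almost everywhere. No pointwise
  identification of \<open>g\<close> is needed.\<close>

lemma gradient_bound:
  assumes \<phi>: "test_function \<Omega> \<phi> \<phi>'" and nonneg: "\<And>x. 0 \<le> \<phi> x"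
  shows "\<bar>integral\<^sup>L (lebesgue_on \<Omega>) (\<lambda>x. u x * (\<phi>' x \<bullet> h))\<bar> \<le> M * norm h * integral\<^sup>L (lebesgue_on \<Omega>) \<phi>"
proof -
  have C1: "C1 \<phi> \<phi>'" using \<phi> test_function_C1 by blast
  obtain K B where K: "compact K" "K \<subseteq> \<Omega>" "\<And>x. x \<notin> K \<Longrightarrow> \<phi> x = 0" "\<And>x. x \<notin> K \<Longrightarrow> \<phi>' x = 0"
    "\<And>x. norm (\<phi> x) \<le> B" "\<And>x. norm (\<phi>' x) \<le> B" using test_functionE[OF \<phi>] by metis
  have int_u: "integrable (lebesgue_on \<Omega>) (\<lambda>x. u x *\<^sub>R \<phi>' x)"
    using integrable_mult_bounded[OF integrable_u C1_gradient_continuous[OF C1] K(6)] .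
  have int_g: "integrable (lebesgue_on \<Omega>) (\<lambda>x. \<phi> x *\<^sub>R g x)"
    using integrable_bounded_mult[OF integrable_g C1_continuous[OF C1] K(5)] .
  have "\<exists>\<kappa> \<kappa>'. (\<forall>n::nat. test_function T (\<kappa> n) (\<kappa>' n)) \<and> (\<forall>n x. 0 \<le> \<kappa> n x \<and> \<kappa> n x \<le> 1) \<and>
      (\<forall>x\<in>T. (\<lambda>n. \<kappa> n x) \<longlonglongrightarrow> (1::real))" if "T \<in> \<T>" for T
  proof -
    have "polytope (closure T)"
      using open_simplex_closure[OF simplices[OF that]] open_simplex_finite_vertices[OF simplices[OF that]]
      unfolding polytope_def by blast
    from polytope_interior_cutoffs[OF this] show ?thesis
      unfolding open_simplex_eq_interior[OF simplices[OF that], symmetric] by metis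
  qed
  then obtain \<kappa> \<kappa>' where \<kappa>: "\<And>T n. T \<in> \<T> \<Longrightarrow> test_function T (\<kappa> T n) (\<kappa>' T (n::nat))"
      "\<And>T n x. T \<in> \<T> \<Longrightarrow> 0 \<le> \<kappa> T n x \<and> \<kappa> T n x \<le> 1"
      "\<And>T x. T \<in> \<T> \<Longrightarrow> x \<in> T \<Longrightarrow> (\<lambda>n. \<kappa> T n x) \<longlonglongrightarrow> (1::real)"
    by metis
  have \<kappa>0: "\<kappa> T n x = 0" if "T \<in> \<T>" "x \<notin> T" for T n x
    using \<kappa>(1)[OF that(1)] that(2) unfolding test_function_def by blast
  \<comment> \<open>At each point at most one cut-off is nonzero because elements are disjoint. The
    sum thus stays in [0, 1], and the bounds on the elements add up without a factor counting
    them.\<close>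
  have sum\<kappa>: "(\<Sum>T\<in>\<T>. \<kappa> T n x) = \<kappa> S n x" if "S \<in> \<T>" "x \<in> S" for S n x
  proof -
    have "(\<Sum>T\<in>\<T> - {S}. \<kappa> T n x) = 0"
      using disjoint[OF that(1)] that \<kappa>0 by (intro sum.neutral ballI) blast
    then show ?thesis using finite_mesh that(1) by (simp add: sum.remove[of \<T> S])
  qed
  have sum01: "0 \<le> (\<Sum>T\<in>\<T>. \<kappa> T n x) \<and> (\<Sum>T\<in>\<T>. \<kappa> T n x) \<le> 1" for n x
  proof (cases "\<exists>S\<in>\<T>. x \<in> S")
    case True
    then show ?thesis using sum\<kappa> \<kappa>(2) by auto
  qed (use \<kappa>0 in auto)
  have test: "test_function (\<Omega> \<inter> T) (\<lambda>x. \<phi> x * \<kappa> T n x) (\<lambda>x. \<phi> x *\<^sub>R \<kappa>' T n x + \<kappa> T n x *\<^sub>R \<phi>' x)"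
    if T: "T \<in> \<T>" for T n
  proof -
    obtain K' where K': "compact K'" "K' \<subseteq> T" "\<And>x. x \<notin> K' \<Longrightarrow> \<kappa> T n x = 0"
      using \<kappa>(1)[OF T] unfolding test_function_def by blast
    have "C1 (\<lambda>x. \<phi> x * \<kappa> T n x) (\<lambda>x. \<phi> x *\<^sub>R \<kappa>' T n x + \<kappa> T n x *\<^sub>R \<phi>' x)"
      using C1_mult[OF C1] \<kappa>(1)[OF T] test_function_C1 by blast
    moreover have "compact (K \<inter> K')" "K \<inter> K' \<subseteq> \<Omega> \<inter> T" "\<forall>x. x \<notin> K \<inter> K' \<longrightarrow> \<phi> x * \<kappa> T n x = 0"
      using K(1,2,3) K' by (auto intro: compact_Int)
    ultimately show ?thesis unfolding test_function_C1 by blast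
  qed
  have int_part: "integrable (lebesgue_on \<Omega>) (\<lambda>x. \<phi> x * \<kappa> T n x)"
      "integrable (lebesgue_on \<Omega>) (\<lambda>x. \<phi> x * \<kappa> T n x * (g x \<bullet> h))" if T: "T \<in> \<T>" for T n
  proof -
    show "integrable (lebesgue_on \<Omega>) (\<lambda>x. \<phi> x * \<kappa> T n x)"
      using integrable_test_function[OF test_function_mono[OF test[OF T]]] bounded_domain open_domain by blast
    obtain B' where B': "\<And>x. norm (\<phi> x * \<kappa> T n x) \<le> B'"
      using test_functionE[OF test[OF T]] by metis
    have "continuous_on UNIV (\<lambda>x. \<phi> x * \<kappa> T n x)"
      using test[OF T] test_function_C1 C1_continuous by blast
    from integrable_inner_left[of h, OF integrable_bounded_mult[OF integrable_g this B']]
    show "integrable (lebesgue_on \<Omega>) (\<lambda>x. \<phi> x * \<kappa> T n x * (g x \<bullet> h))"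
      by simp
  qed
  have int_\<phi>: "integrable (lebesgue_on \<Omega>) \<phi>"
    using integrable_test_function[OF \<phi> bounded_domain open_domain] .
  let ?I = "\<lambda>n. integral\<^sup>L (lebesgue_on \<Omega>) (\<lambda>x. \<phi> x * (\<Sum>T\<in>\<T>. \<kappa> T n x) * (g x \<bullet> h))"
  have bound: "\<bar>?I n\<bar> \<le> M * norm h * integral\<^sup>L (lebesgue_on \<Omega>) \<phi>" for n
  proof -
    have "?I n = (\<Sum>T\<in>\<T>. integral\<^sup>L (lebesgue_on \<Omega>) (\<lambda>x. \<phi> x * \<kappa> T n x * (g x \<bullet> h)))"
      using int_part(2) by (simp add: sum_distrib_left sum_distrib_right)
    then have "\<bar>?I n\<bar> \<le> (\<Sum>T\<in>\<T>. \<bar>integral\<^sup>L (lebesgue_on \<Omega>) (\<lambda>x. \<phi> x * \<kappa> T n x * (g x \<bullet> h))\<bar>)"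
      by simp
    also have "\<dots> \<le> (\<Sum>T\<in>\<T>. M * norm h * integral\<^sup>L (lebesgue_on \<Omega>) (\<lambda>x. \<phi> x * \<kappa> T n x))"
      using nonneg \<kappa>(2) by (intro sum_mono element_gradient_bound[OF _ test]) auto
    also have "\<dots> = M * norm h * integral\<^sup>L (lebesgue_on \<Omega>) (\<lambda>x. \<phi> x * (\<Sum>T\<in>\<T>. \<kappa> T n x))"
      using int_part(1) by (simp add: sum_distrib_left)
    also have "\<dots> \<le> M * norm h * integral\<^sup>L (lebesgue_on \<Omega>) \<phi>"
    proof (rule mult_left_mono[OF integral_mono'])
      show "\<phi> x * (\<Sum>T\<in>\<T>. \<kappa> T n x) \<le> \<phi> x" for x
        using sum01[where n = n and x = x] nonneg[of x] mult_left_le by blast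
    qed (use int_\<phi> nonneg M_nonneg in auto)
    finally show ?thesis .
  qed
  have "?I \<longlonglongrightarrow> integral\<^sup>L (lebesgue_on \<Omega>) (\<lambda>x. \<phi> x * (g x \<bullet> h))"
  proof (rule integral_dominated_convergence)
    have int: "integrable (lebesgue_on \<Omega>) (\<lambda>x. \<phi> x * (g x \<bullet> h))"
      using integrable_inner_left[of h, OF int_g] by simp
    then show "(\<lambda>x. \<phi> x * (g x \<bullet> h)) \<in> borel_measurable (lebesgue_on \<Omega>)"
        "integrable (lebesgue_on \<Omega>) (\<lambda>x. \<bar>\<phi> x * (g x \<bullet> h)\<bar>)" by auto
    show "(\<lambda>x. \<phi> x * (\<Sum>T\<in>\<T>. \<kappa> T n x) * (g x \<bullet> h)) \<in> borel_measurable (lebesgue_on \<Omega>)" for n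
      using borel_measurable_integrable[OF Bochner_Integration.integrable_sum[OF int_part(2)], of \<T> "\<lambda>T. T"]
      by (simp add: sum_distrib_left sum_distrib_right)
    show "AE x in lebesgue_on \<Omega>. (\<lambda>n. \<phi> x * (\<Sum>T\<in>\<T>. \<kappa> T n x) * (g x \<bullet> h)) \<longlonglongrightarrow> \<phi> x * (g x \<bullet> h)"
      using AE_elements
    proof eventually_elim
      case (elim x)
      then obtain S where S: "S \<in> \<T>" "x \<in> S" by blast
      have "(\<lambda>n. \<phi> x * \<kappa> S n x * (g x \<bullet> h)) \<longlonglongrightarrow> \<phi> x * 1 * (g x \<bullet> h)"
        using \<kappa>(3)[OF S] by (intro tendsto_intros)
      then show ?case using sum\<kappa>[OF S] by simp
    qed
    show "AE x in lebesgue_on \<Omega>. norm (\<phi> x * (\<Sum>T\<in>\<T>. \<kappa> T n x) * (g x \<bullet> h)) \<le> \<bar>\<phi> x * (g x \<bullet> h)\<bar>" for n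
    proof (intro always_eventually allI)
      fix x
      have "\<bar>\<Sum>T\<in>\<T>. \<kappa> T n x\<bar> * \<bar>\<phi> x * (g x \<bullet> h)\<bar> \<le> 1 * \<bar>\<phi> x * (g x \<bullet> h)\<bar>"
        using sum01[where n = n and x = x] by (intro mult_right_mono) auto
      then show "norm (\<phi> x * (\<Sum>T\<in>\<T>. \<kappa> T n x) * (g x \<bullet> h)) \<le> \<bar>\<phi> x * (g x \<bullet> h)\<bar>"
        by (simp add: abs_mult mult_ac)
    qed
  qed
  then have "\<bar>integral\<^sup>L (lebesgue_on \<Omega>) (\<lambda>x. \<phi> x * (g x \<bullet> h))\<bar> \<le> M * norm h * integral\<^sup>L (lebesgue_on \<Omega>) \<phi>"
    using bound by (intro LIMSEQ_le_const2[OF tendsto_rabs]) blast+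
  moreover have "integral\<^sup>L (lebesgue_on \<Omega>) (\<lambda>x. u x * (\<phi>' x \<bullet> h)) =
      - integral\<^sup>L (lebesgue_on \<Omega>) (\<lambda>x. \<phi> x * (g x \<bullet> h))"
    using gradient \<phi> unfolding weak_gradient_def integral_mult_inner[OF int_u] integral_mult_inner[OF int_g]
    by simp
  ultimately show ?thesis by simp
qed

end

section \<open>Mollification by a compactly supported bump\<close>

definition bump :: "real \<Rightarrow> 'a::euclidean_space \<Rightarrow> real" where
  "bump r y = (max 0 (r\<^sup>2 - y \<bullet> y))\<^sup>2"

lemma bump_nonneg: "0 \<le> bump r y"
  by (simp add: bump_def)

lemma bump_eq_0: "r > 0 \<Longrightarrow> r \<le> norm y \<Longrightarrow> bump r y = 0"
  using power_mono[of r "norm y" 2] by (simp add: bump_def dot_square_norm)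

lemma bump_pos: "norm y < r \<Longrightarrow> 0 < bump r y"
  using power_strict_mono[of "norm y" r 2] by (simp add: bump_def dot_square_norm)

lemma bump_C1: "\<exists>f'. C1 (bump r) f'"
proof -
  have "C1 (\<lambda>y::'a. y \<bullet> y) (\<lambda>y. 2 *\<^sub>R y)"
    unfolding C1_def gderiv_def
    by (auto intro!: derivative_eq_intros continuous_intros simp: inner_commute)
  then have "C1 (\<lambda>y::'a. r\<^sup>2 + (-1) * (y \<bullet> y)) (\<lambda>y. 0 + (-1) *\<^sub>R (2 *\<^sub>R y))"
    by (intro C1_add C1_cmult C1_const)
  from C1_compose[OF this C1_pospart_power2]
  have "C1 (\<lambda>y::'a. (max 0 (r\<^sup>2 + (-1) * (y \<bullet> y)))\<^sup>2)
     (\<lambda>y. (2 * max 0 (r\<^sup>2 + (-1) * (y \<bullet> y))) *\<^sub>R (0 + (-1) *\<^sub>R (2 *\<^sub>R y)))"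
    by (simp add: continuous_intros)
  moreover have "(\<lambda>y::'a. (max 0 (r\<^sup>2 + (-1) * (y \<bullet> y)))\<^sup>2) = bump r"
    by (auto simp: bump_def)
  ultimately show ?thesis by auto
qed

lemma bump_test_function:
  assumes "r > 0" "C1 (bump r) f'" "cball x r \<subseteq> S"
  shows "test_function S (\<lambda>y. bump r (y - x)) (\<lambda>y. f' (y - x))"
  unfolding test_function_C1
proof (intro conjI exI[of _ "cball x r"] allI impI)
  fix y assume "y \<notin> cball x r"
  then show "bump r (y - x) = 0"
    using bump_eq_0[OF assms(1), of "y - x"] by (simp add: dist_norm norm_minus_commute)
qed (use assms C1_translate in auto)

lemma integral_bump_translate:
  fixes x :: "'a::euclidean_space"
  assumes "r > 0" "cball x r \<subseteq> S" "S \<in> sets lebesgue"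
  shows "integral\<^sup>L (lebesgue_on S) (\<lambda>y. bump r (y - x)) = integral\<^sup>L lebesgue (bump r :: 'a \<Rightarrow> real)"
proof -
  have "bump r (y - x) = 0" if "y \<notin> S" for y
    using bump_eq_0[OF assms(1), of "y - x"] assms(2) that by (force simp: dist_norm norm_minus_commute)
  moreover obtain f' where "C1 (bump r :: 'a \<Rightarrow> real) f'" using bump_C1 by blast
  ultimately show ?thesis
    using integral_lebesgue_on_eq[OF assms(3), of "\<lambda>y. bump r (y - x)"]
      integral_lebesgue_translate[OF C1_continuous, of "bump r" f' x] by simp
qed

lemma integral_bump_pos:
  assumes "r > 0"
  shows "0 < integral\<^sup>L lebesgue (bump r :: 'a::euclidean_space \<Rightarrow> real)"
proof -
  let ?B = "ball 0 (2 * r) :: 'a set"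
  obtain f' where f': "C1 (bump r :: 'a \<Rightarrow> real) f'" using bump_C1 by blast
  have sub: "cball 0 r \<subseteq> ?B" using assms by auto
  have eq: "integral\<^sup>L (lebesgue_on ?B) (bump r) = integral\<^sup>L lebesgue (bump r :: 'a \<Rightarrow> real)"
    using integral_bump_translate[OF assms sub] by simp
  have int: "integrable (lebesgue_on ?B) (bump r)"
    using integrable_test_function[OF bump_test_function[OF assms f' sub]] by simp
  have "integral\<^sup>L (lebesgue_on ?B) (bump r) \<noteq> 0"
  proof
    assume "integral\<^sup>L (lebesgue_on ?B) (bump r) = 0"
    then have "AE y in lebesgue_on ?B. bump r y = 0"
      using integral_nonneg_eq_0_iff_AE[OF int] bump_nonneg by blast
    then have "AE y in lebesgue. y \<in> ?B \<longrightarrow> bump r y = 0"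
      by (simp add: AE_restrict_space_iff)
    then have "AE y in lebesgue. y \<notin> ball (0::'a) r"
    proof eventually_elim
      case (elim y)
      then show ?case using bump_pos[of y r] assms by auto
    qed
    then have "negligible (ball (0::'a) r)"
      by (simp add: negligible_iff_null_sets AE_iff_null_sets)
    then show False using open_not_negligible[of "ball (0::'a) r"] assms by simp
  qed
  moreover have "integral\<^sup>L (lebesgue_on ?B) (bump r) \<ge> 0"
    by (simp add: Bochner_Integration.integral_nonneg bump_nonneg)
  ultimately show ?thesis using eq by linarith
qed

context piecewise_H1
begin

text \<open>The bump is not normalised: its integral is a positive factor, independent of
  \<open>x\<close> for balls inside \<Omega>, and it is cancelled in
  \<open>values_along_path\<close>.\<close>

definition average :: "real \<Rightarrow> 'a \<Rightarrow> real" where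
  "average r x = integral\<^sup>L (lebesgue_on \<Omega>) (\<lambda>y. u y * bump r (y - x))"

text \<open>Mollified functions inherit the bound on the weak gradient.\<close>

lemma average_lipschitz:
  assumes r: "r > 0" and seg: "\<And>x. x \<in> closed_segment a b \<Longrightarrow> cball x r \<subseteq> \<Omega>"
  shows "\<bar>average r b - average r a\<bar> \<le> M * norm (b - a) * integral\<^sup>L lebesgue (bump r :: 'a \<Rightarrow> real)"
proof -
  obtain f' where f': "C1 (bump r :: 'a \<Rightarrow> real) f'" using bump_C1 by blast
  define h where "h = b - a"
  \<comment> \<open>\<open>F t\<close> is the average at \<open>a + t *\<^sub>R h\<close>. The mean
    value theorem reduces the claim to a bound on its derivative, which is
    \<open>gradient_bound\<close> for the bump centred at that point.\<close>
  define F where "F t = integral\<^sup>L (lebesgue_on \<Omega>) (\<lambda>y. u y * bump r (y - t *\<^sub>R h - a))" for t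
  define F' where "F' t = - integral\<^sup>L (lebesgue_on \<Omega>) (\<lambda>y. u y * (f' (y - t *\<^sub>R h - a) \<bullet> h))" for t
  have shift: "y - t *\<^sub>R h - a = y - (a + t *\<^sub>R h)" for y t by simp
  have "cball a r \<subseteq> \<Omega>" using seg[of a] by simp
  then obtain B where B: "\<And>x. norm (bump r (x - a)) \<le> B" "\<And>x. norm (f' (x - a)) \<le> B"
    using test_functionE[OF bump_test_function[OF r f']] by metis
  have deriv: "(F has_real_derivative F' t) (at t)" for t
    unfolding F_def F'_def
    by (rule integral_translate_derivative[OF integrable_u C1_translate[OF f'] B])
  have bound: "\<bar>F' t\<bar> \<le> M * norm h * integral\<^sup>L lebesgue (bump r :: 'a \<Rightarrow> real)" if "0 \<le> t" "t \<le> 1" for t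
  proof -
    have "a + t *\<^sub>R h \<in> closed_segment a b"
      using that unfolding in_segment h_def by (auto intro!: exI[of _ t] simp: algebra_simps)
    then have ball: "cball (a + t *\<^sub>R h) r \<subseteq> \<Omega>" by (rule seg)
    show ?thesis
      using gradient_bound[OF bump_test_function[OF r f' ball] bump_nonneg, of h]
        integral_bump_translate[OF r ball sets_domain]
      unfolding F'_def shift by simp
  qed
  obtain t where "0 < t" "t < 1" "F 1 - F 0 = (1 - 0) * F' t"
    using MVT2[of 0 1 F F'] deriv by auto
  moreover have "F 1 = average r b" "F 0 = average r a"
    by (auto simp: F_def average_def h_def algebra_simps)
  ultimately show ?thesis
    using bound[of t] by (simp add: h_def)
qed

text \<open>The support of the bump lies in a ball where \<open>u\<close> is almost everywhere
  \<open>q T\<close>, so only the oscillation of this polynomial over the ball enters.\<close>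

lemma average_near:
  assumes r: "r > 0" and T: "T \<in> \<T>" and ball: "cball x r \<subseteq> \<Omega> \<inter> T"
    and w: "\<And>y. y \<in> cball x r \<Longrightarrow> \<bar>q T y - q T x\<bar> \<le> w"
  shows "\<bar>average r x - q T x * integral\<^sup>L lebesgue (bump r :: 'a \<Rightarrow> real)\<bar> \<le> w * integral\<^sup>L lebesgue (bump r :: 'a \<Rightarrow> real)"
proof -
  obtain f' where f': "C1 (bump r :: 'a \<Rightarrow> real) f'" using bump_C1 by blast
  have ball': "cball x r \<subseteq> \<Omega>" using ball by blast
  have \<phi>: "test_function \<Omega> (\<lambda>y. bump r (y - x)) (\<lambda>y. f' (y - x))"
    by (rule bump_test_function[OF r f' ball'])
  have int: "integrable (lebesgue_on \<Omega>) (\<lambda>y. bump r (y - x))"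
    by (rule integrable_test_function[OF \<phi> bounded_domain open_domain])
  obtain B where "\<And>y. norm (bump r (y - x)) \<le> B"
    using test_functionE[OF \<phi>] by metis
  from integrable_mult_bounded[OF integrable_u C1_continuous[OF C1_translate[OF f']] this]
  have int_u: "integrable (lebesgue_on \<Omega>) (\<lambda>y. u y * bump r (y - x))" by simp
  have mass: "integral\<^sup>L (lebesgue_on \<Omega>) (\<lambda>y. bump r (y - x)) = integral\<^sup>L lebesgue (bump r :: 'a \<Rightarrow> real)"
    by (rule integral_bump_translate[OF r ball' sets_domain])
  have "average r x - q T x * integral\<^sup>L lebesgue (bump r :: 'a \<Rightarrow> real) =
      integral\<^sup>L (lebesgue_on \<Omega>) (\<lambda>y. u y * bump r (y - x) - q T x * bump r (y - x))"
    unfolding average_def mass[symmetric] using int int_u by simp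
  also have "\<bar>\<dots>\<bar> \<le> integral\<^sup>L (lebesgue_on \<Omega>) (\<lambda>y. \<bar>u y * bump r (y - x) - q T x * bump r (y - x)\<bar>)"
    by (rule integral_abs_bound)
  also have "\<dots> \<le> integral\<^sup>L (lebesgue_on \<Omega>) (\<lambda>y. w * bump r (y - x))"
  proof (rule integral_mono_AE)
    show "AE y in lebesgue_on \<Omega>. \<bar>u y * bump r (y - x) - q T x * bump r (y - x)\<bar> \<le> w * bump r (y - x)"
      using AE_in_element[OF T]
    proof eventually_elim
      case (elim y)
      show ?case
      proof (cases "y \<in> cball x r")
        case True
        then have "u y = q T y" using elim ball by blast
        then have "\<bar>u y - q T x\<bar> * bump r (y - x) \<le> w * bump r (y - x)"
          using w[OF True] bump_nonneg by (intro mult_right_mono) auto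
        moreover have "\<bar>u y * bump r (y - x) - q T x * bump r (y - x)\<bar> = \<bar>u y - q T x\<bar> * bump r (y - x)"
          using bump_nonneg[of r "y - x"] by (simp add: abs_mult flip: left_diff_distrib)
        ultimately show ?thesis by simp
      next
        case False
        then show ?thesis
          using bump_eq_0[OF r, of "y - x"] by (simp add: dist_norm norm_minus_commute)
      qed
    qed
  qed (use int int_u in auto)
  finally show ?thesis using mass by simp
qed

text \<open>Mollified values differ by at most \<open>M\<close> times the length of each segment, up
  to the mass of the bump. Replacing them by the polynomial values costs \<open>e / 2\<close> at
  either end, where \<open>e\<close> is arbitrary since the radius may be as small as
  desired.\<close>

lemma values_along_path:
  assumes S: "S \<in> \<T>" "a \<in> \<Omega> \<inter> S" and T: "T \<in> \<T>" "b \<in> \<Omega> \<inter> T"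
    and path: "closed_segment a p \<subseteq> \<Omega>" "closed_segment p p' \<subseteq> \<Omega>" "closed_segment p' b \<subseteq> \<Omega>"
  shows "\<bar>q S a - q T b\<bar> \<le> M * (norm (p - a) + norm (p' - p) + norm (b - p'))"
proof (rule field_le_epsilon)
  fix e :: real assume "e > 0"
  then have w: "e / 2 > 0" by simp
  have near: "\<exists>d>0. \<forall>r. 0 < r \<longrightarrow> r < d \<longrightarrow> cball x r \<subseteq> \<Omega> \<inter> K \<and> (\<forall>y\<in>cball x r. \<bar>q K y - q K x\<bar> \<le> e / 2)"
    if K: "K \<in> \<T>" "x \<in> \<Omega> \<inter> K" for K x
  proof -
    have "open (\<Omega> \<inter> K)" using open_domain open_simplex_open[OF simplices[OF K(1)]] by blast
    then obtain d\<^sub>1 where d1: "d\<^sub>1 > 0" "cball x d\<^sub>1 \<subseteq> \<Omega> \<inter> K"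
      using K(2) open_contains_cball by blast
    have "continuous_on UNIV (q K)" using C1_continuous[OF q_C1[OF K(1)]] .
    then obtain d\<^sub>2 where d2: "d\<^sub>2 > 0" "\<And>y. dist y x < d\<^sub>2 \<Longrightarrow> dist (q K y) (q K x) < e / 2"
      using w unfolding continuous_on_iff by blast
    show ?thesis
    proof (intro exI[of _ "min d\<^sub>1 d\<^sub>2"] conjI allI impI ballI)
      fix r assume r: "0 < r" "r < min d\<^sub>1 d\<^sub>2"
      then show "cball x r \<subseteq> \<Omega> \<inter> K" using d1(2) by (meson less_imp_le min_less_iff_conj order_trans subset_cball)
      fix y assume "y \<in> cball x r"
      then have "dist y x < d\<^sub>2" using r by (simp add: dist_commute)
      from d2(2)[OF this] show "\<bar>q K y - q K x\<bar> \<le> e / 2"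
        by (simp add: dist_real_def)
    qed (use d1 d2 in auto)
  qed
  obtain d\<^sub>1 where d1: "d\<^sub>1 > 0" "\<And>r. 0 < r \<Longrightarrow> r < d\<^sub>1 \<Longrightarrow> cball a r \<subseteq> \<Omega> \<inter> S \<and> (\<forall>y\<in>cball a r. \<bar>q S y - q S a\<bar> \<le> e / 2)"
    using near[OF S] by blast
  obtain d\<^sub>2 where d2: "d\<^sub>2 > 0" "\<And>r. 0 < r \<Longrightarrow> r < d\<^sub>2 \<Longrightarrow> cball b r \<subseteq> \<Omega> \<inter> T \<and> (\<forall>y\<in>cball b r. \<bar>q T y - q T b\<bar> \<le> e / 2)"
    using near[OF T] by blast
  let ?P = "closed_segment a p \<union> closed_segment p p' \<union> closed_segment p' b"
  have "compact ?P" by (intro compact_Un compact_segment)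
  moreover have "?P \<subseteq> \<Omega>" using path by blast
  ultimately obtain d\<^sub>3 where d3: "d\<^sub>3 > 0" "(\<Union>x\<in>?P. ball x d\<^sub>3) \<subseteq> \<Omega>"
    using compact_subset_open_imp_ball_epsilon_subset[OF _ open_domain] by blast
  \<comment> \<open>Small enough for the oscillation at both ends and for a tube around the path
    inside \<Omega>; halving makes all three bounds strict.\<close>
  define r where "r = min (min d\<^sub>1 d\<^sub>2) d\<^sub>3 / 2"
  have r: "0 < r" "r < d\<^sub>1" "r < d\<^sub>2" "r < d\<^sub>3" using d1(1) d2(1) d3(1) by (auto simp: r_def)
  define c where "c = integral\<^sup>L lebesgue (bump r :: 'a \<Rightarrow> real)"
  have c: "c > 0" unfolding c_def by (rule integral_bump_pos[OF r(1)])
  have seg: "cball x r \<subseteq> \<Omega>" if "x \<in> ?P" for x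
  proof -
    have "cball x r \<subseteq> ball x d\<^sub>3" using r(4) by auto
    then show ?thesis using d3(2) that by blast
  qed
  have "\<bar>average r p - average r a\<bar> \<le> M * norm (p - a) * c"
    "\<bar>average r p' - average r p\<bar> \<le> M * norm (p' - p) * c"
    "\<bar>average r b - average r p'\<bar> \<le> M * norm (b - p') * c"
    unfolding c_def using seg by (auto intro!: average_lipschitz[OF r(1)])
  moreover have "\<bar>average r a - q S a * c\<bar> \<le> e / 2 * c"
    unfolding c_def using d1(2)[OF r(1,2)] by (intro average_near[OF r(1) S(1)]) auto
  moreover have "\<bar>average r b - q T b * c\<bar> \<le> e / 2 * c"
    unfolding c_def using d2(2)[OF r(1,3)] by (intro average_near[OF r(1) T(1)]) auto
  ultimately have "\<bar>q S a * c - q T b * c\<bar> \<le>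
      M * norm (p - a) * c + M * norm (p' - p) * c + M * norm (b - p') * c + e / 2 * c + e / 2 * c"
    by linarith
  also have "\<dots> = (M * (norm (p - a) + norm (p' - p) + norm (b - p')) + e) * c"
    by (simp add: algebra_simps)
  also have "\<bar>q S a * c - q T b * c\<bar> = \<bar>q S a - q T b\<bar> * c"
    using c by (simp add: abs_mult flip: left_diff_distrib)
  finally show "\<bar>q S a - q T b\<bar> \<le> M * (norm (p - a) + norm (p' - p) + norm (b - p')) + e"
    using c by simp
qed

end

text \<open>Local quasiconvexity. Near a boundary point the path climbs from \<open>a\<close> in the
  direction \<open>e\<close> of the graph representation, crosses over in parallel to the segment
  from \<open>a\<close> to \<open>b\<close>, and descends to \<open>b\<close>. The climb is
  proportional to the distance of the endpoints, which makes the length bound linear.\<close>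

lemma lipschitz_domain_paths:
  fixes \<Omega> :: "'a::euclidean_space set"
  assumes \<Omega>: "lipschitz_domain \<Omega>" and z: "z \<in> closure \<Omega>"
  obtains r C where "r > 0" "\<And>a b. a \<in> \<Omega> \<inter> ball z r \<Longrightarrow> b \<in> \<Omega> \<inter> ball z r \<Longrightarrow>
    \<exists>p p'. closed_segment a p \<subseteq> \<Omega> \<and> closed_segment p p' \<subseteq> \<Omega> \<and> closed_segment p' b \<subseteq> \<Omega> \<and>
      norm (p - a) + norm (p' - p) + norm (b - p') \<le> C * norm (b - a)"
proof (cases "z \<in> \<Omega>")
  case True
  then obtain r where r: "r > 0" "ball z r \<subseteq> \<Omega>"
    using \<Omega> open_contains_ball unfolding lipschitz_domain_def by blast
  show thesis
  proof (rule that[of r 1])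
    fix a b assume ab: "a \<in> \<Omega> \<inter> ball z r" "b \<in> \<Omega> \<inter> ball z r"
    then have "closed_segment a b \<subseteq> \<Omega>"
      using r(2) closed_segment_subset[OF _ _ convex_ball, of a z r b] by blast
    then show "\<exists>p p'. closed_segment a p \<subseteq> \<Omega> \<and> closed_segment p p' \<subseteq> \<Omega> \<and> closed_segment p' b \<subseteq> \<Omega> \<and>
      norm (p - a) + norm (p' - p) + norm (b - p') \<le> 1 * norm (b - a)"
      using ab by (intro exI[of _ a]) auto
  qed (rule r(1))
next
  case False
  then have "z \<in> frontier \<Omega>"
    using z \<Omega> unfolding frontier_def lipschitz_domain_def by (simp add: interior_open)
  then obtain R e L and g :: "'a \<Rightarrow> real" where R: "R > 0" and e: "norm e = 1" and g: "L-lipschitz_on UNIV g"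
    and graph: "\<Omega> \<inter> ball z R = {y \<in> ball z R. g (y - (y \<bullet> e) *\<^sub>R e) < y \<bullet> e}"
    using \<Omega> unfolding lipschitz_domain_def by blast
  have L: "L \<ge> 0" using g lipschitz_on_nonneg by blast
  have in_\<Omega>: "y \<in> \<Omega>" if "y \<in> ball z R" "g (y - (y \<bullet> e) *\<^sub>R e) < y \<bullet> e" for y
    using graph that by blast
  have above: "g (y - (y \<bullet> e) *\<^sub>R e) < y \<bullet> e" if "y \<in> \<Omega>" "y \<in> ball z R" for y
    using graph that by blast
  have ee: "e \<bullet> e = 1" using e by (simp add: dot_square_norm)
  \<comment> \<open>Chosen so that points of \<open>ball z r\<close> lifted by at most
    \<open>s\<close> stay in the chart:
    \<open>r + (2 * L + 1) * (2 * r) = (4 * L + 3) * r < R\<close>.\<close>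
  define r where "r = R / (4 * L + 4)"
  have r: "r > 0" using R L by (simp add: r_def)
  have Rr: "R = r * (4 * L + 4)" using L by (simp add: r_def)
  have rR: "r \<le> R" using r L unfolding Rr by (simp add: algebra_simps)
  show thesis
  proof (rule that[of r "4 * L + 3"])
    fix a b assume ab: "a \<in> \<Omega> \<inter> ball z r" "b \<in> \<Omega> \<inter> ball z r"
    \<comment> \<open>During the crossing the projection along \<open>e\<close> moves by at most
      \<open>2 * h\<close>, so the graph rises by at most \<open>2 * L * h\<close>, while the height
      over \<open>a\<close> drops by at most \<open>h\<close>. The lift
      \<open>s = 2 * L * h + h\<close> makes up for both, and strictness comes from \<open>a\<close>
      lying strictly above the graph.\<close>
    define h s where "h = norm (b - a)" and "s = (2 * L + 1) * norm (b - a)"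
    have h: "0 \<le> h" "h < 2 * r"
    proof -
      have "dist a b \<le> dist z a + dist z b" by (metis dist_commute dist_triangle)
      then show "h < 2 * r" using ab by (simp add: h_def dist_norm norm_minus_commute)
    qed (simp add: h_def)
    have s: "0 \<le> s" "s \<le> (2 * L + 1) * (2 * r)" "s = 2 * L * h + h"
    proof -
      show "0 \<le> s" "s = 2 * L * h + h"
        using L by (auto simp: s_def h_def algebra_simps)
      show "s \<le> (2 * L + 1) * (2 * r)"
        unfolding s_def h_def[symmetric] using h L by (intro mult_left_mono) auto
    qed
    have lift: "x + t *\<^sub>R e \<in> ball z R" if "x \<in> ball z r" "0 \<le> t" "t \<le> s" for x t
    proof -
      have "dist z (x + t *\<^sub>R e) \<le> dist z x + norm (t *\<^sub>R e)"
        using dist_triangle[of z "x + t *\<^sub>R e" x] by (simp add: dist_norm)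
      also have "\<dots> < r + (2 * L + 1) * (2 * r)"
        using that s e by simp
      also have "\<dots> \<le> R" using r unfolding Rr by (simp add: algebra_simps)
      finally show ?thesis by simp
    qed
    have vertical: "closed_segment x (x + s *\<^sub>R e) \<subseteq> \<Omega>" if x: "x \<in> \<Omega> \<inter> ball z r" for x
    proof
      fix y assume "y \<in> closed_segment x (x + s *\<^sub>R e)"
      then obtain t where t: "0 \<le> t" "t \<le> 1" "y = (1 - t) *\<^sub>R x + t *\<^sub>R (x + s *\<^sub>R e)"
        unfolding in_segment by blast
      then have y: "y = x + (t * s) *\<^sub>R e" by (simp add: algebra_simps)
      have ts: "0 \<le> t * s" "t * s \<le> s" using t s(1) mult_right_mono[of t 1 s] by auto
      show "y \<in> \<Omega>"
      proof (rule in_\<Omega>)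
        show "y \<in> ball z R" unfolding y using lift x ts by blast
        have "y - (y \<bullet> e) *\<^sub>R e = x - (x \<bullet> e) *\<^sub>R e" "y \<bullet> e = x \<bullet> e + t * s"
          unfolding y by (simp_all add: inner_add_left ee algebra_simps)
        moreover have "g (x - (x \<bullet> e) *\<^sub>R e) < x \<bullet> e"
          using above x rR by auto
        ultimately show "g (y - (y \<bullet> e) *\<^sub>R e) < y \<bullet> e" using ts by simp
      qed
    qed
    have middle: "closed_segment (a + s *\<^sub>R e) (b + s *\<^sub>R e) \<subseteq> \<Omega>"
    proof
      fix y assume y: "y \<in> closed_segment (a + s *\<^sub>R e) (b + s *\<^sub>R e)"
      then obtain t where t: "0 \<le> t" "t \<le> 1" "y = (1 - t) *\<^sub>R (a + s *\<^sub>R e) + t *\<^sub>R (b + s *\<^sub>R e)"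
        unfolding in_segment by blast
      define k where "k = t *\<^sub>R (b - a)"
      have yk: "y = a + k + s *\<^sub>R e" using t(3) by (simp add: k_def algebra_simps)
      have k: "norm k \<le> h" using t by (simp add: k_def h_def mult_left_le_one_le)
      have ke: "\<bar>k \<bullet> e\<bar> \<le> h" using Cauchy_Schwarz_ineq2[of k e] k e by simp
      show "y \<in> \<Omega>"
      proof (rule in_\<Omega>)
        show "y \<in> ball z R"
          using closed_segment_subset[OF lift lift convex_ball, of a s b s] ab s(1) y by auto
        let ?P = "\<lambda>y. y - (y \<bullet> e) *\<^sub>R e"
        have "dist (g (?P y)) (g (?P a)) \<le> L * dist (?P y) (?P a)"
          using g unfolding lipschitz_on_def by blast
        also have "?P y - ?P a = k - (k \<bullet> e) *\<^sub>R e"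
          unfolding yk by (simp add: inner_add_left ee algebra_simps)
        then have "dist (?P y) (?P a) \<le> h + h"
          using norm_triangle_ineq4[of k "(k \<bullet> e) *\<^sub>R e"] k ke e by (simp add: dist_norm)
        then have "L * dist (?P y) (?P a) \<le> L * (h + h)" using L by (rule mult_left_mono)
        finally have "g (?P y) \<le> g (?P a) + 2 * L * h"
          by (simp add: dist_real_def algebra_simps abs_le_iff)
        moreover have "g (?P a) < a \<bullet> e" using above ab rR by auto
        moreover have "y \<bullet> e = a \<bullet> e + k \<bullet> e + s" unfolding yk by (simp add: inner_add_left ee)
        ultimately show "g (?P y) < y \<bullet> e" using ke s(3) by linarith
      qed
    qed
    show "\<exists>p p'. closed_segment a p \<subseteq> \<Omega> \<and> closed_segment p p' \<subseteq> \<Omega> \<and> closed_segment p' b \<subseteq> \<Omega> \<and>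
      norm (p - a) + norm (p' - p) + norm (b - p') \<le> (4 * L + 3) * norm (b - a)"
    proof (intro exI conjI)
      show "closed_segment a (a + s *\<^sub>R e) \<subseteq> \<Omega>" using vertical ab by blast
      show "closed_segment (a + s *\<^sub>R e) (b + s *\<^sub>R e) \<subseteq> \<Omega>" by (rule middle)
      show "closed_segment (b + s *\<^sub>R e) b \<subseteq> \<Omega>"
        using vertical[OF ab(2)] by (simp add: closed_segment_commute)
      have "norm (a + s *\<^sub>R e - a) + norm (b + s *\<^sub>R e - (a + s *\<^sub>R e)) + norm (b - (b + s *\<^sub>R e)) = s + h + s"
        using s(1) e by (simp add: h_def)
      also have "\<dots> = (4 * L + 3) * norm (b - a)"
        using s(3) by (simp add: h_def[symmetric] algebra_simps)
      finally show "norm (a + s *\<^sub>R e - a) + norm (b + s *\<^sub>R e - (a + s *\<^sub>R e)) + norm (b - (b + s *\<^sub>R e))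
          \<le> (4 * L + 3) * norm (b - a)" by simp
    qed
  qed (rule r)
qed

context piecewise_H1
begin

text \<open>Approach \<open>z\<close> by points \<open>a n\<close> of \<open>S\<close> and
  \<open>b n\<close> of \<open>T\<close>. The paths joining them have length at most
  \<open>C * norm (b n - a n)\<close>, which tends to 0, and both polynomials are continuous at
  \<open>z\<close>.\<close>

lemma elements_agree:
  assumes \<Omega>: "lipschitz_domain \<Omega>" and S: "S \<in> \<T>" "z \<in> closure S" and T: "T \<in> \<T>" "z \<in> closure T"
  shows "q S z = q T z"
proof -
  have zcl: "z \<in> closure \<Omega>" using cover S by blast
  obtain r C where r: "r > 0" and paths: "\<And>a b. a \<in> \<Omega> \<inter> ball z r \<Longrightarrow> b \<in> \<Omega> \<inter> ball z r \<Longrightarrow>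
    \<exists>p p'. closed_segment a p \<subseteq> \<Omega> \<and> closed_segment p p' \<subseteq> \<Omega> \<and> closed_segment p' b \<subseteq> \<Omega> \<and>
      norm (p - a) + norm (p' - p) + norm (b - p') \<le> C * norm (b - a)"
    using lipschitz_domain_paths[OF \<Omega> zcl] by blast
  \<comment> \<open>An open set inside the closure of \<Omega> has its points of \<Omega> dense in
    it, so the approximating points can be taken in \<Omega> as well.\<close>
  have dense: "closure K \<subseteq> closure (\<Omega> \<inter> K)" if "K \<in> \<T>" for K
  proof -
    have "K \<subseteq> closure \<Omega>" using cover closure_subset that by blast
    then have "K \<subseteq> closure (K \<inter> \<Omega>)"
      using open_Int_closure_subset[OF open_simplex_open[OF simplices[OF that]], of \<Omega>] by blast
    then show ?thesis by (metis closure_minimal closed_closure Int_commute)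
  qed
  obtain a where a: "\<And>n. a n \<in> \<Omega> \<inter> S" "a \<longlonglongrightarrow> z"
    using subsetD[OF dense[OF S(1)] S(2)] unfolding closure_sequential by blast
  obtain b where b: "\<And>n. b n \<in> \<Omega> \<inter> T" "b \<longlonglongrightarrow> z"
    using subsetD[OF dense[OF T(1)] T(2)] unfolding closure_sequential by blast
  have q_lim: "(\<lambda>n. q K (x n)) \<longlonglongrightarrow> q K z" if "K \<in> \<T>" "x \<longlonglongrightarrow> z" for K x
    using continuous_on_tendsto_compose[OF C1_continuous[OF q_C1[OF that(1)], of UNIV] that(2)] by simp
  have "\<forall>\<^sub>F n in sequentially. \<bar>q S (a n) - q T (b n)\<bar> \<le> M * (C * norm (b n - a n))"
    using tendstoD[OF a(2) r] tendstoD[OF b(2) r]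
  proof eventually_elim
    case (elim n)
    then have "a n \<in> \<Omega> \<inter> ball z r" "b n \<in> \<Omega> \<inter> ball z r"
      using a(1) b(1) by (auto simp: dist_commute)
    then obtain p p' where p: "closed_segment (a n) p \<subseteq> \<Omega>" "closed_segment p p' \<subseteq> \<Omega>" "closed_segment p' (b n) \<subseteq> \<Omega>"
      "norm (p - a n) + norm (p' - p) + norm (b n - p') \<le> C * norm (b n - a n)"
      using paths by blast
    have "\<bar>q S (a n) - q T (b n)\<bar> \<le> M * (norm (p - a n) + norm (p' - p) + norm (b n - p'))"
      by (rule values_along_path[OF S(1) a(1) T(1) b(1) p(1-3)])
    also have "\<dots> \<le> M * (C * norm (b n - a n))"
      using p(4) M_nonneg by (rule mult_left_mono)
    finally show ?case .
  qed
  moreover have "(\<lambda>n. \<bar>q S (a n) - q T (b n)\<bar>) \<longlonglongrightarrow> \<bar>q S z - q T z\<bar>"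
    by (intro tendsto_rabs tendsto_diff q_lim S T a b)
  moreover have "(\<lambda>n. M * (C * norm (b n - a n))) \<longlonglongrightarrow> M * (C * norm (z - z))"
    by (intro tendsto_intros a b)
  ultimately have "\<bar>q S z - q T z\<bar> \<le> M * (C * norm (z - z))"
    by (intro tendsto_le[OF trivial_limit_sequentially])
  then show ?thesis by simp
qed

end

lemma regular_closure_subset: "regular_triangulation \<Omega> \<T> \<Longrightarrow> T \<in> \<T> \<Longrightarrow> closure T \<subseteq> closure \<Omega>"
  using regular_cover by blast

lemma C1_gradient_bounded:
  assumes "C1 f f'" "bounded T"
  shows "\<exists>B. \<forall>x\<in>T. norm (f' x) \<le> B"
proof -
  have "compact (closure T)" using assms(2) by simp
  then have "bounded (f' ` closure T)"
    using C1_gradient_continuous[OF assms(1)] compact_continuous_image compact_imp_bounded by blast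
  then show ?thesis
    unfolding bounded_iff using closure_subset by blast
qed

lemma spline_elements_agree:
  fixes \<Omega> :: "'a::euclidean_space set"
  assumes \<Omega>: "lipschitz_domain \<Omega>" and reg: "regular_triangulation \<Omega> \<T>" and u: "u \<in> H1 \<Omega>"
    and q: "\<And>T. T \<in> \<T> \<Longrightarrow> polyd p (q T) \<and> (AE x in lebesgue_on T. u x = q T x)"
    and S: "S \<in> \<T>" "z \<in> closure S" and T: "T \<in> \<T>" "z \<in> closure T"
  shows "q S z = q T z"
proof -
  have op: "open \<Omega>" and bd: "bounded \<Omega>" using \<Omega> unfolding lipschitz_domain_def by blast+
  obtain g where g: "square_integrable \<Omega> u" "square_integrable \<Omega> g" "weak_gradient \<Omega> u g"
    using u unfolding H1_def by blast
  have "\<forall>T\<in>\<T>. \<exists>f. C1 (q T) f" using q polyd_C1 by blast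
  from bchoice[OF this] obtain q' where q': "\<forall>T\<in>\<T>. C1 (q T) (q' T)" ..
  have "\<forall>T\<in>\<T>. \<exists>B. \<forall>x\<in>T. norm (q' T x) \<le> B"
    using q' C1_gradient_bounded open_simplex_bounded regular_simplex[OF reg] by blast
  from bchoice[OF this] obtain B where B: "\<forall>T\<in>\<T>. \<forall>x\<in>T. norm (q' T x) \<le> B T" ..
  \<comment> \<open>The sum is a common gradient bound for the finitely many elements, and the
    absolute values make it nonnegative.\<close>
  interpret piecewise_H1 \<Omega> \<T> u g q q' "\<Sum>T\<in>\<T>. \<bar>B T\<bar>"
  proof
    show "integrable (lebesgue_on \<Omega>) u" "integrable (lebesgue_on \<Omega>) g"
      using g(1,2) op bd by (auto intro: square_integrable_integrable)
    show "norm (q' T x) \<le> (\<Sum>T\<in>\<T>. \<bar>B T\<bar>)" if "T \<in> \<T>" "x \<in> T" for T x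
    proof -
      have "norm (q' T x) \<le> \<bar>B T\<bar>" using B that by fastforce
      also have "\<dots> \<le> (\<Sum>T\<in>\<T>. \<bar>B T\<bar>)"
        using regular_finite[OF reg] that(1) by (intro member_le_sum) auto
      finally show ?thesis .
    qed
  qed (use op bd g q q' regular_finite[OF reg] regular_simplex[OF reg] regular_disjoint[OF reg]
      regular_cover[OF reg] in \<open>auto intro: sum_nonneg\<close>)
  show ?thesis by (rule elements_agree[OF \<Omega> S T])
qed

section \<open>The finest common coarsening\<close>

text \<open>Bisection enters from here on only through the trichotomy of elements. The assumptions
  are symmetric in the two meshes, so facts can be transferred by exchanging their roles.\<close>

locale nested_meshes =
  fixes \<Omega> :: "'a::euclidean_space set" and \<T> Th :: "'a set set"
  assumes coarse: "regular_triangulation \<Omega> \<T>" and fine: "regular_triangulation \<Omega> Th"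
    and nested: "\<And>S T. S \<in> \<T> \<Longrightarrow> T \<in> Th \<Longrightarrow> S \<subseteq> T \<or> T \<subseteq> S \<or> S \<inter> T = {}"
begin

lemma nested_meshes_swap: "nested_meshes \<Omega> Th \<T>"
  using coarse fine nested by unfold_locales blast+

text \<open>An element of \<open>\<T>\<close> that meets \<open>T\<close> but contains it would also
  contain \<open>S\<close> and hence equal \<open>S\<close>. So every element of \<open>\<T>\<close>
  meeting \<open>T\<close> lies inside \<open>T\<close>, and finitely many of their closures cover
  the closure of \<open>T\<close>.\<close>

lemma refined_by_coarse:
  assumes T: "T \<in> Th" and S: "S \<in> \<T>" "S \<subseteq> T" and z: "z \<in> closure T"
  shows "\<exists>S'\<in>\<T>. S' \<subseteq> T \<and> z \<in> closure S'"
proof -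
  let ?A = "{S'\<in>\<T>. S' \<subseteq> T}"
  have os: "open T" using open_simplex_open[OF regular_simplex[OF fine T]] .
  have "T \<subseteq> \<Union>(closure ` ?A)"
  proof
    fix x assume x: "x \<in> T"
    then have "x \<in> closure \<Omega>" using regular_closure_subset[OF fine T] closure_subset by blast
    then obtain S' where S': "S' \<in> \<T>" "x \<in> closure S'" using regular_cover[OF coarse] by blast
    then have "T \<inter> S' \<noteq> {}" using x os open_Int_closure_eq_empty by blast
    then consider "S' \<subseteq> T" | "T \<subseteq> S'" using nested[OF S'(1) T] by blast
    then have "S' \<subseteq> T"
    proof cases
      case 2
      then have "S \<inter> S' \<noteq> {}" using S open_simplex_nonempty[OF regular_simplex[OF coarse S(1)]] by blast
      then have "S = S'" using regular_disjoint[OF coarse S(1) S'(1)] by blast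
      then show ?thesis using S(2) by blast
    qed
    then show "x \<in> \<Union>(closure ` ?A)" using S' by blast
  qed
  moreover have "closed (\<Union>(closure ` ?A))"
    using regular_finite[OF coarse] by (intro closed_Union) auto
  ultimately have "closure T \<subseteq> \<Union>(closure ` ?A)" by (rule closure_minimal)
  then show ?thesis using z by blast
qed

lemma element_of_fcc:
  assumes T: "T \<in> Th"
  shows "T \<in> fcc \<T> Th \<or> (\<exists>K\<in>\<T>. T \<subset> K \<and> K \<in> fcc \<T> Th - Th)"
proof -
  have os: "open_simplex T" by (rule regular_simplex[OF fine T])
  obtain x where x: "x \<in> T" using open_simplex_nonempty[OF os] by blast
  then have "x \<in> closure \<Omega>" using regular_closure_subset[OF fine T] closure_subset by blast
  then obtain S where S: "S \<in> \<T>" "x \<in> closure S" using regular_cover[OF coarse] by blast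
  then have "T \<inter> S \<noteq> {}" using x open_simplex_open[OF os] open_Int_closure_eq_empty by blast
  then consider "S = T" | "S \<subset> T" | "T \<subset> S" using nested[OF S(1) T] by blast
  then show ?thesis
  proof cases
    case 1
    then show ?thesis using S T unfolding fcc_def by blast
  next
    case 2
    then show ?thesis using S T unfolding fcc_def by blast
  next
    case 3
    then have "S \<notin> Th"
      using regular_disjoint[OF fine T] x by blast
    then show ?thesis using 3 S T unfolding fcc_def by blast
  qed
qed

lemma fcc_minus_fine: "K \<in> fcc \<T> Th - Th \<Longrightarrow> K \<in> \<T> \<and> (\<exists>T\<in>Th. T \<subset> K)"
  unfolding fcc_def by blast

lemma fine_inside_coarse_not_fcc:
  assumes "T \<in> Th" "K \<in> \<T>" "T \<subset> K"
  shows "T \<notin> fcc \<T> Th"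
proof
  have inter: "A \<inter> B \<noteq> {}" if "A \<in> \<T> \<or> A \<in> Th" "A \<subseteq> B" for A B
    using that open_simplex_nonempty regular_simplex[OF coarse] regular_simplex[OF fine] by blast
  assume "T \<in> fcc \<T> Th"
  then consider "T \<in> \<T>" | S where "S \<in> \<T>" "S \<subset> T" unfolding fcc_def by blast
  then show False
  proof cases
    case 1
    then show False using regular_disjoint[OF coarse 1 assms(2)] inter[of T K] assms by blast
  next
    case 2
    then show False using regular_disjoint[OF coarse 2(1) assms(2)] inter[of S K] assms by blast
  qed
qed

lemma coarse_in_fcc:
  assumes "T \<in> Th" "K \<in> \<T>" "T \<subset> K"
  shows "K \<in> fcc \<T> Th - Th"
proof -
  have "K \<in> fcc \<T> Th" using assms unfolding fcc_def by blast
  moreover have "K \<notin> Th"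
    using regular_disjoint[OF fine assms(1)] assms open_simplex_nonempty[OF regular_simplex[OF fine assms(1)]] by blast
  ultimately show ?thesis by blast
qed

lemma fcc_cases: "T \<in> fcc \<T> Th \<Longrightarrow> (T \<in> \<T> \<or> T \<in> Th) \<and> (\<exists>S\<in>\<T>. S \<subseteq> T) \<and> (\<exists>S\<in>Th. S \<subseteq> T)"
  unfolding fcc_def by blast

lemma fcc_simplex: "T \<in> fcc \<T> Th \<Longrightarrow> open_simplex T"
  using fcc_cases regular_simplex coarse fine by blast

lemma fcc_finite: "finite (fcc \<T> Th)"
  using regular_finite[OF coarse] regular_finite[OF fine]
  by (rule finite_subset[of _ "\<T> \<union> Th", rotated, OF finite_UnI]) (auto simp: fcc_def)

lemma fcc_closure_subset: "T \<in> fcc \<T> Th \<Longrightarrow> closure T \<subseteq> closure \<Omega>"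
  using fcc_cases regular_closure_subset coarse fine by blast

text \<open>Supplies, at a given point of the closure, elements of either mesh inside an element of
  the coarsening. Through them the mixed case of \<open>fcc_lattice\<close> uses the common-face
  property of each mesh.\<close>

lemma fcc_refined:
  assumes T: "T \<in> fcc \<T> Th" and z: "z \<in> closure T"
  shows "\<exists>S\<in>\<T>. S \<subseteq> T \<and> z \<in> closure S" "\<exists>S\<in>Th. S \<subseteq> T \<and> z \<in> closure S"
proof -
  interpret swap: nested_meshes \<Omega> Th \<T> by (rule nested_meshes_swap)
  obtain S S' where S: "S \<in> \<T>" "S \<subseteq> T" "S' \<in> Th" "S' \<subseteq> T" using fcc_cases[OF T] by blast
  show "\<exists>S\<in>\<T>. S \<subseteq> T \<and> z \<in> closure S"
  proof (cases "T \<in> \<T>")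
    case False
    then have "T \<in> Th" using fcc_cases[OF T] by blast
    then show ?thesis using refined_by_coarse S z by blast
  qed (use z in blast)
  show "\<exists>S\<in>Th. S \<subseteq> T \<and> z \<in> closure S"
  proof (cases "T \<in> Th")
    case False
    then have "T \<in> \<T>" using fcc_cases[OF T] by blast
    then show ?thesis using swap.refined_by_coarse S z by blast
  qed (use z in blast)
qed

text \<open>A substitute for conformity of the coarsened mesh. Elements of the same mesh share a
  face. For \<open>S\<close> from \<open>\<T>\<close> and \<open>S'\<close> from \<open>Th\<close>,
  the comparison runs over an element of \<open>\<T>\<close> inside \<open>S'\<close> and an element
  of \<open>Th\<close> inside \<open>S\<close>, both touching \<open>z\<close>.\<close>

lemma fcc_lattice:
  assumes T: "T \<in> fcc \<T> Th" "z \<in> closure T" and T': "T' \<in> fcc \<T> Th" "z \<in> closure T'"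
  shows "z \<in> lattice p (vertices T) \<longleftrightarrow> z \<in> lattice p (vertices T')"
proof -
  have same: "z \<in> lattice p (vertices S) \<longleftrightarrow> z \<in> lattice p (vertices S')"
    if "regular_triangulation \<Omega> \<M>" "S \<in> \<M>" "S' \<in> \<M>" "S \<in> fcc \<T> Th" "S' \<in> fcc \<T> Th" "z \<in> closure S" "z \<in> closure S'" for S S' \<M>
    using that lattice_transfer[OF fcc_simplex[OF that(4)] fcc_simplex[OF that(5)],
        of S' S z p] regular_face[OF that(1)] by blast
  have mixed: "z \<in> lattice p (vertices S) \<longleftrightarrow> z \<in> lattice p (vertices S')"
    if S: "S \<in> \<T>" "S' \<in> Th" "S \<in> fcc \<T> Th" "S' \<in> fcc \<T> Th" "z \<in> closure S" "z \<in> closure S'" for S S'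
  proof -
    obtain R where R: "R \<in> \<T>" "R \<subseteq> S'" "z \<in> closure R" using fcc_refined(1)[OF S(4,6)] by blast
    obtain R' where R': "R' \<in> Th" "R' \<subseteq> S" "z \<in> closure R'" using fcc_refined(2)[OF S(3,5)] by blast
    show ?thesis
      by (rule lattice_transfer[OF fcc_simplex[OF S(3)] fcc_simplex[OF S(4)]
          regular_face[OF coarse S(1) R(1)] regular_face[OF fine S(2) R'(1)] R(2) R'(2) R(3) R'(3)])
  qed
  show ?thesis
    using fcc_cases[OF T(1)] fcc_cases[OF T'(1)] same[OF coarse] same[OF fine] mixed assms by blast
qed

lemma fcc_nodes:
  assumes "T \<in> fcc \<T> Th" "z \<in> closure T"
  shows "z \<in> nodes p (fcc \<T> Th) \<longleftrightarrow> z \<in> lattice p (vertices T)"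
proof -
  have "z \<in> closure S" if "S \<in> fcc \<T> Th" "z \<in> lattice p (vertices S)" for S
    using that lattice_subset_convex_hull[OF open_simplex_finite_vertices[OF fcc_simplex[OF that(1)]]]
      open_simplex_closure[OF fcc_simplex[OF that(1)]] by blast
  then show ?thesis
    unfolding nodes_eq_lattice using fcc_lattice assms by blast
qed

end

text \<open>A regular mesh is nested with itself and is its own finest common coarsening, so the
  statement for coarsenings applies.\<close>

lemma regular_nodes:
  assumes "regular_triangulation \<Omega> \<M>" "T \<in> \<M>" "z \<in> closure T"
  shows "z \<in> nodes p \<M> \<longleftrightarrow> z \<in> lattice p (vertices T)"
proof -
  interpret nested_meshes \<Omega> \<M> \<M>
    using assms(1) regular_disjoint[OF assms(1)] by unfold_locales blast+
  have "fcc \<M> \<M> = \<M>"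
    using regular_disjoint[OF assms(1)] open_simplex_nonempty[OF regular_simplex[OF assms(1)]]
    unfolding fcc_def by blast
  then show ?thesis using fcc_nodes assms(2,3) by metis
qed

section \<open>Averaging elements\<close>

text \<open>The index \<open>D\<close> of the invariant records the elements already
  visited.\<close>

lemma loop_invariant:
  assumes "loop R xs s s'" "I D s"
    and "\<And>x D s s'. x \<in> set xs \<Longrightarrow> R x s s' \<Longrightarrow> I D s \<Longrightarrow> I (insert x D) s'"
  shows "I (D \<union> set xs) s'"
  using assms
proof (induction xs arbitrary: D s)
  case (Cons x xs)
  then obtain s'' where "R x s s''" "loop R xs s'' s'" by auto
  then have "I (insert x D \<union> set xs) s'"
    using Cons.prems by (intro Cons.IH[of s'']) auto
  then show ?case by simp
qed simp

lemma fold_fill_step_Some: "a z = Some T \<Longrightarrow> fold (fill_step p \<M>) ys a z = Some T"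
  by (induction ys arbitrary: a) (auto simp: fill_step_def)

lemma fold_fill_step_None:
  assumes "a z = None" "z \<in> nodes p \<M>" "T \<in> set ys" "z \<in> closure T"
  shows "\<exists>T'\<in>set ys. z \<in> closure T' \<and> fold (fill_step p \<M>) ys a z = Some T'"
  using assms
proof (induction ys arbitrary: a)
  case (Cons Y ys)
  show ?case
  proof (cases "z \<in> closure Y")
    case True
    then have "fill_step p \<M> Y a z = Some Y" using Cons.prems by (simp add: fill_step_def)
    then show ?thesis using True fold_fill_step_Some by fastforce
  next
    case False
    then have "fill_step p \<M> Y a z = None" using Cons.prems by (simp add: fill_step_def)
    then show ?thesis using Cons.IH[of "fill_step p \<M> Y a"] Cons.prems False by auto
  qed
qed simp

context nested_meshes
begin

lemma fine_coarse_pairsD: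
  assumes "(T, K) \<in> fine_coarse_pairs \<T> Th z"
  shows "T \<in> Th" "K \<in> fcc \<T> Th - Th" "T \<subset> K" "z \<in> closure T" "z \<in> closure K"
  using assms coarse_in_fcc closure_mono[of T K] unfolding fine_coarse_pairs_def node_patch_def by auto

lemma fine_coarse_pairs_nonempty:
  assumes "K \<in> fcc \<T> Th - Th" "z \<in> closure K"
  obtains T where "(T, K) \<in> fine_coarse_pairs \<T> Th z" "T \<notin> fcc \<T> Th"
proof -
  obtain T where T: "T \<in> Th" "T \<subseteq> K" "z \<in> closure T" using fcc_refined(2) assms by blast
  then have "T \<subset> K" using assms by blast
  moreover have "K \<in> \<T>" using fcc_minus_fine assms by blast
  ultimately show thesis
    using T fine_inside_coarse_not_fcc that unfolding fine_coarse_pairs_def node_patch_def by blast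
qed

text \<open>At an interior point of \<open>T\<close> no other element of \<open>Th\<close> touches,
  and a common element is never a proper part of an element of \<open>\<T>\<close>. Hence clause (a)
  of the first loop obeys the same description as clause (ii).\<close>

lemma fine_coarse_pairs_interior:
  assumes T: "T \<in> Th \<inter> fcc \<T> Th" "z \<in> T"
  shows "fine_coarse_pairs \<T> Th z = {}"
proof (rule ccontr)
  assume "fine_coarse_pairs \<T> Th z \<noteq> {}"
  then obtain T' K where pair: "(T', K) \<in> fine_coarse_pairs \<T> Th z" by auto
  note p = fine_coarse_pairsD[OF pair]
  have "T \<inter> T' \<noteq> {}"
    using p(4) T(2) open_simplex_open[OF regular_simplex[OF fine, of T]] T(1) open_Int_closure_eq_empty by blast
  then have "T = T'" using regular_disjoint[OF fine] T(1) p(1) by blast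
  then show False
    using fine_inside_coarse_not_fcc[OF p(1) _ p(3)] fcc_minus_fine[OF p(2)] T(1) by blast
qed

text \<open>Describes the outcome of the first loop at one node independently of the order of the
  loop: which alternative applies depends on \<open>z\<close> alone.\<close>

definition averaging_choice :: "'a \<Rightarrow> 'a set option \<Rightarrow> 'a set option \<Rightarrow> bool" where
  "averaging_choice z tt th \<longleftrightarrow>
     (if fine_coarse_pairs \<T> Th z \<noteq> {} then \<exists>(T, K)\<in>fine_coarse_pairs \<T> Th z. th = Some T \<and> tt = Some K
      else \<exists>T\<in>Th \<inter> fcc \<T> Th. z \<in> closure T \<and> tt = Some T \<and> th = Some T)"

text \<open>Both assignments are undefined at a node until an element touching it is visited. They
  are kept undefined together because the guard in \<open>common_step\<close> asks for both.\<close>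

definition loop_inv :: "nat \<Rightarrow> 'a set set \<Rightarrow> ('a \<rightharpoonup> 'a set) \<times> ('a \<rightharpoonup> 'a set) \<Rightarrow> bool" where
  "loop_inv p D s \<longleftrightarrow> (\<forall>z.
     if z \<in> nodes p (fcc \<T> Th) \<union> nodes p Th \<and> (\<exists>T\<in>D. z \<in> closure T)
     then averaging_choice z (fst s z) (snd s z) else fst s z = None \<and> snd s z = None)"

lemma averaging_choice_Some: "averaging_choice z tt th \<Longrightarrow> tt \<noteq> None \<and> th \<noteq> None"
  unfolding averaging_choice_def by (auto split: if_splits)

lemma common_step_loop_inv:
  assumes T: "T \<in> Th \<inter> fcc \<T> Th" and step: "common_step p \<T> (fcc \<T> Th) Th T s s'" and inv: "loop_inv p D s"
  shows "loop_inv p (insert T D) s'"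
  unfolding loop_inv_def
proof
  fix z
  obtain \<tau>t \<tau>h \<tau>t' \<tau>h' where s: "s = (\<tau>t, \<tau>h)" "s' = (\<tau>t', \<tau>h')" by (cases s, cases s') auto
  let ?N = "nodes p (fcc \<T> Th) \<union> nodes p Th"
  let ?P = "fine_coarse_pairs \<T> Th z"
  have os: "open T" using open_simplex_open[OF fcc_simplex] T by blast
  have cl: "z \<in> closure T \<longleftrightarrow> z \<in> T \<or> z \<in> frontier T"
    using os closure_subset[of T] unfolding frontier_def by (auto simp: interior_open)
  have st: "if z \<in> ?N \<and> z \<in> T then \<tau>t' z = Some T \<and> \<tau>h' z = Some T
         else if z \<in> ?N \<and> z \<in> frontier T \<and> \<tau>t z = None \<and> \<tau>h z = None
         then (if ?P \<noteq> {} then \<exists>(T', K) \<in> ?P. \<tau>h' z = Some T' \<and> \<tau>t' z = Some K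
               else \<tau>t' z = Some T \<and> \<tau>h' z = Some T)
         else \<tau>t' z = \<tau>t z \<and> \<tau>h' z = \<tau>h z"
    using step unfolding common_step_def s prod.case by blast
  have iv: "if z \<in> ?N \<and> (\<exists>T\<in>D. z \<in> closure T) then averaging_choice z (\<tau>t z) (\<tau>h z) else \<tau>t z = None \<and> \<tau>h z = None"
    using inv unfolding loop_inv_def s fst_conv snd_conv by blast
  have "if z \<in> ?N \<and> (\<exists>T\<in>insert T D. z \<in> closure T) then averaging_choice z (\<tau>t' z) (\<tau>h' z) else \<tau>t' z = None \<and> \<tau>h' z = None"
  proof (cases "z \<in> ?N \<and> z \<in> closure T")
    case False
    then have "\<tau>t' z = \<tau>t z \<and> \<tau>h' z = \<tau>h z" using st cl by (auto split: if_splits)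
    then show ?thesis using iv False by (auto split: if_splits)
  next
    case True
    have "averaging_choice z (\<tau>t' z) (\<tau>h' z)"
    proof (cases "z \<in> T")
      case inT: True
      then show ?thesis
        using st True T fine_coarse_pairs_interior[OF T inT] unfolding averaging_choice_def by auto
    next
      case notT: False
      then have fr: "z \<in> frontier T" using True cl by blast
      show ?thesis
      proof (cases "\<exists>T\<in>D. z \<in> closure T")
        case old: True
        then have ch: "averaging_choice z (\<tau>t z) (\<tau>h z)" using iv True by auto
        then have "\<tau>t' z = \<tau>t z \<and> \<tau>h' z = \<tau>h z"
          using st notT averaging_choice_Some[OF ch] by auto
        then show ?thesis using ch by simp
      next
        case new: False
        then have none: "\<tau>t z = None" "\<tau>h z = None" using iv by (auto split: if_splits)
        have "if ?P \<noteq> {} then \<exists>(T', K) \<in> ?P. \<tau>h' z = Some T' \<and> \<tau>t' z = Some K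
               else \<tau>t' z = Some T \<and> \<tau>h' z = Some T"
          using st True notT fr none by simp
        then show ?thesis
          unfolding averaging_choice_def using T True by (auto split: if_splits)
      qed
    qed
    then show ?thesis using True by auto
  qed
  then show "if z \<in> ?N \<and> (\<exists>T\<in>insert T D. z \<in> closure T)
      then averaging_choice z (fst s' z) (snd s' z) else fst s' z = None \<and> snd s' z = None"
    by (simp only: s fst_conv snd_conv)
qed

text \<open>A node on the closure of an element of \<open>fcc \<T> Th - Th\<close> has a fine-coarse
  pair. The first loop therefore assigns such a pair or leaves the node to the later loops, and
  these choose elements that are coarse for one operator and strictly inside an element of
  \<open>\<T>\<close> for the other.\<close>

lemma adapted_averaging_cases:
  assumes "adapted_averaging p \<T> (fcc \<T> Th) Th \<tau>t \<tau>h"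
  shows adapted_coarse: "\<And>z K. z \<in> nodes p (fcc \<T> Th) \<Longrightarrow> K \<in> fcc \<T> Th - Th \<Longrightarrow> z \<in> closure K \<Longrightarrow>
      \<exists>K'\<in>fcc \<T> Th - Th. z \<in> closure K' \<and> \<tau>t z = Some K'"
    and adapted_fine: "\<And>z K. z \<in> nodes p Th \<Longrightarrow> K \<in> fcc \<T> Th - Th \<Longrightarrow> z \<in> closure K \<Longrightarrow>
      \<exists>T\<in>Th. \<exists>K'\<in>\<T>. T \<subset> K' \<and> z \<in> closure T \<and> \<tau>h z = Some T"
    and adapted_common: "\<And>z T. z \<in> nodes p (fcc \<T> Th) \<Longrightarrow> T \<in> Th \<inter> fcc \<T> Th \<Longrightarrow> z \<in> closure T \<Longrightarrow>
      (\<exists>T'\<in>Th \<inter> fcc \<T> Th. z \<in> closure T' \<and> \<tau>t z = Some T' \<and> \<tau>h z = Some T') \<or>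
      (\<exists>T'\<in>Th. \<exists>K\<in>fcc \<T> Th - Th. T' \<subset> K \<and> z \<in> closure T' \<and> \<tau>h z = Some T' \<and> \<tau>t z = Some K)"
proof -
  obtain xs ys zs \<tau>t\<^sub>1 \<tau>h\<^sub>1 where xs: "set xs = Th \<inter> fcc \<T> Th" and ys: "set ys = fcc \<T> Th - Th"
    and zs: "set zs = Th - fcc \<T> Th"
    and lp: "loop (common_step p \<T> (fcc \<T> Th) Th) xs (Map.empty, Map.empty) (\<tau>t\<^sub>1, \<tau>h\<^sub>1)"
    and \<tau>t: "\<tau>t = fold (fill_step p (fcc \<T> Th)) ys \<tau>t\<^sub>1" and \<tau>h: "\<tau>h = fold (fill_step p Th) zs \<tau>h\<^sub>1"
    using assms unfolding adapted_averaging_def by blast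
  have "loop_inv p ({} \<union> set xs) (\<tau>t\<^sub>1, \<tau>h\<^sub>1)"
  proof (rule loop_invariant[OF lp])
    show "loop_inv p {} (Map.empty, Map.empty)" by (simp add: loop_inv_def)
  qed (use common_step_loop_inv xs in blast)
  then have "\<forall>z. if z \<in> nodes p (fcc \<T> Th) \<union> nodes p Th \<and> (\<exists>T\<in>Th \<inter> fcc \<T> Th. z \<in> closure T)
     then averaging_choice z (\<tau>t\<^sub>1 z) (\<tau>h\<^sub>1 z) else \<tau>t\<^sub>1 z = None \<and> \<tau>h\<^sub>1 z = None"
    by (simp only: loop_inv_def xs fst_conv snd_conv Un_empty_left)
  then have inv: "if z \<in> nodes p (fcc \<T> Th) \<union> nodes p Th \<and> (\<exists>T\<in>Th \<inter> fcc \<T> Th. z \<in> closure T)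
     then averaging_choice z (\<tau>t\<^sub>1 z) (\<tau>h\<^sub>1 z) else \<tau>t\<^sub>1 z = None \<and> \<tau>h\<^sub>1 z = None" for z
    by (rule spec)
  have keep: "\<tau>t z = \<tau>t\<^sub>1 z" "\<tau>h z = \<tau>h\<^sub>1 z" if "averaging_choice z (\<tau>t\<^sub>1 z) (\<tau>h\<^sub>1 z)" for z
    using averaging_choice_Some[OF that] fold_fill_step_Some unfolding \<tau>t \<tau>h by fastforce+
  have pair: "\<exists>T K. (T, K) \<in> fine_coarse_pairs \<T> Th z \<and> \<tau>h z = Some T \<and> \<tau>t z = Some K"
    if pr: "averaging_choice z (\<tau>t\<^sub>1 z) (\<tau>h\<^sub>1 z)" "K \<in> fcc \<T> Th - Th" "z \<in> closure K" for z K
  proof -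
    obtain T where "(T, K) \<in> fine_coarse_pairs \<T> Th z" by (rule fine_coarse_pairs_nonempty[OF pr(2,3)])
    then show ?thesis
      using pr(1) keep[OF pr(1)] unfolding averaging_choice_def by (auto split: if_splits)
  qed
  show "\<exists>K'\<in>fcc \<T> Th - Th. z \<in> closure K' \<and> \<tau>t z = Some K'"
    if z: "z \<in> nodes p (fcc \<T> Th)" "K \<in> fcc \<T> Th - Th" "z \<in> closure K" for z K
  proof (cases "\<exists>T\<in>Th \<inter> fcc \<T> Th. z \<in> closure T")
    case True
    then have "averaging_choice z (\<tau>t\<^sub>1 z) (\<tau>h\<^sub>1 z)" using inv[of z] z(1) by auto
    from pair[OF this z(2,3)] obtain T K' where
      T: "(T, K') \<in> fine_coarse_pairs \<T> Th z" "\<tau>t z = Some K'" by blast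
    show ?thesis using fine_coarse_pairsD[OF T(1)] T(2) by blast
  next
    case False
    \<comment> \<open>No common element touches \<open>z\<close>, so it is still free and the second
      loop gives it an element of \<open>fcc \<T> Th - Th\<close>.\<close>
    then have "\<tau>t\<^sub>1 z = None" using inv[of z] by (auto split: if_splits)
    then show ?thesis
      using fold_fill_step_None[of \<tau>t\<^sub>1 z p "fcc \<T> Th" K ys] z ys unfolding \<tau>t by auto
  qed
  show "\<exists>T\<in>Th. \<exists>K'\<in>\<T>. T \<subset> K' \<and> z \<in> closure T \<and> \<tau>h z = Some T"
    if z: "z \<in> nodes p Th" "K \<in> fcc \<T> Th - Th" "z \<in> closure K" for z K
  proof (cases "\<exists>T\<in>Th \<inter> fcc \<T> Th. z \<in> closure T")
    case True
    then have "averaging_choice z (\<tau>t\<^sub>1 z) (\<tau>h\<^sub>1 z)" using inv[of z] z(1) by auto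
    from pair[OF this z(2,3)] obtain T K' where
      T: "(T, K') \<in> fine_coarse_pairs \<T> Th z" "\<tau>h z = Some T" by blast
    note tk = fine_coarse_pairsD[OF T(1)]
    show ?thesis using tk T(2) fcc_minus_fine[OF tk(2)] by blast
  next
    case False
    then have none: "\<tau>h\<^sub>1 z = None" using inv[of z] by (auto split: if_splits)
    obtain T where T: "(T, K) \<in> fine_coarse_pairs \<T> Th z" "T \<notin> fcc \<T> Th"
      by (rule fine_coarse_pairs_nonempty[OF z(2,3)])
    then have "T \<in> set zs" "z \<in> closure T" using fine_coarse_pairsD[OF T(1)] zs by blast+
    from fold_fill_step_None[of \<tau>h\<^sub>1, OF none z(1) this] obtain T' where
      T': "T' \<in> Th - fcc \<T> Th" "z \<in> closure T'" "\<tau>h z = Some T'"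
      using zs unfolding \<tau>h by blast
    \<comment> \<open>The third loop may pick another element than the \<open>T\<close> found above,
      but any element of \<open>Th\<close> outside the coarsening lies strictly inside an element of
      \<open>\<T>\<close>.\<close>
    then obtain K' where "K' \<in> \<T>" "T' \<subset> K'" using element_of_fcc[of T'] by blast
    then show ?thesis using T' by blast
  qed
  show "(\<exists>T'\<in>Th \<inter> fcc \<T> Th. z \<in> closure T' \<and> \<tau>t z = Some T' \<and> \<tau>h z = Some T') \<or>
      (\<exists>T'\<in>Th. \<exists>K\<in>fcc \<T> Th - Th. T' \<subset> K \<and> z \<in> closure T' \<and> \<tau>h z = Some T' \<and> \<tau>t z = Some K)"
    if z: "z \<in> nodes p (fcc \<T> Th)" "T \<in> Th \<inter> fcc \<T> Th" "z \<in> closure T" for z T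
  proof -
    have "z \<in> nodes p (fcc \<T> Th) \<union> nodes p Th \<and> (\<exists>T\<in>Th \<inter> fcc \<T> Th. z \<in> closure T)"
      using z by blast
    then have ch: "averaging_choice z (\<tau>t\<^sub>1 z) (\<tau>h\<^sub>1 z)" using inv[of z] by simp
    show ?thesis
    proof (cases "fine_coarse_pairs \<T> Th z = {}")
      case True
      then show ?thesis using ch keep[OF ch] unfolding averaging_choice_def by auto
    next
      case False
      then obtain T' K where T': "(T', K) \<in> fine_coarse_pairs \<T> Th z" "\<tau>h z = Some T'" "\<tau>t z = Some K"
        using ch keep[OF ch] unfolding averaging_choice_def by auto
      then show ?thesis using fine_coarse_pairsD[OF T'(1)] by blast
    qed
  qed
qed

end

section \<open>Lagrange bases and their duals\<close>

text \<open>The restriction of Lebesgue measure to \<open>S\<close> is complete, so measurability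
  passes to functions that agree almost everywhere. This covers \<open>u\<close> and the dual
  functions, which are tied to polynomials only on the element.\<close>

lemma borel_measurable_lebesgue_on_AE:
  fixes f g :: "'a::euclidean_space \<Rightarrow> real"
  assumes S: "S \<in> sets lebesgue" and g: "g \<in> borel_measurable (lebesgue_on S)"
    and eq: "AE x in lebesgue_on S. f x = g x"
  shows "f \<in> borel_measurable (lebesgue_on S)"
proof -
  interpret complete_measure "lebesgue_on S"
  proof
    fix A B assume AB: "B \<subseteq> A" "A \<in> null_sets (lebesgue_on S)"
    then have "A \<subseteq> S" "A \<in> null_sets lebesgue"
      using null_sets_restrict_space[OF S] by blast+
    then have "B \<in> null_sets (lebesgue_on S)"
      using AB(1) completion.complete2[OF AB(1)] null_sets_restrict_space[OF S] by blast
    then show "B \<in> sets (lebesgue_on S)" by blast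
  qed
  show ?thesis
  proof (rule measurableI)
    fix X :: "real set" assume X: "X \<in> sets borel"
    show "f -` X \<inter> space (lebesgue_on S) \<in> sets (lebesgue_on S)"
    proof (rule in_sets_AE)
      show "g -` X \<inter> space (lebesgue_on S) \<in> sets (lebesgue_on S)"
        using measurable_sets[OF g X] .
      show "AE x in lebesgue_on S. x \<in> g -` X \<inter> space (lebesgue_on S) \<longleftrightarrow> x \<in> f -` X \<inter> space (lebesgue_on S)"
        using eq by eventually_elim simp
    qed simp
  qed simp
qed

text \<open>The subset of \<open>T\<close> where the functions differ is open and null, hence empty;
  continuity carries the equality to the closure.\<close>

lemma continuous_on_closure_eq:
  fixes f g :: "'a::euclidean_space \<Rightarrow> real"
  assumes T: "open T" and f: "continuous_on (closure T) f" and g: "continuous_on (closure T) g"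
    and eq: "AE x in lebesgue_on T. f x = g x" and x: "x \<in> closure T"
  shows "f x = g x"
proof -
  let ?D = "T \<inter> (\<lambda>x. f x - g x) -` (- {0})"
  have cont: "continuous_on (closure T) (\<lambda>x. f x - g x)" by (intro continuous_intros f g)
  then have "open ?D"
    using T closure_subset by (intro continuous_open_preimage continuous_on_subset[OF cont]) auto
  moreover have "AE x in lebesgue. x \<notin> ?D"
    using eq T by (simp add: AE_restrict_space_iff)
  then have "negligible ?D"
    using \<open>open ?D\<close> by (simp add: negligible_iff_null_sets AE_iff_null_sets)
  ultimately have "?D = {}" using open_not_negligible by blast
  then have "f y - g y = 0" if "y \<in> T" for y using that by auto
  from continuous_constant_on_closure[OF cont this x] show ?thesis by simp
qed

lemma continuous_integrable_on_bounded:
  fixes f :: "'a::euclidean_space \<Rightarrow> real"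
  assumes "bounded T" "T \<in> sets lebesgue" "continuous_on UNIV f"
  shows "integrable (lebesgue_on T) f"
proof -
  have "compact (closure T)" using assms(1) by simp
  then have "bounded (f ` closure T)"
    using continuous_on_subset[OF assms(3)] compact_continuous_image compact_imp_bounded by blast
  then obtain B where B: "\<And>x. x \<in> T \<Longrightarrow> \<bar>f x\<bar> \<le> B"
    unfolding bounded_iff using closure_subset by force
  show ?thesis
  proof (rule Bochner_Integration.integrable_bound)
    show "integrable (lebesgue_on T) (\<lambda>x. B)" by (rule integrable_const_bounded[OF assms(1,2)])
    show "f \<in> borel_measurable (lebesgue_on T)" by (rule continuous_measurable_lebesgue_on[OF assms(3)])
    show "AE x in lebesgue_on T. norm (f x) \<le> norm B"
      using B by (intro AE_I2) fastforce
  qed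
qed

lemma polyd_continuous: "polyd n f \<Longrightarrow> continuous_on S f"
  using polyd_C1[of n f] C1_continuous by blast

text \<open>Collects what the uniform and the coarsened mesh share. Conformity is replaced by
  \<open>nodes_iff\<close>: on a closed element the nodes of the mesh are exactly its own lattice
  points.\<close>

locale finite_element_mesh =
  fixes p :: nat and \<Omega> :: "'a::euclidean_space set" and \<M> :: "'a set set"
    and \<phi> :: "'a \<Rightarrow> 'a \<Rightarrow> real" and \<phi>s :: "'a set \<Rightarrow> 'a \<Rightarrow> 'a \<Rightarrow> real"
  assumes p: "p \<ge> 1" and finite_elements: "finite \<M>"
    and elements: "\<And>T. T \<in> \<M> \<Longrightarrow> open_simplex T"
    and in_domain: "\<And>T. T \<in> \<M> \<Longrightarrow> closure T \<subseteq> closure \<Omega>"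
    and nodes_iff: "\<And>T z. T \<in> \<M> \<Longrightarrow> z \<in> closure T \<Longrightarrow> z \<in> nodes p \<M> \<longleftrightarrow> z \<in> lattice p (vertices T)"
    and lagrange: "lagrange_basis p \<Omega> \<M> \<phi>" and dual: "dual_basis p \<M> \<phi> \<phi>s"
begin

lemma finite_nodes: "finite (nodes p \<M>)"
  unfolding nodes_eq_lattice
  by (intro finite_UN_I finite_elements finite_lattice open_simplex_finite_vertices elements)

lemma lattice_eq_nodes:
  assumes T: "T \<in> \<M>"
  shows "lattice p (vertices T) = nodes p \<M> \<inter> closure T"
proof -
  have "lattice p (vertices T) \<subseteq> closure T"
    unfolding open_simplex_closure[OF elements[OF T]]
    by (rule lattice_subset_convex_hull[OF open_simplex_finite_vertices[OF elements[OF T]]])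
  then show ?thesis using nodes_iff[OF T] by blast
qed

lemma unisolvent:
  assumes "T \<in> \<M>" "polyd p f" "\<And>z. z \<in> nodes p \<M> \<inter> closure T \<Longrightarrow> f z = 0"
  shows "f x = 0"
proof (rule lattice_unisolvent[OF _ _ p assms(2)])
  show "finite (vertices T)" "affine hull vertices T = UNIV"
    using open_simplex_finite_vertices open_simplex_affine_hull elements[OF assms(1)] by blast+
  show "f z = 0" if "z \<in> lattice p (vertices T)" for z
    using assms(3) that unfolding lattice_eq_nodes[OF assms(1)] .
qed

lemma basis_polyd:
  assumes "z \<in> nodes p \<M>" "T \<in> \<M>"
  shows "\<exists>q. polyd p q \<and> (\<forall>x\<in>closure T. \<phi> z x = q x)"
proof -
  obtain q where q: "poly_le p q" "AE x in lebesgue_on T. \<phi> z x = q x"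
    and cont: "continuous_on (closure \<Omega>) (\<phi> z)"
    using lagrange assms unfolding lagrange_basis_def spline_space_def by blast
  have "\<phi> z x = q x" if "x \<in> closure T" for x
    using continuous_on_closure_eq[OF open_simplex_open[OF elements[OF assms(2)]]
        continuous_on_subset[OF cont in_domain[OF assms(2)]]
        polyd_continuous[OF poly_le_imp_polyd[OF q(1)]] q(2) that] .
  then show ?thesis using poly_le_imp_polyd[OF q(1)] by blast
qed

lemma basis_at_nodes: "z \<in> nodes p \<M> \<Longrightarrow> z' \<in> nodes p \<M> \<Longrightarrow> \<phi> z z' = (if z = z' then 1 else 0)"
  using lagrange unfolding lagrange_basis_def by meson

lemma basis_local:
  assumes "z \<in> nodes p \<M>" "T \<in> \<M>" "z \<notin> closure T" "x \<in> closure T"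
  shows "\<phi> z x = 0"
proof -
  obtain q where q: "polyd p q" "\<And>x. x \<in> closure T \<Longrightarrow> \<phi> z x = q x"
    using basis_polyd[OF assms(1,2)] by blast
  have "q y = 0" if "y \<in> nodes p \<M> \<inter> closure T" for y
    using basis_at_nodes[OF assms(1), of y] q(2)[of y] that assms(3) by auto
  then have "q x = 0" by (rule unisolvent[OF assms(2) q(1)])
  then show ?thesis using q(2)[OF assms(4)] by simp
qed

lemma interpolation:
  assumes "T \<in> \<M>" "polyd p f" "x \<in> closure T"
  shows "f x = (\<Sum>z\<in>nodes p \<M> \<inter> closure T. f z * \<phi> z x)"
proof -
  let ?\<Lambda> = "nodes p \<M> \<inter> closure T"
  have "\<forall>z\<in>?\<Lambda>. \<exists>q. polyd p q \<and> (\<forall>x\<in>closure T. \<phi> z x = q x)"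
    using basis_polyd assms(1) by blast
  from bchoice[OF this] obtain q where "\<forall>z\<in>?\<Lambda>. polyd p (q z) \<and> (\<forall>x\<in>closure T. \<phi> z x = q z x)" ..
  then have q: "\<And>z. z \<in> ?\<Lambda> \<Longrightarrow> polyd p (q z)" "\<And>z x. z \<in> ?\<Lambda> \<Longrightarrow> x \<in> closure T \<Longrightarrow> \<phi> z x = q z x"
    by blast+
  have poly: "polyd p (\<lambda>x. f x - (\<Sum>z\<in>?\<Lambda>. f z * q z x))"
    by (intro polyd_diff assms(2) polyd_sum polyd_cmult q(1))
  have "f y - (\<Sum>z\<in>?\<Lambda>. f z * q z y) = 0" if y: "y \<in> ?\<Lambda>" for y
  proof -
    have "(\<Sum>z\<in>?\<Lambda>. f z * q z y) = (\<Sum>z\<in>?\<Lambda>. if z = y then f z else 0)"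
    proof (rule sum.cong[OF refl])
      fix z assume z: "z \<in> ?\<Lambda>"
      then have "q z y = (if z = y then 1 else 0)"
        using q(2)[OF z, of y] basis_at_nodes[of z y] y by simp
      then show "f z * q z y = (if z = y then f z else 0)" by simp
    qed
    also have "\<dots> = f y" using y finite_nodes by simp
    finally show ?thesis by simp
  qed
  then have "f x - (\<Sum>z\<in>?\<Lambda>. f z * q z x) = 0"
    by (rule unisolvent[OF assms(1) poly])
  moreover have "(\<Sum>z\<in>?\<Lambda>. f z * q z x) = (\<Sum>z\<in>?\<Lambda>. f z * \<phi> z x)"
    using q(2) assms(3) by (intro sum.cong) auto
  ultimately show ?thesis by simp
qed

lemma dual_polyd:
  assumes "T \<in> \<M>" "z \<in> nodes p \<M> \<inter> closure T"
  obtains q where "polyd p q" "\<And>x. x \<in> T \<Longrightarrow> \<phi>s T z x = q x"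
proof -
  obtain q where "poly_le p q" "\<forall>x\<in>T. \<phi>s T z x = q x"
    using dual assms unfolding dual_basis_def by meson
  then show thesis using poly_le_imp_polyd by (intro that[of q]) auto
qed

text \<open>Expand \<open>f\<close> in the nodal basis on \<open>T\<close>; biorthogonality picks
  out the coefficient at \<open>z\<close>, which is the nodal value.\<close>

lemma dual_reproduces:
  assumes T: "T \<in> \<M>" and z: "z \<in> nodes p \<M> \<inter> closure T" and f: "polyd p f"
    and u: "AE x in lebesgue_on T. u x = f x"
  shows "integral\<^sup>L (lebesgue_on T) (\<lambda>x. \<phi>s T z x * u x) = f z"
proof -
  let ?\<Lambda> = "nodes p \<M> \<inter> closure T"
  note os = elements[OF T]
  have S: "T \<in> sets lebesgue" using open_simplex_open[OF os] by simp
  obtain q where q: "polyd p q" "\<And>x. x \<in> T \<Longrightarrow> \<phi>s T z x = q x" using dual_polyd[OF T z] by blast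
  have meas_\<phi>s: "\<phi>s T z \<in> borel_measurable (lebesgue_on T)"
    by (rule borel_measurable_lebesgue_on_AE[OF S continuous_measurable_lebesgue_on[OF polyd_continuous[OF q(1)]]])
      (intro AE_I2, simp add: q(2))
  have meas_f: "f \<in> borel_measurable (lebesgue_on T)"
    by (rule continuous_measurable_lebesgue_on[OF polyd_continuous[OF f]])
  have "integral\<^sup>L (lebesgue_on T) (\<lambda>x. \<phi>s T z x * u x) = integral\<^sup>L (lebesgue_on T) (\<lambda>x. \<phi>s T z x * f x)"
    using u borel_measurable_lebesgue_on_AE[OF S meas_f u] meas_f meas_\<phi>s
    by (intro integral_cong_AE borel_measurable_times) (auto elim: eventually_mono)
  also have "\<dots> = integral\<^sup>L (lebesgue_on T) (\<lambda>x. \<Sum>z'\<in>?\<Lambda>. f z' * (\<phi>s T z x * \<phi> z' x))"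
  proof (rule Bochner_Integration.integral_cong[OF refl])
    fix x assume "x \<in> space (lebesgue_on T)"
    then have "f x = (\<Sum>z'\<in>?\<Lambda>. f z' * \<phi> z' x)" using interpolation[OF T f, of x] closure_subset by force
    then show "\<phi>s T z x * f x = (\<Sum>z'\<in>?\<Lambda>. f z' * (\<phi>s T z x * \<phi> z' x))"
      by (simp add: sum_distrib_left mult_ac)
  qed
  also have "\<dots> = (\<Sum>z'\<in>?\<Lambda>. f z' * integral\<^sup>L (lebesgue_on T) (\<lambda>x. \<phi>s T z x * \<phi> z' x))"
  proof -
    have "integrable (lebesgue_on T) (\<lambda>x. \<phi>s T z x * \<phi> z' x)" if z': "z' \<in> ?\<Lambda>" for z'
    proof -
      obtain q' where q': "polyd p q'" "\<And>x. x \<in> closure T \<Longrightarrow> \<phi> z' x = q' x"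
        using basis_polyd[of z' T] z' T by blast
      have "integrable (lebesgue_on T) (\<lambda>x. q x * q' x)"
        by (intro continuous_integrable_on_bounded open_simplex_bounded[OF os] S
            continuous_on_mult polyd_continuous[OF q(1)] polyd_continuous[OF q'(1)])
      then show ?thesis
        using q(2) q'(2) closure_subset[of T]
        by (subst Bochner_Integration.integrable_cong[OF refl, of _ _ "\<lambda>x. q x * q' x"]) auto
    qed
    then show ?thesis by simp
  qed
  also have "\<dots> = (\<Sum>z'\<in>?\<Lambda>. if z' = z then f z' else 0)"
    using dual T z unfolding dual_basis_def by (intro sum.cong) auto
  also have "\<dots> = f z" using z finite_nodes by simp
  finally show ?thesis .
qed

lemma scott_zhang_local:
  assumes "T \<in> \<M>" "x \<in> closure T"
  shows "scott_zhang p \<M> \<phi> \<phi>s \<tau> u x = (\<Sum>z\<in>nodes p \<M> \<inter> closure T.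
    \<phi> z x * integral\<^sup>L (lebesgue_on (\<tau> z)) (\<lambda>y. \<phi>s (\<tau> z) z y * u y))"
  unfolding scott_zhang_def
  by (intro sum.mono_neutral_right finite_nodes) (use basis_local assms in auto)

end

locale finite_element_meshes =
  M\<^sub>1: finite_element_mesh p \<Omega> \<M>\<^sub>1 \<phi>\<^sub>1 \<phi>s\<^sub>1 + M\<^sub>2: finite_element_mesh p \<Omega> \<M>\<^sub>2 \<phi>\<^sub>2 \<phi>s\<^sub>2
  for p :: nat and \<Omega> :: "'a::euclidean_space set" and \<M>\<^sub>1 \<phi>\<^sub>1 \<phi>s\<^sub>1 \<M>\<^sub>2 \<phi>\<^sub>2 \<phi>s\<^sub>2
begin

lemma common_nodes: "T \<in> \<M>\<^sub>1 \<inter> \<M>\<^sub>2 \<Longrightarrow> nodes p \<M>\<^sub>1 \<inter> closure T = nodes p \<M>\<^sub>2 \<inter> closure T"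
  by (metis IntE M\<^sub>1.lattice_eq_nodes M\<^sub>2.lattice_eq_nodes)

lemma common_basis:
  assumes T: "T \<in> \<M>\<^sub>1 \<inter> \<M>\<^sub>2" and z: "z \<in> nodes p \<M>\<^sub>1 \<inter> closure T" and x: "x \<in> closure T"
  shows "\<phi>\<^sub>1 z x = \<phi>\<^sub>2 z x"
proof -
  have z2: "z \<in> nodes p \<M>\<^sub>2 \<inter> closure T" using common_nodes[OF T] z by blast
  obtain q\<^sub>1 where q1: "polyd p q\<^sub>1" "\<And>x. x \<in> closure T \<Longrightarrow> \<phi>\<^sub>1 z x = q\<^sub>1 x"
    using M\<^sub>1.basis_polyd z T by blast
  obtain q\<^sub>2 where q2: "polyd p q\<^sub>2" "\<And>x. x \<in> closure T \<Longrightarrow> \<phi>\<^sub>2 z x = q\<^sub>2 x"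
    using M\<^sub>2.basis_polyd z2 T by blast
  have "q\<^sub>1 x - q\<^sub>2 x = 0"
  proof (rule M\<^sub>1.unisolvent[OF _ polyd_diff[OF q1(1) q2(1)]])
    fix y assume y: "y \<in> nodes p \<M>\<^sub>1 \<inter> closure T"
    then have "y \<in> nodes p \<M>\<^sub>2" using common_nodes[OF T] by blast
    then show "q\<^sub>1 y - q\<^sub>2 y = 0"
      using q1(2)[of y] q2(2)[of y] M\<^sub>1.basis_at_nodes[of z y] M\<^sub>2.basis_at_nodes[of z y] y z z2 by simp
  qed (use T in blast)
  then show ?thesis using q1(2)[OF x] q2(2)[OF x] by simp
qed

text \<open>Let \<open>d\<close> be the difference of the two polynomials. Both dual functions
  reproduce the value \<open>d z\<close> when tested with \<open>d\<close>, so the integral of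
  \<open>d * d\<close> is \<open>d z - d z = 0\<close>.\<close>

lemma common_dual:
  assumes T: "T \<in> \<M>\<^sub>1 \<inter> \<M>\<^sub>2" and z: "z \<in> nodes p \<M>\<^sub>1 \<inter> closure T" and x: "x \<in> T"
  shows "\<phi>s\<^sub>1 T z x = \<phi>s\<^sub>2 T z x"
proof -
  have T': "T \<in> \<M>\<^sub>1" "T \<in> \<M>\<^sub>2" using T by blast+
  have z2: "z \<in> nodes p \<M>\<^sub>2 \<inter> closure T" using common_nodes[OF T] z by blast
  note os = M\<^sub>1.elements[OF T'(1)]
  have S: "T \<in> sets lebesgue" using open_simplex_open[OF os] by simp
  obtain q\<^sub>1 where q1: "polyd p q\<^sub>1" "\<And>x. x \<in> T \<Longrightarrow> \<phi>s\<^sub>1 T z x = q\<^sub>1 x" using M\<^sub>1.dual_polyd[OF T'(1) z] by blast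
  obtain q\<^sub>2 where q2: "polyd p q\<^sub>2" "\<And>x. x \<in> T \<Longrightarrow> \<phi>s\<^sub>2 T z x = q\<^sub>2 x" using M\<^sub>2.dual_polyd[OF T'(2) z2] by blast
  define d where "d x = q\<^sub>1 x - q\<^sub>2 x" for x
  have d: "polyd p d" unfolding d_def by (rule polyd_diff[OF q1(1) q2(1)])
  have cont: "continuous_on A d" "continuous_on A q\<^sub>1" "continuous_on A q\<^sub>2" for A
    using polyd_continuous d q1(1) q2(1) by blast+
  have int: "integrable (lebesgue_on T) (\<lambda>x. q\<^sub>1 x * d x)" "integrable (lebesgue_on T) (\<lambda>x. q\<^sub>2 x * d x)"
    by (intro continuous_integrable_on_bounded open_simplex_bounded[OF os] S continuous_on_mult cont)+
  have "integral\<^sup>L (lebesgue_on T) (\<lambda>x. q\<^sub>1 x * d x) = integral\<^sup>L (lebesgue_on T) (\<lambda>x. \<phi>s\<^sub>1 T z x * d x)"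
    by (rule Bochner_Integration.integral_cong) (auto simp: q1(2))
  also have "\<dots> = d z" by (rule M\<^sub>1.dual_reproduces[OF T'(1) z d]) simp
  also have "\<dots> = integral\<^sup>L (lebesgue_on T) (\<lambda>x. \<phi>s\<^sub>2 T z x * d x)"
    by (rule M\<^sub>2.dual_reproduces[OF T'(2) z2 d, symmetric]) simp
  also have "\<dots> = integral\<^sup>L (lebesgue_on T) (\<lambda>x. q\<^sub>2 x * d x)"
    by (rule Bochner_Integration.integral_cong) (auto simp: q2(2))
  finally have "integral\<^sup>L (lebesgue_on T) (\<lambda>x. q\<^sub>1 x * d x - q\<^sub>2 x * d x) = 0"
    using int by simp
  then have "integral\<^sup>L (lebesgue_on T) (\<lambda>x. d x * d x) = 0"
    by (simp add: d_def algebra_simps)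
  moreover have "integrable (lebesgue_on T) (\<lambda>x. d x * d x)"
    by (intro continuous_integrable_on_bounded open_simplex_bounded[OF os] S continuous_on_mult cont)
  ultimately have "AE x in lebesgue_on T. d x * d x = 0"
    using integral_nonneg_eq_0_iff_AE[of "lebesgue_on T" "\<lambda>x. d x * d x"] by simp
  then have "AE x in lebesgue_on T. d x = 0" by simp
  then have "d x = 0"
    using continuous_on_closure_eq[OF open_simplex_open[OF os] cont(1) continuous_on_const[of _ 0]]
      x closure_subset by blast
  then show ?thesis using q1(2)[OF x] q2(2)[OF x] by (simp add: d_def)
qed

text \<open>Here \<open>u\<close> is arbitrary, which is what a common element refined by
  \<open>\<T>\<close> requires.\<close>

lemma common_functional:
  assumes "T \<in> \<M>\<^sub>1 \<inter> \<M>\<^sub>2" "z \<in> nodes p \<M>\<^sub>1 \<inter> closure T"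
  shows "integral\<^sup>L (lebesgue_on T) (\<lambda>x. \<phi>s\<^sub>1 T z x * u x) = integral\<^sup>L (lebesgue_on T) (\<lambda>x. \<phi>s\<^sub>2 T z x * u x)"
  using common_dual[OF assms] by (intro Bochner_Integration.integral_cong) auto

end

section \<open>Comparison of the two operators, element by element\<close>

theorem lemma4p4:
  fixes \<Omega> :: "'a::euclidean_space set"
    and L\<^sub>0 L :: "'a lsimplex set"
    and \<T> Th Tt :: "'a set set"
    and p l :: nat
    and \<phi>t \<phi>h :: "'a \<Rightarrow> 'a \<Rightarrow> real"
    and \<phi>st \<phi>sh :: "'a set \<Rightarrow> 'a \<Rightarrow> 'a \<Rightarrow> real"
    and \<tau>t \<tau>h :: "'a \<rightharpoonup> 'a set"
  assumes "lipschitz_domain \<Omega>"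
    and "p \<ge> 1"
    and "admissible_labelling \<Omega> L\<^sub>0"
    and "nvb_refinement L\<^sub>0 L" and "\<T> = mesh L" and "regular_triangulation \<Omega> \<T>"
    and "Th = mesh (uniform_refinement L\<^sub>0 l)"
    and "Tt = fcc \<T> Th"
    and "lagrange_basis p \<Omega> Tt \<phi>t" and "dual_basis p Tt \<phi>t \<phi>st"
    and "lagrange_basis p \<Omega> Th \<phi>h" and "dual_basis p Th \<phi>h \<phi>sh"
    and "adapted_averaging p \<T> Tt Th \<tau>t \<tau>h"
  shows "\<forall>u \<in> spline_space p \<Omega> \<T>. \<forall>x \<in> closure \<Omega>.
           scott_zhang p Tt \<phi>t \<phi>st (\<lambda>z. the (\<tau>t z)) u x
         = scott_zhang p Th \<phi>h \<phi>sh (\<lambda>z. the (\<tau>h z)) u x"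
proof (intro ballI)
  fix u x assume u: "u \<in> spline_space p \<Omega> \<T>" and x: "x \<in> closure \<Omega>"
  have fine: "regular_triangulation \<Omega> Th"
    using assms(3,7) unfolding admissible_labelling_def by blast
  interpret nested_meshes \<Omega> \<T> Th
    using assms(6) fine nvb_nested[OF assms(3,4)] unfolding assms(5,7) by unfold_locales blast+
  have Tt: "Tt = fcc \<T> Th" by (rule assms(8))
  have "finite_element_mesh p \<Omega> Tt \<phi>t \<phi>st"
    unfolding Tt
    by (rule finite_element_mesh.intro[OF assms(2) fcc_finite fcc_simplex fcc_closure_subset fcc_nodes
        assms(9,10)[unfolded Tt]])
  moreover have "finite_element_mesh p \<Omega> Th \<phi>h \<phi>sh"
    by (rule finite_element_mesh.intro[OF assms(2) regular_finite[OF fine] regular_simplex[OF fine]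
        regular_closure_subset[OF fine] regular_nodes[OF fine] assms(11,12)])
  ultimately interpret finite_element_meshes p \<Omega> Tt \<phi>t \<phi>st Th \<phi>h \<phi>sh
    by (rule finite_element_meshes.intro)
  have "\<forall>T\<in>\<T>. \<exists>q. polyd p q \<and> (AE x in lebesgue_on T. u x = q x)"
    using u poly_le_imp_polyd unfolding spline_space_def by blast
  from bchoice[OF this] obtain q where
    q: "\<forall>T\<in>\<T>. polyd p (q T) \<and> (AE x in lebesgue_on T. u x = q T x)" ..
  have agree: "q S z = q T z" if "S \<in> \<T>" "z \<in> closure S" "T \<in> \<T>" "z \<in> closure T" for S T z
    using spline_elements_agree[OF assms(1,6), of u p q] u q that unfolding spline_space_def by blast
  note avg = assms(13)[unfolded Tt]
  let ?ct = "\<lambda>z. integral\<^sup>L (lebesgue_on (the (\<tau>t z))) (\<lambda>y. \<phi>st (the (\<tau>t z)) z y * u y)"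
  let ?ch = "\<lambda>z. integral\<^sup>L (lebesgue_on (the (\<tau>h z))) (\<lambda>y. \<phi>sh (the (\<tau>h z)) z y * u y)"
  have value_t: "integral\<^sup>L (lebesgue_on K) (\<lambda>y. \<phi>st K z y * u y) = q K z"
    if "K \<in> Tt - Th" "z \<in> nodes p Tt \<inter> closure K" for K z
    using M\<^sub>1.dual_reproduces[of K z "q K" u] q fcc_minus_fine[of K] that unfolding Tt by blast
  have value_h: "integral\<^sup>L (lebesgue_on T) (\<lambda>y. \<phi>sh T z y * u y) = q K z"
    if "T \<in> Th" "K \<in> \<T>" "T \<subset> K" "z \<in> nodes p Th \<inter> closure T" for T K z
  proof -
    have "AE x in lebesgue_on T. u x = q K x"
    proof -
      have sets: "T \<in> sets lebesgue" "K \<in> sets lebesgue"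
        using open_simplex_open[OF regular_simplex[OF fine that(1)]]
          open_simplex_open[OF regular_simplex[OF assms(6) that(2)]] by simp_all
      have "AE x in lebesgue_on K. u x = q K x" using q that(2) by blast
      then have "AE x in lebesgue. x \<in> K \<longrightarrow> u x = q K x"
        using sets(2) by (simp add: AE_restrict_space_iff)
      then have "AE x in lebesgue. x \<in> T \<longrightarrow> u x = q K x"
        by eventually_elim (use that(3) in blast)
      then show ?thesis using sets(1) by (simp add: AE_restrict_space_iff)
    qed
    then show ?thesis using M\<^sub>2.dual_reproduces[of T z "q K" u] q that by blast
  qed
  \<comment> \<open>The averaging element may be another coarse element \<open>K'\<close> at
    \<open>z\<close>; \<open>agree\<close> makes the value independent of this choice.\<close>
  have ct: "?ct z = q K z" if K: "K \<in> Tt - Th" "z \<in> nodes p Tt \<inter> closure K" for K z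
  proof -
    obtain K' where K': "K' \<in> Tt - Th" "z \<in> closure K'" "\<tau>t z = Some K'"
      using adapted_coarse[OF avg, of z K] K unfolding Tt by blast
    then have "?ct z = q K' z" using value_t K(2) by simp
    also have "\<dots> = q K z"
    proof (rule agree)
      show "K' \<in> \<T>" "K \<in> \<T>" using K(1) K'(1) fcc_minus_fine unfolding Tt by blast+
    qed (use K(2) K'(2) in blast)+
    finally show ?thesis .
  qed
  have ch: "?ch z = q K z" if K: "K \<in> Tt - Th" "z \<in> nodes p Th \<inter> closure K" for K z
  proof -
    obtain T K' where T: "T \<in> Th" "K' \<in> \<T>" "T \<subset> K'" "z \<in> closure T" "\<tau>h z = Some T"
      using adapted_fine[OF avg, of z K] K unfolding Tt by blast
    then have "?ch z = q K' z" using value_h[OF T(1-3)] K(2) by simp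
    also have "\<dots> = q K z"
    proof (rule agree[OF T(2)])
      show "z \<in> closure K'" using T(3,4) closure_mono[of T K'] by blast
      show "K \<in> \<T>" "z \<in> closure K" using K fcc_minus_fine[of K] unfolding Tt by blast+
    qed
    finally show ?thesis .
  qed
  have common: "?ct z = ?ch z" if T: "T \<in> Th \<inter> Tt" and z: "z \<in> nodes p Tt \<inter> closure T" for T z
  proof -
    have zh: "z \<in> nodes p Th" using common_nodes[of T] T z by blast
    from adapted_common[OF avg, of z T] T z consider
        T' where "T' \<in> Th \<inter> Tt" "z \<in> closure T'" "\<tau>t z = Some T'" "\<tau>h z = Some T'"
      | T' K where "T' \<in> Th" "K \<in> Tt - Th" "T' \<subset> K" "z \<in> closure T'" "\<tau>h z = Some T'" "\<tau>t z = Some K"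
      unfolding Tt by blast
    then show ?thesis
    proof cases
      case 1
      then show ?thesis using common_functional[of T' z u] z by simp
    next
      case 2
      \<comment> \<open>A fine-coarse pair: \<open>T'\<close> lies in \<open>K\<close>, so both
        averages return the value at \<open>z\<close> of the same polynomial
        \<open>q K\<close>.\<close>
      have "?ch z = q K z" using value_h[of T' K z] fcc_minus_fine[of K] 2 zh unfolding Tt by simp
      moreover have "z \<in> closure K" using 2 closure_mono[of T' K] by blast
      then have "?ct z = q K z" using value_t[of K z] 2 z by simp
      ultimately show ?thesis by simp
    qed
  qed
  obtain T where T: "T \<in> Th" "x \<in> closure T" using x regular_cover[OF fine] by blast
  show "scott_zhang p Tt \<phi>t \<phi>st (\<lambda>z. the (\<tau>t z)) u x = scott_zhang p Th \<phi>h \<phi>sh (\<lambda>z. the (\<tau>h z)) u x"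
  proof (cases "T \<in> Tt")
    case True
    \<comment> \<open>Nodes and nodal functions coincide on the closure of a common element, so
      equal coefficients suffice; \<open>u\<close> itself may fail to be reproduced here.\<close>
    have "(\<Sum>z\<in>nodes p Tt \<inter> closure T. \<phi>t z x * ?ct z) = (\<Sum>z\<in>nodes p Th \<inter> closure T. \<phi>h z x * ?ch z)"
      using common[of T] common_basis[of T] common_nodes[of T] True T by (intro sum.cong) auto
    then show ?thesis
      using M\<^sub>1.scott_zhang_local[OF True T(2)] M\<^sub>2.scott_zhang_local[OF T] by simp
  next
    case False
    \<comment> \<open>Both sides equal \<open>q K x\<close>: the coarsened mesh interpolates
      \<open>q K\<close> over the closure of \<open>K\<close>, the uniform mesh over the closure of
      the smaller \<open>T\<close>.\<close>
    then obtain K where K: "K \<in> \<T>" "T \<subset> K" "K \<in> Tt - Th"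
      using element_of_fcc[OF T(1)] unfolding Tt by blast
    have cl: "closure T \<subseteq> closure K" using K(2) by (intro closure_mono) blast
    have poly: "polyd p (q K)" using q K(1) by blast
    have "scott_zhang p Tt \<phi>t \<phi>st (\<lambda>z. the (\<tau>t z)) u x = (\<Sum>z\<in>nodes p Tt \<inter> closure K. \<phi>t z x * ?ct z)"
      using M\<^sub>1.scott_zhang_local[of K x] K T cl by blast
    also have "\<dots> = (\<Sum>z\<in>nodes p Tt \<inter> closure K. q K z * \<phi>t z x)"
      using ct[OF K(3)] by (intro sum.cong) auto
    also have "\<dots> = q K x"
      using M\<^sub>1.interpolation[of K "q K" x] poly K T cl by auto
    also have "\<dots> = (\<Sum>z\<in>nodes p Th \<inter> closure T. q K z * \<phi>h z x)"
      using M\<^sub>2.interpolation[OF T(1) poly T(2)] .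
    also have "\<dots> = (\<Sum>z\<in>nodes p Th \<inter> closure T. \<phi>h z x * ?ch z)"
      using ch[OF K(3)] cl by (intro sum.cong) auto
    also have "\<dots> = scott_zhang p Th \<phi>h \<phi>sh (\<lambda>z. the (\<tau>h z)) u x"
      using M\<^sub>2.scott_zhang_local[OF T] by simp
    finally show ?thesis .
  qed
qed

end
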